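(* Let $u\in L_2[0,\pi]$ be complex-valued, let $q=u'$ (derivative in the sense of distributions), and let $L$ be the Sturm--Liouville operator $Ly=-y''+q(x)y$ on $L_2[0,\pi]$ with Dirichlet--Neumann boundary conditions $y(0)=0$, $y'(\pi)=0$, defined via regularization as described in the context. Then, with a suitable enumeration $\{\lambda_n\}_{n\in\mathbb N}$ of the eigenvalues of $L$ and $\lambda_n^{1/2}$ the principal branch of the square root, there is a constant $M>0$ depending only on $u$ such that for all sufficiently large $n$ $$\lambda_n^{1/2}=n-\tfrac12-\frac1\pi\, v\big(\pi,(n-\tfrac12)^2\big)+\rho(\lambda_n),\qquad |\rho(\lambda_n)|\le M\,\gamma^2(\lambda_n),$$ where $v$ and $\gamma$ are the functions defined in the context.
   Context: Regularized operator: for $y$ with $y$ absolutely continuous, put $y^{[1]}=y'-u y$ (quasi-derivative). The operator $L$ has domain $\{y:\ y,\,y^{[1]}\in AC[0,\pi],\ \ell y:=-(y^{[1]})'-u\,y^{[1]}-u^2y\in L_2[0,\pi],\ y(0)=0,\ y^{[1]}(\pi)=0\}$ and acts by $Ly=\ell y$; for smooth $u$ this coincides with $-y''+u'y$, and the condition $y'(\pi)=0$ is understood as $y^{[1]}(\pi)=0$. The spectrum of $L$ is discrete. Equivalently, $-y''+qy=\lambda y$ is the system $y_1'=u y_1+y_2$, $y_2'=-(\lambda+u^2)y_1-u y_2$ with $y_1=y$, $y_2=y^{[1]}$. Notation: for $x\in[0,\pi]$ and complex $\lambda\neq0$ (with $\lambda^{1/2}$ the principal branch), $$v(x,\lambda)=\int_0^x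 u(t)\sin(2\lambda^{1/2}t)\,dt+\tfrac12\lambda^{-1/2}\int_0^x u^2(t)\,dt+2\int_0^x\!\!\int_0^t u(t)u(s)\cos(2\lambda^{1/2}t)\sin(2\lambda^{1/2}s)\,ds\,dt-\tfrac12\lambda^{-1/2}\int_0^x u^2(t)\cos(2\lambda^{1/2}t)\,dt,$$ $$\gamma(\lambda)=\sup_{0\le x\le\pi}\Big(\Big|\int_0^x u(t)\sin(2\lambda^{1/2}t)dt\Big|+\Big|\int_0^x u(t)\cos(2\lambda^{1/2}t)dt\Big|+2\Big|\int_0^x\!\!\int_0^t u(t)u(s)\cos(2\lambda^{1/2}t)\sin(2\lambda^{1/2}s)\,ds\,dt\Big|+\tfrac12\Big|\lambda^{-1/2}\int_0^x u^2(t)\cos(2\lambda^{1/2}t)dt\Big|\Big)+|\lambda|^{-1/2}\|u\|_{L_2}^2.$$ *)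

theory Defs
  imports "HOL-Complex_Analysis.Complex_Analysis"
begin

definition L2_on_0pi :: "(real \<Rightarrow> complex) \<Rightarrow> bool" where
  "L2_on_0pi u \<longleftrightarrow> u measurable_on {0..pi} \<and> (\<lambda>x. (cmod (u x))^2) integrable_on {0..pi}"

text \<open>(y1,y2) = (y, y^[1]) is an absolutely continuous (Caratheodory) solution on [0,pi] of
  y1' = u y1 + y2,  y2' = -(lam + u^2) y1 - u y2, written in integral form with
  Lebesgue (absolutely) integrable integrands.\<close>
definition reg_sol :: "(real \<Rightarrow> complex) \<Rightarrow> complex \<Rightarrow> (real \<Rightarrow> complex) \<Rightarrow> (real \<Rightarrow> complex) \<Rightarrow> bool" where
  "reg_sol u lam y1 y2 \<longleftrightarrow>
     (\<lambda>t. u t * y1 t + y2 t) absolutely_integrable_on {0..pi} \<and>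
     (\<lambda>t. - (lam + (u t)^2) * y1 t - u t * y2 t) absolutely_integrable_on {0..pi} \<and>
     (\<forall>x\<in>{0..pi}. y1 x = y1 0 + integral {0..x} (\<lambda>t. u t * y1 t + y2 t)) \<and>
     (\<forall>x\<in>{0..pi}. y2 x = y2 0 + integral {0..x} (\<lambda>t. - (lam + (u t)^2) * y1 t - u t * y2 t))"

definition is_eigenvalue :: "(real \<Rightarrow> complex) \<Rightarrow> complex \<Rightarrow> bool" where
  "is_eigenvalue u lam \<longleftrightarrow>
     (\<exists>y1 y2. reg_sol u lam y1 y2 \<and> y1 0 = 0 \<and> y2 pi = 0 \<and> (\<exists>x\<in>{0..pi}. y1 x \<noteq> 0))"

definition char_fn :: "(real \<Rightarrow> complex) \<Rightarrow> complex \<Rightarrow> complex" where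
  "char_fn u lam = (THE c. \<exists>y1 y2. reg_sol u lam y1 y2 \<and> y1 0 = 0 \<and> y2 0 = 1 \<and> y2 pi = c)"

definition eig_mult :: "(real \<Rightarrow> complex) \<Rightarrow> complex \<Rightarrow> nat" where
  "eig_mult u lam = nat (zorder (char_fn u) lam)"

definition eig_enum :: "(real \<Rightarrow> complex) \<Rightarrow> (nat \<Rightarrow> complex) \<Rightarrow> bool" where
  "eig_enum u lams \<longleftrightarrow>
     (\<forall>mu. if is_eigenvalue u mu
           then finite {n. n \<ge> 1 \<and> lams n = mu} \<and> card {n. n \<ge> 1 \<and> lams n = mu} = eig_mult u mu
           else {n. n \<ge> 1 \<and> lams n = mu} = {})"

definition vfun :: "(real \<Rightarrow> complex) \<Rightarrow> real \<Rightarrow> complex \<Rightarrow> complex" where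
  "vfun u x lam =
     integral {0..x} (\<lambda>t. u t * sin (2 * csqrt lam * of_real t))
   + 1 / 2 * (1 / csqrt lam) * integral {0..x} (\<lambda>t. (u t)^2)
   + 2 * integral {0..x} (\<lambda>t. integral {0..t} (\<lambda>s.
          u t * u s * cos (2 * csqrt lam * of_real t) * sin (2 * csqrt lam * of_real s)))
   - 1 / 2 * (1 / csqrt lam) * integral {0..x} (\<lambda>t. (u t)^2 * cos (2 * csqrt lam * of_real t))"

definition gammafun :: "(real \<Rightarrow> complex) \<Rightarrow> complex \<Rightarrow> real" where
  "gammafun u lam =
     (SUP x\<in>{0..pi}.
        cmod (integral {0..x} (\<lambda>t. u t * sin (2 * csqrt lam * of_real t)))
      + cmod (integral {0..x} (\<lambda>t. u t * cos (2 * csqrt lam * of_real t)))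
      + 2 * cmod (integral {0..x} (\<lambda>t. integral {0..t} (\<lambda>s.
          u t * u s * cos (2 * csqrt lam * of_real t) * sin (2 * csqrt lam * of_real s))))
      + 1 / 2 * cmod ((1 / csqrt lam) * integral {0..x} (\<lambda>t. (u t)^2 * cos (2 * csqrt lam * of_real t))))
   + (1 / sqrt (cmod lam)) * integral {0..pi} (\<lambda>t. (cmod (u t))^2)"

end

theory Submission
  imports Defs
begin

text \<open>Write \<open>\<lambda> = k^2\<close>. In the variables \<open>P = exp (- i k x) (y2 + i k y1)\<close> and \<open>Q = exp (i k x) (y2 - i k y1)\<close> the
  system becomes \<open>P' = - u e' Q - a (P - e' Q)\<close>, \<open>Q' = - u e P - a (e P - Q)\<close> with \<open>e = exp (2 i k x)\<close>,
  \<open>e' = exp (- 2 i k x)\<close> and \<open>a = u^2 / (2 i k)\<close>, and \<open>\<lambda>\<close> is an eigenvalue iff \<open>exp (2 i k \<pi>) P \<pi> + Q \<pi> = 0\<close>.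
  For \<open>Im k \<ge> 0\<close> and \<open>|k|\<close> large, the Riemann-Lebesgue lemma and Gronwall's inequality make \<open>e (P - 1)\<close> and
  \<open>Q - 1\<close> uniformly small, so Rouche's theorem on the circles \<open>|\<lambda>| = N^2\<close> compares the characteristic function
  with that of the zero potential, \<open>cos (\<pi> k)\<close>: for large \<open>n\<close> there is exactly one eigenvalue, a simple one, with
  \<open>(n - 1)^2 < |\<lambda>| < n^2\<close>, and its root is close to \<open>n - 1/2\<close>. At such a root \<open>k = n - 1/2 + \<epsilon>\<close> the equation reads
  \<open>exp (2 \<pi> i \<epsilon>) = Q \<pi> / P \<pi>\<close>. Iterating the system once more gives \<open>P \<pi> - Q \<pi> = 2 i v(\<pi>, \<lambda>) + O(\<gamma>^2)\<close> with
  \<open>P - 1\<close>, \<open>Q - 1\<close> and \<open>\<epsilon>\<close> of size \<open>O(\<gamma>)\<close>, whence \<open>\<epsilon> = - v(\<pi>, \<lambda>) / \<pi> + O(\<gamma>^2)\<close>. Replacing \<open>\<lambda>\<close> by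
  \<open>(n - 1/2)^2\<close> in \<open>v\<close> costs \<open>O(|\<epsilon>| \<gamma>)\<close>, by integration by parts.\<close>

section \<open>Antiderivatives of Lebesgue integrable functions\<close>


text \<open>As \<open>u\<close> is only square integrable, the system holds in integrated form only.
  \<open>antideriv b F f\<close> says that \<open>F\<close> is absolutely continuous with derivative
  \<open>f\<close>; its product rule supplies every integration by parts below. The growth of the
  exponentials shapes the estimates. For Im k > 0 the factor e' grows and so may P - 1; only with
  the weight e does the kernel e(x) e'(t), t <= x, stay bounded. Counting takes place in this half
  plane, where smallness without a rate is enough. The roots then lie in a strip, where both
  exponentials are bounded, the weight can be removed, and the errors are bounded by powers of one
  number \<open>b\<close>, with constants depending only on \<open>u\<close> and the strip. The
  factor 2 of the double integral in v comes from taking the difference P - Q: the second iterates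
  leave the difference of two double integrals with sin and cos exchanged, and the sum of these two
  is a product of single integrals, of size gamma^2. As gamma is taken at the eigenvalue but v at (n
  - 1/2)^2, the change of v has to be estimated by oscillatory integrals at the eigenvalue.\<close>

definition antideriv :: "real \<Rightarrow> (real \<Rightarrow> 'a::euclidean_space) \<Rightarrow> (real \<Rightarrow> 'a) \<Rightarrow> bool" where
  "antideriv b F f \<longleftrightarrow> f absolutely_integrable_on {0..b} \<and> (\<forall>x\<in>{0..b}. F x - F 0 = integral {0..x} f)"

lemma absint_sub:
  fixes f :: "real \<Rightarrow> 'a::euclidean_space"
  assumes "f absolutely_integrable_on {0..b}" "0 \<le> x" "y \<le> b"
  shows "f absolutely_integrable_on {x..y}"
  using assms(2,3) by (intro absolutely_integrable_on_subinterval[OF assms(1)]) auto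

lemma absint_int:
  fixes f :: "real \<Rightarrow> 'a::euclidean_space"
  assumes "f absolutely_integrable_on {0..b}" "0 \<le> x" "y \<le> b"
  shows "f integrable_on {x..y}" "(\<lambda>t. norm (f t)) integrable_on {x..y}"
  using absint_sub[OF assms] by (auto simp: absolutely_integrable_on_def)

lemma absint_mult_cont:
  fixes f g :: "real \<Rightarrow> 'a::{euclidean_space,real_normed_field}"
  assumes "f absolutely_integrable_on {a..b}" "continuous_on {a..b} g"
  shows "(\<lambda>t. f t * g t) absolutely_integrable_on {a..b}" "(\<lambda>t. g t * f t) absolutely_integrable_on {a..b}"
proof -
  have "bounded (g ` {a..b})" using assms(2) compact_continuous_image compact_imp_bounded by blast
  moreover have "g \<in> borel_measurable (lebesgue_on {a..b})"
    using assms(2) by (intro continuous_imp_measurable_on_sets_lebesgue) auto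
  moreover have "bilinear (\<lambda>x y::'a. x * y)" by (simp add: bilinear_conv_bounded_bilinear bounded_bilinear_mult)
  ultimately show "(\<lambda>t. g t * f t) absolutely_integrable_on {a..b}"
    using assms(1) by (intro absolutely_integrable_bounded_measurable_product[where h="(*)"]) auto
  then show "(\<lambda>t. f t * g t) absolutely_integrable_on {a..b}" by (simp add: mult.commute)
qed

lemma integral_norm_le_absint:
  fixes f :: "real \<Rightarrow> 'a::euclidean_space"
  assumes "f absolutely_integrable_on {0..b}" "0 \<le> x" "y \<le> b"
    and "\<And>t. t \<in> {x..y} \<Longrightarrow> norm (f t) \<le> g t" "g absolutely_integrable_on {0..b}"
  shows "norm (integral {x..y} f) \<le> integral {x..y} g"
  using assms absint_int[OF assms(1-3)] absint_int[OF assms(5,2,3)]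
  by (intro integral_norm_bound_integral) auto

lemma integral_mono_absint:
  fixes f g :: "real \<Rightarrow> real"
  assumes "f absolutely_integrable_on {0..b}" "g absolutely_integrable_on {0..b}" "0 \<le> x" "y \<le> b"
    and "\<And>t. t \<in> {x..y} \<Longrightarrow> f t \<le> g t"
  shows "integral {x..y} f \<le> integral {x..y} g"
  using assms absint_int[OF assms(1,3,4)] absint_int[OF assms(2,3,4)]
  by (intro integral_le) auto

lemma antideriv_indefinite:
  assumes "f absolutely_integrable_on {0..b}"
  shows "antideriv b (\<lambda>x. c + integral {0..x} f) f"
  using assms unfolding antideriv_def by auto

lemma antideriv_eq:
  assumes "antideriv b F f" "x \<in> {0..b}"
  shows "F x - F 0 = integral {0..x} f"
  using assms by (auto simp: antideriv_def)

lemma antideriv_cong: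
  assumes "antideriv b F f" "\<And>x. x \<in> {0..b} \<Longrightarrow> F x = G x" "\<And>x. x \<in> {0..b} \<Longrightarrow> f x = g x"
  shows "antideriv b G g"
proof -
  have fi: "f absolutely_integrable_on {0..b}" using assms(1) by (simp add: antideriv_def)
  have "g absolutely_integrable_on {0..b}"
    using assms(3) by (intro absolutely_integrable_spike[OF fi, of "{}" g]) auto
  moreover have "G x - G 0 = integral {0..x} g" if "x \<in> {0..b}" for x
  proof -
    have "integral {0..x} f = integral {0..x} g"
      using assms(3) that by (intro integral_cong) auto
    moreover have "F x - F 0 = integral {0..x} f" "F x = G x" "F 0 = G 0"
      using antideriv_eq[OF assms(1) that] assms(2)[of 0] assms(2)[of x] that by auto
    ultimately show ?thesis by simp
  qed
  ultimately show ?thesis unfolding antideriv_def by auto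
qed

lemma antideriv_diff:
  assumes "antideriv b F f" "0 \<le> x" "x \<le> y" "y \<le> b"
  shows "F y - F x = integral {x..y} f"
proof -
  have "integral {0..x} f + integral {x..y} f = integral {0..y} f"
    using assms absint_int(1)[of b f 0 y] unfolding antideriv_def
    by (intro Henstock_Kurzweil_Integration.integral_combine) auto
  moreover have "F x - F 0 = integral {0..x} f" "F y - F 0 = integral {0..y} f"
    using assms unfolding antideriv_def by auto
  ultimately show ?thesis by (simp add: algebra_simps)
qed

lemma antideriv_cont:
  assumes "antideriv b F f"
  shows "continuous_on {0..b} F"
proof -
  have "f integrable_on {0..b}" using assms absint_int(1)[of b f 0 b] unfolding antideriv_def by auto
  then have "continuous_on {0..b} (\<lambda>x. F 0 + integral {0..x} f)"
    by (intro continuous_intros indefinite_integral_continuous_1)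
  moreover have "F 0 + integral {0..x} f = F x" if "x \<in> {0..b}" for x
    using assms that unfolding antideriv_def by (metis add.commute diff_add_cancel)
  ultimately show ?thesis by (metis (no_types, lifting) continuous_on_cong)
qed

lemma antideriv_absint: "antideriv b F f \<Longrightarrow> f absolutely_integrable_on {0..b}"
  by (simp add: antideriv_def)

lemma antideriv_add:
  assumes "antideriv b F f" "antideriv b G g"
  shows "antideriv b (\<lambda>x. F x + G x) (\<lambda>x. f x + g x)"
proof -
  have "integral {0..x} (\<lambda>x. f x + g x) = integral {0..x} f + integral {0..x} g" if "x \<in> {0..b}" for x
    using assms that absint_int(1)[of b _ 0 x] unfolding antideriv_def by (intro integral_add) auto
  moreover have "F x + G x - (F 0 + G 0) = (F x - F 0) + (G x - G 0)" for x by simp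
  moreover have "(\<lambda>x. f x + g x) absolutely_integrable_on {0..b}"
    using assms unfolding antideriv_def by (intro set_integral_add) auto
  ultimately show ?thesis using assms unfolding antideriv_def by (simp only:) auto
qed

lemma antideriv_const: "antideriv b (\<lambda>x. c) (\<lambda>x. 0)"
  unfolding antideriv_def by auto

lemma antideriv_FTC:
  fixes F :: "real \<Rightarrow> 'a::euclidean_space"
  assumes "\<And>x. (F has_vector_derivative f x) (at x)" "continuous_on UNIV f"
  shows "antideriv b F f"
proof -
  have "f absolutely_integrable_on {0..b}"
    by (meson absolutely_integrable_continuous_real assms(2) continuous_on_subset subset_UNIV)
  moreover have "integral {0..x} f = F x - F 0" if "x \<in> {0..b}" for x
    using that assms(1) by (intro integral_unique fundamental_theorem_of_calculus) (auto intro: has_vector_derivative_at_within)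
  ultimately show ?thesis unfolding antideriv_def by auto
qed

lemma antideriv_bounded_linear:
  assumes "antideriv b F f" "bounded_linear h"
  shows "antideriv b (\<lambda>x. h (F x)) (\<lambda>x. h (f x))"
proof -
  interpret bounded_linear h by fact
  have "integral {0..x} (\<lambda>x. h (f x)) = h (integral {0..x} f)" if "x \<in> {0..b}" for x
    using assms that absint_int(1)[of b f 0 x] integral_linear[of f "{0..x}" h] unfolding antideriv_def o_def by auto
  moreover have "(\<lambda>x. h (f x)) absolutely_integrable_on {0..b}"
    using assms absolutely_integrable_linear[where f=f and s="{0..b}" and h=h] unfolding antideriv_def o_def by auto
  ultimately show ?thesis using assms unfolding antideriv_def by (metis diff)
qed

lemma antideriv_cmult:
  fixes F :: "real \<Rightarrow> 'a::{euclidean_space,real_normed_field}"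
  assumes "antideriv b F f"
  shows "antideriv b (\<lambda>x. c * F x) (\<lambda>x. c * f x)"
  using antideriv_bounded_linear[OF assms bounded_linear_mult_right[of c]] by simp

text \<open>The error \<open>F G - \<integral>(f G + F g)\<close> over a short interval is at most \<open>e\<close> times the integral of
  \<open>|f| + |g|\<close>, with \<open>e\<close> the oscillation of \<open>F\<close> and \<open>G\<close>; this bound is additive in the interval.\<close>
lemma antideriv_mult:
  fixes F G :: "real \<Rightarrow> 'a::{euclidean_space,real_normed_field}"
  assumes F: "antideriv b F f" and G: "antideriv b G g"
  shows "antideriv b (\<lambda>x. F x * G x) (\<lambda>x. f x * G x + F x * g x)"
proof -
  note cF = antideriv_cont[OF F] and cG = antideriv_cont[OF G]
  note fi = antideriv_absint[OF F] and gi = antideriv_absint[OF G]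
  define h where "h = (\<lambda>x. f x * G x + F x * g x)"
  have hi: "h absolutely_integrable_on {0..b}"
    unfolding h_def by (rule set_integral_add(1)[OF absint_mult_cont(1)[OF fi cG] absint_mult_cont(2)[OF gi cF]])
  define w where "w = (\<lambda>x. norm (f x) + norm (g x))"
  have wi: "w absolutely_integrable_on {0..b}"
    unfolding w_def by (rule set_integral_add(1)[OF set_integrable_norm[OF fi] set_integrable_norm[OF gi]])
  define H where "H = (\<lambda>x y. F y * G y - F x * G x - integral {x..y} h)"
  have H0: "norm (H x y) \<le> e * integral {x..y} w"
    if xy: "0 \<le> x" "x \<le> y" "y \<le> b" and e: "\<And>s t. s \<in> {x..y} \<Longrightarrow> t \<in> {x..y} \<Longrightarrow> norm (F s - F t) \<le> e \<and> norm (G s - G t) \<le> e"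
    for x y e
  proof -
    have i1: "(\<lambda>t. f t * G y) integrable_on {x..y}" "(\<lambda>t. F x * g t) integrable_on {x..y}" "h integrable_on {x..y}"
      using absint_int(1)[OF hi xy(1,3)] absint_int(1)[OF fi xy(1,3)] absint_int(1)[OF gi xy(1,3)]
      by (auto intro: integrable_on_mult_left integrable_on_mult_right)
    have "H x y = (F y - F x) * G y + F x * (G y - G x) - integral {x..y} h"
      by (simp add: H_def algebra_simps)
    also have "\<dots> = integral {x..y} (\<lambda>t. f t * G y) + integral {x..y} (\<lambda>t. F x * g t) - integral {x..y} h"
      using antideriv_diff[OF F xy] antideriv_diff[OF G xy] by simp
    also have "\<dots> = integral {x..y} (\<lambda>t. f t * G y + F x * g t - h t)"
      using i1 by (simp add: integral_add integral_diff integrable_add)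
    also have "norm \<dots> \<le> integral {x..y} (\<lambda>t. e * w t)"
    proof (rule integral_norm_bound_integral)
      show "(\<lambda>t. f t * G y + F x * g t - h t) integrable_on {x..y}"
        using i1 by (intro integrable_diff integrable_add)
      show "(\<lambda>t. e * w t) integrable_on {x..y}"
        using absint_int(1)[OF wi xy(1,3)] by (intro integrable_on_mult_right)
      fix t assume t: "t \<in> {x..y}"
      have "f t * G y + F x * g t - h t = f t * (G y - G t) + (F x - F t) * g t"
        by (simp add: h_def algebra_simps)
      also have "norm \<dots> \<le> norm (f t) * norm (G y - G t) + norm (F x - F t) * norm (g t)"
        using norm_triangle_ineq[of "f t * (G y - G t)" "(F x - F t) * g t"] by (simp add: norm_mult)
      also have "\<dots> \<le> norm (f t) * e + e * norm (g t)"
        using e[of y t] e[of x t] t xy by (intro add_mono mult_left_mono mult_right_mono) auto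
      finally show "norm (f t * G y + F x * g t - h t) \<le> e * w t" by (simp add: w_def algebra_simps)
    qed
    finally show ?thesis by simp
  qed
  have Hadd: "H x z = H x y + H y z" if "0 \<le> x" "x \<le> y" "y \<le> z" "z \<le> b" for x y z
    using Henstock_Kurzweil_Integration.integral_combine[of x y z h] absint_int(1)[OF hi, of x z] that
    by (simp add: H_def flip: add_eq_0_iff) (metis minus_add_distrib uminus_add_conv_diff add.commute)
  have wadd: "integral {x..z} w = integral {x..y} w + integral {y..z} w" if "0 \<le> x" "x \<le> y" "y \<le> z" "z \<le> b" for x y z
    using Henstock_Kurzweil_Integration.integral_combine[of x y z w] absint_int(1)[OF wi, of x z] that by simp
  have small: "norm (H 0 x) \<le> e * integral {0..x} w" if x: "x \<in> {0..b}" and e: "e > 0" for x e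
  proof -
    let ?P = "\<lambda>s t. 0 \<le> s \<and> s \<le> t \<and> t \<le> b \<longrightarrow> norm (H s t) \<le> e * integral {s..t} w"
    have uF: "uniformly_continuous_on {0..b} F" and uG: "uniformly_continuous_on {0..b} G"
      using cF cG compact_uniformly_continuous by blast+
    obtain d1 where d1: "d1 > 0" "\<And>s t. s \<in> {0..b} \<Longrightarrow> t \<in> {0..b} \<Longrightarrow> dist s t < d1 \<Longrightarrow> dist (F s) (F t) < e"
      using uF e unfolding uniformly_continuous_on_def by metis
    obtain d2 where d2: "d2 > 0" "\<And>s t. s \<in> {0..b} \<Longrightarrow> t \<in> {0..b} \<Longrightarrow> dist s t < d2 \<Longrightarrow> dist (G s) (G t) < e"
      using uG e unfolding uniformly_continuous_on_def by metis
    have "?P 0 x"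
    proof (rule Bolzano[of 0 x ?P])
      show "0 \<le> x" using x by simp
      fix r s t assume "?P r s" "?P s t" and rs: "r \<le> s" "s \<le> t"
      then show "?P r t"
        using Hadd[of r s t] wadd[of r s t] norm_triangle_ineq[of "H r s" "H s t"] rs
        by (auto simp: algebra_simps)
    next
      fix c :: real
      have "?P s t" if "t - s < min d1 d2" for s t
      proof
        assume st: "0 \<le> s \<and> s \<le> t \<and> t \<le> b"
        have "norm (F p - F q) \<le> e \<and> norm (G p - G q) \<le> e" if "p \<in> {s..t}" "q \<in> {s..t}" for p q
        proof -
          have "dist p q < min d1 d2" "p \<in> {0..b}" "q \<in> {0..b}" using that st \<open>t - s < min d1 d2\<close> by (auto simp: dist_real_def)
          then show ?thesis using d1(2)[of p q] d2(2)[of p q] by (simp add: dist_norm less_imp_le)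
        qed
        then show "norm (H s t) \<le> e * integral {s..t} w" using st H0[of s t e] by blast
      qed
      then show "\<exists>d>0. \<forall>s t. s \<le> c \<and> c \<le> t \<and> t - s < d \<longrightarrow> ?P s t"
        using d1(1) d2(1) by (intro exI[of _ "min d1 d2"]) auto
    qed
    then show ?thesis using x by auto
  qed
  have "H 0 x = 0" if x: "x \<in> {0..b}" for x
  proof -
    let ?I = "integral {0..x} w"
    have I0: "?I \<ge> 0" by (intro integral_nonneg absint_int(1)[OF wi]) (use x in \<open>auto simp: w_def\<close>)
    have "norm (H 0 x) \<le> 0"
    proof (rule field_le_epsilon)
      fix e :: real assume e: "e > 0"
      have "norm (H 0 x) \<le> (e / (?I + 1)) * ?I" using small[OF x, of "e / (?I+1)"] e I0 by simp
      also have "\<dots> \<le> e" using e I0 by (simp add: field_simps)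
      finally show "norm (H 0 x) \<le> 0 + e" by simp
    qed
    then show ?thesis by simp
  qed
  then show ?thesis using hi unfolding antideriv_def H_def h_def by simp
qed

lemma antideriv_power:
  fixes W :: "real \<Rightarrow> 'a::{euclidean_space,real_normed_field}"
  assumes "antideriv b W w"
  shows "antideriv b (\<lambda>x. W x ^ Suc n) (\<lambda>x. of_nat (Suc n) * (w x * W x ^ n))"
proof (induction n)
  case 0 show ?case using assms by simp
next
  case (Suc n)
  show ?case by (rule antideriv_cong[OF antideriv_mult[OF assms Suc]]) (auto simp: algebra_simps)
qed

text \<open>The product rule for antiderivatives replaces the substitution rule, \<open>w\<close>
  being merely integrable. Both Gronwall's iteration and the Picard bound produce these terms and
  sum them to an exponential.\<close>

lemma integral_power_fact:
  fixes w :: "real \<Rightarrow> real"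
  assumes "w absolutely_integrable_on {0..b}" "x \<in> {0..b}"
  shows "integral {0..x} (\<lambda>t. w t * (integral {0..t} w ^ n / fact n)) = integral {0..x} w ^ Suc n / fact (Suc n)"
proof -
  have A: "antideriv b (\<lambda>x. 0 + integral {0..x} w) w" by (rule antideriv_indefinite[OF assms(1)])
  have B: "antideriv b (\<lambda>x. (1 / fact (Suc n)) * (0 + integral {0..x} w) ^ Suc n) (\<lambda>x. (1 / fact (Suc n)) * (real (Suc n) * (w x * (0 + integral {0..x} w) ^ n)))"
    by (rule antideriv_cmult[OF antideriv_power[OF A]])
  have eq: "(1 / fact (Suc n)) * (real (Suc n) * c) = c / fact n" for c :: real
    by (simp add: field_simps del: of_nat_Suc)
  have "integral {0..x} (\<lambda>t. w t * integral {0..t} w ^ n / fact n) = 1 / fact (Suc n) * integral {0..x} w ^ Suc n"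
    using B assms(2) unfolding antideriv_def eq by simp
  then show ?thesis by simp
qed

text \<open>Inserting the inequality into itself \<open>n\<close> times gives a partial sum of
  \<open>c * exp W\<close>, with \<open>W\<close> the integral of \<open>w\<close>, plus a remainder
  \<open>B * W^n / n!\<close>, where \<open>B\<close> is any upper bound of \<open>E\<close>; the
  remainder tends to 0.\<close>

lemma gronwall:
  fixes w E :: "real \<Rightarrow> real"
  assumes w: "w absolutely_integrable_on {0..b}" "\<And>t. t \<in> {0..b} \<Longrightarrow> 0 \<le> w t"
    and E: "continuous_on {0..b} E"
    and c: "c \<ge> 0"
    and ineq: "\<And>x. x \<in> {0..b} \<Longrightarrow> E x \<le> c + integral {0..x} (\<lambda>t. w t * E t)"
    and x: "x \<in> {0..b}"
  shows "E x \<le> c * exp (integral {0..x} w)"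
proof -
  define W where "W = (\<lambda>x. integral {0..x} w)"
  have aW: "antideriv b W w" using antideriv_indefinite[OF w(1), of 0] by (simp add: W_def)
  have cW: "continuous_on {0..b} W" by (rule antideriv_cont[OF aW])
  have "compact (E ` {0..b})" using E compact_continuous_image by blast
  then have "bounded (E ` {0..b})" by (rule compact_imp_bounded)
  then obtain B where "\<And>t. t \<in> {0..b} \<Longrightarrow> norm (E t) \<le> B" "B > 0"
    unfolding bounded_pos by (auto simp del: atLeastAtMost_iff)
  then have B: "\<And>t. t \<in> {0..b} \<Longrightarrow> E t \<le> B" by fastforce
  have iE: "(\<lambda>t. w t * E t) absolutely_integrable_on {0..b}" using absint_mult_cont(1)[OF w(1) E] .
  have step: "E x \<le> c * (\<Sum>j<n. W x ^ j / fact j) + B * (W x ^ n / fact n)" if "x \<in> {0..b}" for x n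
    using that
  proof (induction n arbitrary: x)
    case 0 then show ?case using B by simp
  next
    case (Suc n)
    have i1: "(\<lambda>t. w t * (W t ^ j / fact j)) integrable_on {0..x}" for j
    proof -
      have "continuous_on {0..b} (\<lambda>t. W t ^ j / fact j)" by (intro continuous_intros cW) auto
      from absint_int(1)[OF absint_mult_cont(1)[OF w(1) this], of 0 x] show ?thesis using Suc.prems by auto
    qed
    have "E x \<le> c + integral {0..x} (\<lambda>t. w t * E t)" using ineq Suc.prems by simp
    also have "integral {0..x} (\<lambda>t. w t * E t) \<le> integral {0..x} (\<lambda>t. c * (\<Sum>j<n. w t * (W t ^ j / fact j)) + B * (w t * (W t ^ n / fact n)))"
    proof (rule integral_le)
      show "(\<lambda>t. w t * E t) integrable_on {0..x}" using Suc.prems by (intro absint_int(1)[OF iE]) auto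
      show "(\<lambda>t. c * (\<Sum>j<n. w t * (W t ^ j / fact j)) + B * (w t * (W t ^ n / fact n))) integrable_on {0..x}"
        by (intro integrable_add integrable_on_mult_right integrable_sum i1) auto
      fix t assume t: "t \<in> {0..x}"
      then have "w t * E t \<le> w t * (c * (\<Sum>j<n. W t ^ j / fact j) + B * (W t ^ n / fact n))"
        using Suc.prems w(2) by (intro mult_left_mono Suc.IH) auto
      also have "\<dots> = c * (\<Sum>j<n. w t * (W t ^ j / fact j)) + B * (w t * (W t ^ n / fact n))"
        unfolding distrib_left sum_distrib_left by (simp add: mult_ac)
      finally show "w t * E t \<le> c * (\<Sum>j<n. w t * (W t ^ j / fact j)) + B * (w t * (W t ^ n / fact n))" .
    qed
    also have "\<dots> = c * (\<Sum>j<n. integral {0..x} (\<lambda>t. w t * (W t ^ j / fact j))) + B * integral {0..x} (\<lambda>t. w t * (W t ^ n / fact n))"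
      using i1 by (subst integral_add) (auto intro!: integrable_on_mult_right integrable_sum simp: integral_sum)
    also have "\<dots> = c * (\<Sum>j<n. W x ^ Suc j / fact (Suc j)) + B * (W x ^ Suc n / fact (Suc n))"
      using integral_power_fact[OF w(1) Suc.prems] by (simp add: W_def)
    finally have "E x \<le> c + (c * (\<Sum>j<n. W x ^ Suc j / fact (Suc j)) + B * (W x ^ Suc n / fact (Suc n)))" by simp
    moreover have "(\<Sum>j<Suc n. W x ^ j / fact j) = 1 + (\<Sum>j<n. W x ^ Suc j / fact (Suc j))"
      unfolding sum.lessThan_Suc_shift by simp
    ultimately show ?case by (simp add: distrib_left)
  qed
  have s: "(\<lambda>n. W x ^ n / fact n) sums exp (W x)"
    using exp_converges[of "W x"] by (simp add: divide_inverse mult.commute)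
  have "(\<lambda>n. c * (\<Sum>j<n. W x ^ j / fact j) + B * (W x ^ n / fact n)) \<longlonglongrightarrow> c * exp (W x) + B * 0"
    using s sums_summable[OF s, THEN summable_LIMSEQ_zero] unfolding sums_def
    by (intro tendsto_intros)
  then show ?thesis using step[OF x] unfolding W_def by (intro LIMSEQ_le_const) auto
qed

section \<open>The Riemann-Lebesgue lemma\<close>

text \<open>Measurability yields continuous functions that converge to \<open>f\<close> off a null
  set, but without a common majorant. Clipping \<open>f\<close> and the approximants at one level
  \<open>m\<close> supplies a constant majorant, so dominated convergence applies twice: to choose
  \<open>m\<close>, then to choose the approximant.\<close>

lemma absint_approx_continuous:
  fixes f :: "real \<Rightarrow> complex"
  assumes f: "f absolutely_integrable_on {0..b}" and e: "e > 0"
  shows "\<exists>g. continuous_on UNIV g \<and> integral {0..b} (\<lambda>t. norm (f t - g t)) \<le> e"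
proof -
  \<comment> \<open>Radial retraction onto the disc of radius \<open>Suc n\<close>. The successor
    keeps the denominator positive, so the map is continuous and clipping preserves
    continuity.\<close>
  define clip :: "nat \<Rightarrow> complex \<Rightarrow> complex" where
    "clip = (\<lambda>n z. of_real (real (Suc n) / max (real (Suc n)) (norm z)) * z)"
  have nclip: "norm (clip n z) = (real (Suc n) / max (real (Suc n)) (norm z)) * norm z" for n z
    unfolding clip_def norm_mult norm_of_real by simp
  have clip1: "norm (clip n z) \<le> norm z" for n z
    unfolding nclip by (intro mult_left_le_one_le) (auto simp: divide_le_eq_1)
  have clip2: "norm (clip n z) \<le> real (Suc n)" for n z
  proof -
    have "real (Suc n) * norm z \<le> real (Suc n) * max (real (Suc n)) (norm z)"
      by (intro mult_left_mono) auto
    then show ?thesis unfolding nclip by (simp add: divide_le_eq del: of_nat_Suc)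
  qed
  have clip3: "clip n z = z" if "norm z \<le> real (Suc n)" for n z
    using that unfolding clip_def by (simp add: max_def)
  have clipc: "continuous_on UNIV (clip n)" for n
    unfolding clip_def by (intro continuous_intros) (auto simp: max_def)
  have fm: "f \<in> borel_measurable (lebesgue_on {0..b})"
    using f by (simp add: absolutely_integrable_on_def integrable_imp_measurable)
  have cfm: "(\<lambda>t. clip n (f t)) \<in> borel_measurable (lebesgue_on {0..b})" for n
    using clipc[of n] fm by (intro measurable_compose[OF fm] borel_measurable_continuous_onI)
  have cfi: "(\<lambda>t. clip n (f t)) absolutely_integrable_on {0..b}" for n
    by (rule measurable_bounded_by_integrable_imp_absolutely_integrable[OF cfm, of "\<lambda>t. norm (f t)"])
      (use f clip1 in \<open>auto simp: absolutely_integrable_on_def\<close>)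
  have "(\<lambda>n. integral {0..b} (\<lambda>t. norm (f t - clip n (f t)))) \<longlonglongrightarrow> integral {0..b} (\<lambda>t. 0)"
  proof (rule dominated_convergence(2))
    show "(\<lambda>t. norm (f t - clip n (f t))) integrable_on {0..b}" for n
      using set_integral_diff(1)[OF f cfi[of n]] by (simp add: absolutely_integrable_on_def)
    show "(\<lambda>t. 2 * norm (f t)) integrable_on {0..b}"
      using f by (auto simp: absolutely_integrable_on_def intro: integrable_on_mult_right)
    show "norm (norm (f t - clip n (f t))) \<le> 2 * norm (f t)" for n t
      using norm_triangle_ineq4[of "f t" "clip n (f t)"] clip1[of n "f t"] by simp
    fix t
    obtain N where "norm (f t) \<le> real N" using real_arch_simple by blast
    then have "norm (f t - clip n (f t)) = 0" if "n \<ge> N" for n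
      using that by (subst clip3) auto
    then show "(\<lambda>n. norm (f t - clip n (f t))) \<longlonglongrightarrow> 0"
      by (intro tendsto_eventually eventually_sequentiallyI[of N])
  qed
  then have "eventually (\<lambda>n. integral {0..b} (\<lambda>t. norm (f t - clip n (f t))) < e / 2) sequentially"
    using e by (intro order_tendstoD) auto
  then obtain m where m: "integral {0..b} (\<lambda>t. norm (f t - clip m (f t))) < e / 2"
    by (auto simp: eventually_sequentially)
  have "f measurable_on {0..b}" using fm by (simp add: measurable_on_iff_borel_measurable)
  then obtain N g where N: "negligible N" and g: "\<And>n. continuous_on UNIV (g n :: real \<Rightarrow> complex)"
    and lim: "\<And>x. x \<notin> N \<Longrightarrow> (\<lambda>n. g n x) \<longlonglongrightarrow> (if x \<in> {0..b} then f x else 0)"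
    unfolding measurable_on_def by blast
  have cgc: "continuous_on UNIV (\<lambda>t. clip m (g n t))" for n
    using continuous_on_compose2[OF clipc g] by simp
  have cgi: "(\<lambda>t. clip m (g n t)) absolutely_integrable_on {0..b}" for n
    by (rule absolutely_integrable_continuous_real[OF continuous_on_subset[OF cgc]]) simp
  have di: "(\<lambda>t. norm (clip m (f t) - clip m (g n t))) integrable_on {0..b}" for n
    using set_integral_diff(1)[OF cfi[of m] cgi[of n]] by (simp add: absolutely_integrable_on_def)
  have "(\<lambda>n. integral {0..b} (\<lambda>t. if t \<in> N then 0 else norm (clip m (f t) - clip m (g n t)))) \<longlonglongrightarrow> integral {0..b} (\<lambda>t. 0)"
  proof (rule dominated_convergence(2))
    show "(\<lambda>t. if t \<in> N then 0 else norm (clip m (f t) - clip m (g n t))) integrable_on {0..b}" for n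
      by (rule integrable_spike[OF di[of n] N]) auto
    show "(\<lambda>t. 2 * real (Suc m)) integrable_on {0..b}" by (intro integrable_const_ivl)
    show "norm (if t \<in> N then 0 else norm (clip m (f t) - clip m (g n t))) \<le> 2 * real (Suc m)" for n t
      using norm_triangle_ineq4[of "clip m (f t)" "clip m (g n t)"] clip2[of m "f t"] clip2[of m "g n t"] by auto
    fix t assume t: "t \<in> {0..b}"
    show "(\<lambda>n. if t \<in> N then 0 else norm (clip m (f t) - clip m (g n t))) \<longlonglongrightarrow> 0"
    proof (cases "t \<in> N")
      case False
      have "(\<lambda>n. clip m (g n t)) \<longlonglongrightarrow> clip m (f t)"
        using continuous_on_tendsto_compose[OF clipc, of "\<lambda>n. g n t" "f t" sequentially m] lim[OF False] t by auto
      from tendsto_norm[OF tendsto_diff[OF tendsto_const[of "clip m (f t)"] this]] show ?thesis using False by simp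
    qed simp
  qed
  then have "eventually (\<lambda>n. integral {0..b} (\<lambda>t. if t \<in> N then 0 else norm (clip m (f t) - clip m (g n t))) < e / 2) sequentially"
    using e by (intro order_tendstoD) auto
  then obtain n where "integral {0..b} (\<lambda>t. if t \<in> N then 0 else norm (clip m (f t) - clip m (g n t))) < e / 2"
    by (auto simp: eventually_sequentially)
  moreover have "integral {0..b} (\<lambda>t. if t \<in> N then 0 else norm (clip m (f t) - clip m (g n t)))
     = integral {0..b} (\<lambda>t. norm (clip m (f t) - clip m (g n t)))"
    by (rule integral_spike[OF N]) auto
  ultimately have n: "integral {0..b} (\<lambda>t. norm (clip m (f t) - clip m (g n t))) < e / 2" by simp
  have fi: "(\<lambda>t. norm (f t - clip m (f t))) integrable_on {0..b}"
    using set_integral_diff(1)[OF f cfi[of m]] by (simp add: absolutely_integrable_on_def)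
  have "integral {0..b} (\<lambda>t. norm (f t - clip m (g n t))) \<le> integral {0..b} (\<lambda>t. norm (f t - clip m (f t)) + norm (clip m (f t) - clip m (g n t)))"
  proof (rule integral_le)
    show "(\<lambda>t. norm (f t - clip m (g n t))) integrable_on {0..b}"
      using set_integral_diff(1)[OF f cgi[of n]] by (simp add: absolutely_integrable_on_def)
    show "(\<lambda>t. norm (f t - clip m (f t)) + norm (clip m (f t) - clip m (g n t))) integrable_on {0..b}"
      by (intro integrable_add fi di)
    show "norm (f t - clip m (g n t)) \<le> norm (f t - clip m (f t)) + norm (clip m (f t) - clip m (g n t))" for t
      using norm_triangle_ineq[of "f t - clip m (f t)" "clip m (f t) - clip m (g n t)"] by simp
  qed
  also have "\<dots> \<le> e" using m n by (simp add: integral_add[OF fi di])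
  finally show ?thesis using cgc by blast
qed

text \<open>By Weierstrass, a polynomial uniformly within \<open>e / (2 * (b + 1))\<close> of the
  continuous approximant adds at most \<open>e / 2\<close> over an interval of length
  \<open>b\<close>; the summand 1 covers \<open>b = 0\<close>.\<close>

lemma absint_approx_smooth:
  fixes f :: "real \<Rightarrow> complex"
  assumes f: "f absolutely_integrable_on {0..b}" and e: "e > 0" and b: "b \<ge> 0"
  shows "\<exists>g g'. continuous_on UNIV g' \<and> (\<forall>x. (g has_vector_derivative g' x) (at x)) \<and> integral {0..b} (\<lambda>t. norm (f t - g t)) \<le> e"
proof -
  obtain h where h: "continuous_on UNIV h" "integral {0..b} (\<lambda>t. norm (f t - h t)) \<le> e / 2"
    using absint_approx_continuous[OF f, of "e/2"] e by auto
  have hc: "continuous_on {0..b} h" using h(1) continuous_on_subset by blast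
  obtain g where g: "polynomial_function g" "\<And>x. x \<in> {0..b} \<Longrightarrow> norm (h x - g x) < e / (2 * (b + 1))"
    using Stone_Weierstrass_polynomial_function[OF _ hc, of "e / (2 * (b + 1))"] e b by auto
  obtain g' where g': "polynomial_function g'" "\<And>x. (g has_vector_derivative g' x) (at x)"
    using has_vector_derivative_polynomial_function[OF g(1)] by blast
  have gc: "continuous_on {0..b} g" using g(1) continuous_on_polymonial_function by blast
  have i1: "(\<lambda>t. norm (f t - h t)) integrable_on {0..b}"
    using set_integral_diff(1)[OF f absolutely_integrable_continuous_real[OF hc]] by (simp add: absolutely_integrable_on_def)
  have "integral {0..b} (\<lambda>t. norm (f t - g t)) \<le> integral {0..b} (\<lambda>t. norm (f t - h t) + e / (2 * (b + 1)))"
  proof (rule integral_le)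
    show "(\<lambda>t. norm (f t - g t)) integrable_on {0..b}"
      using set_integral_diff(1)[OF f absolutely_integrable_continuous_real[OF gc]] by (simp add: absolutely_integrable_on_def)
    show "(\<lambda>t. norm (f t - h t) + e / (2 * (b + 1))) integrable_on {0..b}"
      by (intro integrable_add i1 integrable_const_ivl)
    show "norm (f t - g t) \<le> norm (f t - h t) + e / (2 * (b + 1))" if "t \<in> {0..b}" for t
      using norm_triangle_ineq[of "f t - h t" "h t - g t"] g(2)[OF that] by simp
  qed
  also have "\<dots> = integral {0..b} (\<lambda>t. norm (f t - h t)) + b * (e / (2 * (b + 1)))"
    using b by (subst integral_add[OF i1 integrable_const_ivl]) simp
  also have "\<dots> \<le> e / 2 + e / 2" 
    using h(2) e b by (intro add_mono) (auto simp: field_simps)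
  finally show ?thesis using g' continuous_on_polymonial_function[OF g'(1)] by auto
qed

lemma exp_affine_deriv: "((\<lambda>t. exp (k * of_real t + d)) has_vector_derivative k * exp (k * of_real t + d)) (at t)" for k d :: complex
proof -
  have "((\<lambda>z. exp (k * z + d)) has_field_derivative k * exp (k * of_real t + d)) (at (of_real t))"
    by (auto intro!: derivative_eq_intros)
  from has_vector_derivative_real_field[OF this] show ?thesis by simp
qed

lemma antideriv_exp: "antideriv b (\<lambda>t. exp (k * of_real t + d)) (\<lambda>t. k * exp (k * of_real t + d))" for k d :: complex
  by (intro antideriv_FTC exp_affine_deriv continuous_intros)

text \<open>The error of a smooth approximation costs at most \<open>K\<close> times its L1 norm,
  and integrating the smooth part by parts gains \<open>1 / cmod k\<close>. The exponent is complex
  and may be shifted by \<open>d\<close>, with the exponential bounded only on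
  \<open>{0..x}\<close>: this admits the factor exp(2ik(x - t)), uniformly in \<open>x\<close>,
  although its two constituents may be unbounded separately.\<close>

lemma riemann_lebesgue:
  fixes f :: "real \<Rightarrow> complex"
  assumes f: "f absolutely_integrable_on {0..b}" and e: "e > 0" and K: "K > 0"
  shows "\<exists>R>0. \<forall>k d x. R \<le> norm k \<longrightarrow> x \<in> {0..b} \<longrightarrow> (\<forall>t\<in>{0..x}. norm (exp (k * of_real t + d)) \<le> K) \<longrightarrow>
           norm (integral {0..x} (\<lambda>t. f t * exp (k * of_real t + d))) \<le> e"
proof (cases "b \<ge> 0")
  case b: True
  obtain g g' where g': "continuous_on UNIV g'" "\<And>x. (g has_vector_derivative g' x) (at x)"
    and g: "integral {0..b} (\<lambda>t. norm (f t - g t)) \<le> e / (2 * K)"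
    using absint_approx_smooth[OF f _ b, of "e/(2*K)"] e K by auto
  have ag: "antideriv b g g'" by (rule antideriv_FTC[OF g'(2,1)])
  have gc: "continuous_on {0..b} g" by (rule antideriv_cont[OF ag])
  have g'c: "continuous_on {0..b} g'" using g'(1) continuous_on_subset by blast
  obtain B where B: "B > 0" "\<And>t. t \<in> {0..b} \<Longrightarrow> norm (g t) \<le> B" "\<And>t. t \<in> {0..b} \<Longrightarrow> norm (g' t) \<le> B"
  proof -
    have "bounded (g ` {0..b})" "bounded (g' ` {0..b})"
      using gc g'c compact_continuous_image compact_imp_bounded by blast+
    then obtain B1 B2 where "\<forall>t\<in>{0..b}. norm (g t) \<le> B1" "\<forall>t\<in>{0..b}. norm (g' t) \<le> B2"
      unfolding bounded_iff by auto
    then show ?thesis by (intro that[of "max 1 (max B1 B2)"]) (auto simp: le_max_iff_disj)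
  qed
  \<comment> \<open>Integration by parts bounds \<open>k\<close> times the smooth integral by two
    boundary terms \<open>K * B\<close> and an integral over a length of at most \<open>b\<close>.
    Dividing by \<open>R\<close> leaves \<open>e / 2\<close>.\<close>
  define C where "C = K * B * (2 + b)"
  define R where "R = 2 * C / e"
  have C: "C > 0" using K B b by (auto simp: C_def)
  have R: "R > 0" using C e by (auto simp: R_def)
  have dfi: "(\<lambda>t. f t - g t) absolutely_integrable_on {0..b}"
    using set_integral_diff(1)[OF f absolutely_integrable_continuous_real[OF gc]] .
  have main: "norm (integral {0..x} (\<lambda>t. f t * exp (k * of_real t + d))) \<le> e"
    if k: "R \<le> norm k" and x: "x \<in> {0..b}" and bd: "\<And>t. t \<in> {0..x} \<Longrightarrow> norm (exp (k * of_real t + d)) \<le> K" for k d x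
  proof -
    let ?E = "\<lambda>t. exp (k * of_real t + d)"
    have Ec: "continuous_on {0..b} ?E" by (intro continuous_intros)
    have i1: "(\<lambda>t. (f t - g t) * ?E t) integrable_on {0..x}"
      using absint_int(1)[OF absint_mult_cont(1)[OF dfi Ec], of 0 x] x by auto
    have i2: "(\<lambda>t. g t * ?E t) integrable_on {0..x}" "(\<lambda>t. g' t * ?E t) integrable_on {0..x}"
      by (intro integrable_continuous_real continuous_intros continuous_on_subset[OF gc] continuous_on_subset[OF g'c]; use x in auto)+
    have "integral {0..x} (\<lambda>t. f t * ?E t) = integral {0..x} (\<lambda>t. (f t - g t) * ?E t + g t * ?E t)"
      by (simp add: algebra_simps)
    also have "\<dots> = integral {0..x} (\<lambda>t. (f t - g t) * ?E t) + integral {0..x} (\<lambda>t. g t * ?E t)"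
      by (rule integral_add[OF i1 i2(1)])
    finally have split: "integral {0..x} (\<lambda>t. f t * ?E t) = \<dots>" .
    have ni: "(\<lambda>t. norm (f t - g t)) integrable_on {0..b}" using dfi by (simp add: absolutely_integrable_on_def)
    have ni': "(\<lambda>t. norm (f t - g t)) integrable_on {0..x}" using absint_int(2)[OF dfi, of 0 x] x by auto
    have "norm (integral {0..x} (\<lambda>t. (f t - g t) * ?E t)) \<le> integral {0..x} (\<lambda>t. norm (f t - g t) * K)"
      using bd by (intro integral_norm_bound_integral i1 integrable_on_mult_left ni') (auto simp: norm_mult intro!: mult_left_mono)
    also have "\<dots> \<le> integral {0..b} (\<lambda>t. norm (f t - g t)) * K"
      using K x ni ni' by (auto intro!: integral_subset_le mult_right_mono)
    also have "\<dots> \<le> e / (2 * K) * K" using g K by (intro mult_right_mono) auto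
    finally have p1: "norm (integral {0..x} (\<lambda>t. (f t - g t) * ?E t)) \<le> e / 2" using K by simp
    have "g x * ?E x - g 0 * ?E 0 = integral {0..x} (\<lambda>t. g' t * ?E t + g t * (k * ?E t))"
      using antideriv_eq[OF antideriv_mult[OF ag antideriv_exp[of b k d]] x] by simp
    also have "\<dots> = integral {0..x} (\<lambda>t. g' t * ?E t + k * (g t * ?E t))" by (simp add: algebra_simps)
    also have "\<dots> = integral {0..x} (\<lambda>t. g' t * ?E t) + k * integral {0..x} (\<lambda>t. g t * ?E t)"
      using i2 by (simp add: integral_add integrable_on_mult_right)
    finally have eq: "k * integral {0..x} (\<lambda>t. g t * ?E t) = g x * ?E x - g 0 * ?E 0 - integral {0..x} (\<lambda>t. g' t * ?E t)"
      by (simp add: algebra_simps)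
    have gE: "norm (g t * ?E t) \<le> B * K" "norm (g' t * ?E t) \<le> B * K" if "t \<in> {0..x}" for t
      using B(2,3)[of t] B(1) bd[OF that] that x unfolding norm_mult by (auto intro!: mult_mono)
    have "norm (integral {0..x} (\<lambda>t. g' t * ?E t)) \<le> B * K * (x - 0)"
      using gE x by (intro integral_bound continuous_intros continuous_on_subset[OF g'c]) auto
    also have "\<dots> \<le> B * K * b" using B K x by (intro mult_left_mono) auto
    finally have "norm (integral {0..x} (\<lambda>t. g' t * ?E t)) \<le> B * K * b" .
    then have "norm (k * integral {0..x} (\<lambda>t. g t * ?E t)) \<le> B * K + B * K + B * K * b"
      unfolding eq using gE(1)[of x] gE(1)[of 0] x
      by (intro order_trans[OF norm_triangle_ineq4] add_mono) auto
    also have "\<dots> = C" by (simp add: C_def algebra_simps)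
    finally have "norm k * norm (integral {0..x} (\<lambda>t. g t * ?E t)) \<le> C" by (simp add: norm_mult)
    moreover have "R * norm (integral {0..x} (\<lambda>t. g t * ?E t)) \<le> norm k * norm (integral {0..x} (\<lambda>t. g t * ?E t))"
      using k by (intro mult_right_mono) auto
    ultimately have "R * norm (integral {0..x} (\<lambda>t. g t * ?E t)) \<le> C" by linarith
    then have "norm (integral {0..x} (\<lambda>t. g t * ?E t)) \<le> e / 2"
      using C e by (simp add: R_def field_simps)
    with p1 show ?thesis unfolding split by (intro order_trans[OF norm_triangle_ineq]) auto
  qed
  show ?thesis using R main by blast
qed (auto intro: exI[of _ 1])

section \<open>Picard iteration and the characteristic function\<close>

lemma reg_sol_antideriv:
  "reg_sol u l y1 y2 \<longleftrightarrow> antideriv pi y1 (\<lambda>t. u t * y1 t + y2 t) \<and> antideriv pi y2 (\<lambda>t. - (l + (u t)^2) * y1 t - u t * y2 t)"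
proof -
  have "y x = y 0 + I \<longleftrightarrow> y x - y 0 = I" for y :: "real \<Rightarrow> complex" and x I by (auto simp: algebra_simps)
  then show ?thesis unfolding reg_sol_def antideriv_def by auto
qed

text \<open>Functions of \<open>(l, x)\<close> that are polynomial in \<open>l\<close> with continuous coefficients: closed under the Volterra
  operators of the Picard iteration, hence a way to see that the iterates are holomorphic in \<open>l\<close>.\<close>

inductive poly_family :: "real \<Rightarrow> (complex \<Rightarrow> real \<Rightarrow> complex) \<Rightarrow> bool" for b where
  pf_const: "continuous_on {0..b} c \<Longrightarrow> poly_family b (\<lambda>l x. c x)"
| pf_add: "poly_family b h \<Longrightarrow> poly_family b g \<Longrightarrow> poly_family b (\<lambda>l x. h l x + g l x)"
| pf_lam: "poly_family b h \<Longrightarrow> poly_family b (\<lambda>l x. l * h l x)"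
| pf_cong: "poly_family b h \<Longrightarrow> (\<And>l x. x \<in> {0..b} \<Longrightarrow> h l x = g l x) \<Longrightarrow> poly_family b g"

lemma poly_family_cont: "poly_family b h \<Longrightarrow> continuous_on {0..b} (h l)"
proof (induction rule: poly_family.induct)
  case (pf_cong h g)
  then show ?case by (metis (no_types, lifting) continuous_on_cong)
qed (auto intro: continuous_intros)

lemma poly_family_holo: "poly_family b h \<Longrightarrow> x \<in> {0..b} \<Longrightarrow> (\<lambda>l. h l x) holomorphic_on S"
proof (induction rule: poly_family.induct)
  case (pf_cong h g)
  then show ?case by (metis (no_types, lifting) holomorphic_cong)
qed (auto intro: holomorphic_intros)

lemma poly_family_integral:
  assumes f: "f absolutely_integrable_on {0..b}"
  shows "poly_family b h \<Longrightarrow> poly_family b (\<lambda>l x. integral {0..x} (\<lambda>t. f t * h l t))"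
proof (induction rule: poly_family.induct)
  case (pf_const c)
  then have "antideriv b (\<lambda>x. 0 + integral {0..x} (\<lambda>t. f t * c t)) (\<lambda>t. f t * c t)"
    by (intro antideriv_indefinite absint_mult_cont f)
  from antideriv_cont[OF this] show ?case by (intro poly_family.pf_const) simp
next
  case (pf_add h g)
  have i: "(\<lambda>t. f t * h l t) integrable_on {0..x}" "(\<lambda>t. f t * g l t) integrable_on {0..x}" if "x \<in> {0..b}" for l x
    using absint_int(1)[OF absint_mult_cont(1)[OF f poly_family_cont[OF pf_add.hyps(1)]], of 0 x]
      absint_int(1)[OF absint_mult_cont(1)[OF f poly_family_cont[OF pf_add.hyps(2)]], of 0 x] that by auto
  show ?case
    by (rule poly_family.pf_cong[OF poly_family.pf_add[OF pf_add.IH]])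
      (simp add: integral_add[OF i] distrib_left)
next
  case (pf_lam h)
  show ?case by (rule poly_family.pf_cong[OF poly_family.pf_lam[OF pf_lam.IH]])
      (simp add: mult.left_commute)
next
  case (pf_cong h g)
  show ?case
  proof (rule poly_family.pf_cong[OF pf_cong.IH])
    fix l x assume "x \<in> {0..b}"
    then show "integral {0..x} (\<lambda>t. f t * h l t) = integral {0..x} (\<lambda>t. f t * g l t)"
      using pf_cong.hyps(2) by (intro integral_cong) auto
  qed
qed

text \<open>These are the terms, not the partial sums, of the Neumann series for the initial data
  \<open>(0, 1)\<close>: by linearity each term is the Volterra operator applied to the previous
  one, and the solution is their sum.\<close>

primrec picard :: "(real \<Rightarrow> complex) \<Rightarrow> complex \<Rightarrow> nat \<Rightarrow> (real \<Rightarrow> complex) \<times> (real \<Rightarrow> complex)" where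
  "picard u l 0 = ((\<lambda>x. 0), (\<lambda>x. 1))"
| "picard u l (Suc n) =
    ((\<lambda>x. integral {0..x} (\<lambda>t. u t * fst (picard u l n) t + snd (picard u l n) t)),
     (\<lambda>x. integral {0..x} (\<lambda>t. - (l + (u t)^2) * fst (picard u l n) t - u t * snd (picard u l n) t)))"

section \<open>The initial value problem for a square integrable \<open>u\<close>\<close>

locale L2_potential =
  fixes u :: "real \<Rightarrow> complex"
  assumes L2: "L2_on_0pi u"
begin

lemma u_measurable: "u \<in> borel_measurable (lebesgue_on {0..pi})"
  using L2 by (simp add: L2_on_0pi_def measurable_on_iff_borel_measurable)

lemma u2n_absint: "(\<lambda>t. (cmod (u t))^2) absolutely_integrable_on {0..pi}"
  using L2 by (simp add: L2_on_0pi_def absolutely_integrable_on_iff_nonneg)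

lemma u_absint: "u absolutely_integrable_on {0..pi}"
proof (rule measurable_bounded_by_integrable_imp_absolutely_integrable[OF u_measurable, of "\<lambda>t. 1 + (cmod (u t))^2"])
  show "(\<lambda>t. 1 + (cmod (u t))\<^sup>2) integrable_on {0..pi}"
    using L2 by (intro integrable_add integrable_const_ivl) (auto simp: L2_on_0pi_def)
  have "a \<le> 1 + a^2" for a :: real
    using zero_le_power2[of "a - 1/2"] by (simp add: power2_eq_square algebra_simps)
  then show "cmod (u t) \<le> 1 + (cmod (u t))\<^sup>2" for t .
qed auto

lemma u2_absint: "(\<lambda>t. (u t)^2) absolutely_integrable_on {0..pi}"
proof (rule measurable_bounded_by_integrable_imp_absolutely_integrable[of _ _ "\<lambda>t. (cmod (u t))^2"])
  show "(\<lambda>t. (u t)\<^sup>2) \<in> borel_measurable (lebesgue_on {0..pi})" using u_measurable by measurable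
  show "(\<lambda>t. (cmod (u t))\<^sup>2) integrable_on {0..pi}" using L2 by (simp add: L2_on_0pi_def)
qed (auto simp: norm_power)

text \<open>Majorant of the column sums of the coefficient matrix for all \<open>l\<close> with
  \<open>cmod l <= r\<close> at once; this uniformity in \<open>l\<close> is what later gives
  holomorphy of the series.\<close>

definition wt :: "real \<Rightarrow> real \<Rightarrow> real" where
  "wt r t = 1 + r + cmod (u t) + (cmod (u t))^2"

lemma wt_absint: "wt r absolutely_integrable_on {0..pi}"
proof -
  have "(\<lambda>t. 1 + r) absolutely_integrable_on {0..pi}" by (intro absolutely_integrable_continuous_real) auto
  from set_integral_add(1)[OF set_integral_add(1)[OF this set_integrable_norm[OF u_absint]] u2n_absint]
  show ?thesis by (simp add: wt_def[abs_def])
qed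

lemma wt_nonneg: "r \<ge> 0 \<Longrightarrow> wt r t \<ge> 0"
  by (simp add: wt_def)

definition Wt :: "real \<Rightarrow> real \<Rightarrow> real" where
  "Wt r x = integral {0..x} (wt r)"

lemma system_bound:
  assumes "cmod l \<le> r"
  shows "cmod (u t * a + c) + cmod (- (l + (u t)^2) * a - u t * c) \<le> wt r t * (cmod a + cmod c)"
proof -
  have r: "r \<ge> 0" using assms norm_ge_zero order_trans by blast
  have "cmod (u t * a + c) \<le> cmod (u t) * cmod a + cmod c"
    by (metis norm_mult norm_triangle_ineq)
  moreover have "cmod (- (l + (u t)^2) * a - u t * c) \<le> (r + (cmod (u t))^2) * cmod a + cmod (u t) * cmod c"
  proof -
    have "cmod (- (l + (u t)^2) * a - u t * c) \<le> cmod (- (l + (u t)^2)) * cmod a + cmod (u t) * cmod c"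
      by (metis norm_mult norm_triangle_ineq4)
    moreover have "cmod (- (l + (u t)^2)) \<le> r + (cmod (u t))^2"
      using norm_triangle_ineq[of l "(u t)^2"] assms unfolding norm_minus_cancel by (simp add: norm_power)
    then have "cmod (- (l + (u t)^2)) * cmod a \<le> (r + (cmod (u t))^2) * cmod a"
      by (intro mult_right_mono) auto
    ultimately show ?thesis by linarith
  qed
  moreover have "0 \<le> cmod a" "0 \<le> r * cmod c" "0 \<le> (cmod (u t))^2 * cmod c" using r by auto
  moreover have "wt r t * (cmod a + cmod c) = (cmod (u t) * cmod a + cmod c) + ((r + (cmod (u t))^2) * cmod a + cmod (u t) * cmod c)
      + cmod a + r * cmod c + (cmod (u t))^2 * cmod c"
    unfolding wt_def by (simp add: algebra_simps)
  ultimately show ?thesis by linarith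
qed

lemma rhs_absint:
  assumes "continuous_on {0..pi} a" "continuous_on {0..pi} c"
  shows "(\<lambda>t. u t * a t + c t) absolutely_integrable_on {0..pi}"
    "(\<lambda>t. - (l + (u t)^2) * a t - u t * c t) absolutely_integrable_on {0..pi}"
proof -
  have "(\<lambda>t. u t * a t) absolutely_integrable_on {0..pi}" "(\<lambda>t. u t * c t) absolutely_integrable_on {0..pi}"
    using assms by (auto intro: absint_mult_cont u_absint)
  moreover have "(\<lambda>t. - (l + (u t)^2) * a t) absolutely_integrable_on {0..pi}"
  proof (rule absint_mult_cont(1)[OF _ assms(1)])
    have "(\<lambda>t. - l) absolutely_integrable_on {0..pi}" by (intro absolutely_integrable_continuous_real) auto
    from set_integral_diff(1)[OF this u2_absint] show "(\<lambda>t. - (l + (u t)^2)) absolutely_integrable_on {0..pi}" by simp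
  qed
  moreover have "c absolutely_integrable_on {0..pi}" using assms(2) by (rule absolutely_integrable_continuous_real)
  ultimately show "(\<lambda>t. u t * a t + c t) absolutely_integrable_on {0..pi}"
    "(\<lambda>t. - (l + (u t)^2) * a t - u t * c t) absolutely_integrable_on {0..pi}"
    by (auto intro: set_integral_add set_integral_diff)
qed

lemma reg_sol_cont:
  assumes "reg_sol u l y1 y2"
  shows "continuous_on {0..pi} y1" "continuous_on {0..pi} y2"
  using assms antideriv_cont unfolding reg_sol_antideriv by blast+

lemma reg_sol_lincomb:
  assumes y: "reg_sol u l y1 y2" and z: "reg_sol u l z1 z2"
  shows "reg_sol u l (\<lambda>x. y1 x + c * z1 x) (\<lambda>x. y2 x + c * z2 x)"
proof -
  note yy = y[unfolded reg_sol_antideriv] and zz = z[unfolded reg_sol_antideriv]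
  have "antideriv pi (\<lambda>x. y1 x + c * z1 x) (\<lambda>t. (u t * y1 t + y2 t) + c * (u t * z1 t + z2 t))"
    using yy zz by (intro antideriv_add antideriv_cmult) auto
  moreover have "antideriv pi (\<lambda>x. y2 x + c * z2 x) (\<lambda>t. (- (l + (u t)^2) * y1 t - u t * y2 t) + c * (- (l + (u t)^2) * z1 t - u t * z2 t))"
    using yy zz by (intro antideriv_add antideriv_cmult) auto
  ultimately show ?thesis unfolding reg_sol_antideriv
    by (auto elim!: antideriv_cong simp: algebra_simps)
qed

text \<open>Gronwall with initial constant 0. The resulting uniqueness for the Cauchy problem gives
  the \<open>THE\<close> in \<open>char_fn\<close> its meaning.\<close>

lemma reg_sol_zero:
  assumes y: "reg_sol u l y1 y2" and 0: "y1 0 = 0" "y2 0 = 0" and x: "x \<in> {0..pi}"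
  shows "y1 x = 0 \<and> y2 x = 0"
proof -
  let ?w = "wt (cmod l)"
  let ?E = "\<lambda>x. cmod (y1 x) + cmod (y2 x)"
  have c: "continuous_on {0..pi} ?E" by (intro continuous_intros reg_sol_cont[OF y])
  note r = rhs_absint[OF reg_sol_cont[OF y]]
  have wE: "(\<lambda>t. ?w t * ?E t) absolutely_integrable_on {0..pi}" by (intro absint_mult_cont wt_absint c)
  have "?E x \<le> 0 * exp (integral {0..x} ?w)"
  proof (rule gronwall[OF wt_absint _ c _ _ x])
    fix x assume x: "x \<in> {0..pi}"
    have "y1 x = integral {0..x} (\<lambda>t. u t * y1 t + y2 t)" "y2 x = integral {0..x} (\<lambda>t. - (l + (u t)^2) * y1 t - u t * y2 t)"
      using y[unfolded reg_sol_def] x 0 by auto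
    then have "?E x \<le> integral {0..x} (\<lambda>t. cmod (u t * y1 t + y2 t)) + integral {0..x} (\<lambda>t. cmod (- (l + (u t)^2) * y1 t - u t * y2 t))"
      using integral_norm_le_absint[OF r(1), of 0 x] integral_norm_le_absint[OF r(2), of 0 x] x
        set_integrable_norm[OF r(1)] set_integrable_norm[OF r(2)] by (auto intro!: add_mono)
    also have "\<dots> = integral {0..x} (\<lambda>t. cmod (u t * y1 t + y2 t) + cmod (- (l + (u t)^2) * y1 t - u t * y2 t))"
      using absint_int(2)[OF r(1), of 0 x] absint_int(2)[OF r(2), of 0 x] x by (simp add: integral_add)
    also have "\<dots> \<le> integral {0..x} (\<lambda>t. ?w t * ?E t)"
      using x system_bound[of l "cmod l"]
      by (intro integral_mono_absint[OF _ wE] set_integral_add set_integrable_norm r) auto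
    finally show "?E x \<le> 0 + integral {0..x} (\<lambda>t. ?w t * ?E t)" by simp
  qed (auto simp: wt_nonneg)
  then have "?E x \<le> 0" by simp
  then show ?thesis using norm_ge_zero[of "y1 x"] norm_ge_zero[of "y2 x"] by (metis add_nonneg_eq_0_iff antisym add_nonneg_nonneg norm_eq_zero)
qed

lemma picard_poly_family: "poly_family pi (\<lambda>l. fst (picard u l n)) \<and> poly_family pi (\<lambda>l. snd (picard u l n))"
proof (induction n)
  case 0 show ?case by (simp add: pf_const)
next
  case (Suc n)
  let ?a = "\<lambda>l. fst (picard u l n)" and ?c = "\<lambda>l. snd (picard u l n)"
  have a: "poly_family pi ?a" and c: "poly_family pi ?c" using Suc by auto
  have one: "(\<lambda>t. 1::complex) absolutely_integrable_on {0..pi}" by (intro absolutely_integrable_continuous_real) auto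
  have mone: "(\<lambda>t. -1::complex) absolutely_integrable_on {0..pi}" by (intro absolutely_integrable_continuous_real) auto
  have mu: "(\<lambda>t. - u t) absolutely_integrable_on {0..pi}" using set_integral_diff(1)[OF absolutely_integrable_zero u_absint] by simp
  have mu2: "(\<lambda>t. - ((u t)^2)) absolutely_integrable_on {0..pi}" using set_integral_diff(1)[OF absolutely_integrable_zero u2_absint] by simp
  have i: "(\<lambda>t. f t * h l t) integrable_on {0..x}" if "x \<in> {0..pi}" "f absolutely_integrable_on {0..pi}" "poly_family pi h" for f :: "real \<Rightarrow> complex" and h l x
    using absint_int(1)[OF absint_mult_cont(1)[OF that(2) poly_family_cont[OF that(3)]], of 0 x] that(1) by auto
  have "poly_family pi (\<lambda>l x. integral {0..x} (\<lambda>t. u t * ?a l t) + integral {0..x} (\<lambda>t. 1 * ?c l t))"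
    by (intro pf_add poly_family_integral u_absint one a c)
  then have 1: "poly_family pi (\<lambda>l. fst (picard u l (Suc n)))"
    by (rule pf_cong) (use integral_add[OF i[OF _ u_absint a] i[OF _ one c]] in simp)
  have "poly_family pi (\<lambda>l x. (integral {0..x} (\<lambda>t. - ((u t)^2) * ?a l t) + integral {0..x} (\<lambda>t. - u t * ?c l t)) + l * integral {0..x} (\<lambda>t. -1 * ?a l t))"
    by (intro pf_add pf_lam poly_family_integral mu mu2 mone a c)
  then have 2: "poly_family pi (\<lambda>l. snd (picard u l (Suc n)))"
  proof (rule pf_cong)
    fix l x assume x: "x \<in> {0..pi}"
    note j = i[OF x mu2 a, of l] i[OF x mu c, of l] i[OF x mone a, of l]
    have "(integral {0..x} (\<lambda>t. - ((u t)^2) * ?a l t) + integral {0..x} (\<lambda>t. - u t * ?c l t)) + l * integral {0..x} (\<lambda>t. -1 * ?a l t)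
      = integral {0..x} (\<lambda>t. (- ((u t)^2) * ?a l t + - u t * ?c l t) + l * (-1 * ?a l t))"
      using integral_add[OF integrable_add[OF j(1,2)] integrable_on_mult_right[OF j(3), of l]] integral_add[OF j(1,2)]
      by simp
    also have "\<dots> = snd (picard u l (Suc n)) x" by (simp add: algebra_simps)
    finally show "(integral {0..x} (\<lambda>t. - ((u t)^2) * ?a l t) + integral {0..x} (\<lambda>t. - u t * ?c l t)) + l * integral {0..x} (\<lambda>t. -1 * ?a l t)
      = snd (picard u l (Suc n)) x" .
  qed
  from 1 2 show ?case by simp
qed

lemma picard_cont: "continuous_on {0..pi} (fst (picard u l n))" "continuous_on {0..pi} (snd (picard u l n))"
  using picard_poly_family[of n] poly_family_cont by blast+

lemma picard_bound:
  assumes l: "cmod l \<le> r"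
  shows "x \<in> {0..pi} \<Longrightarrow> cmod (fst (picard u l n) x) + cmod (snd (picard u l n) x) \<le> Wt r x ^ n / fact n"
proof (induction n arbitrary: x)
  case 0 show ?case by simp
next
  case (Suc n)
  let ?a = "fst (picard u l n)" and ?c = "snd (picard u l n)"
  have r0: "r \<ge> 0" using l norm_ge_zero order_trans by blast
  note x = Suc.prems
  note r = rhs_absint[OF picard_cont[of l n]]
  have cW: "continuous_on {0..pi} (\<lambda>t. Wt r t ^ n / fact n)"
    using antideriv_cont[OF antideriv_indefinite[OF wt_absint, of 0]] unfolding Wt_def by (intro continuous_intros) auto
  have "cmod (fst (picard u l (Suc n)) x) + cmod (snd (picard u l (Suc n)) x)
     \<le> integral {0..x} (\<lambda>t. cmod (u t * ?a t + ?c t)) + integral {0..x} (\<lambda>t. cmod (- (l + (u t)^2) * ?a t - u t * ?c t))"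
    using integral_norm_le_absint[OF r(1), of 0 x] integral_norm_le_absint[OF r(2), of 0 x] x
      set_integrable_norm[OF r(1)] set_integrable_norm[OF r(2)] by (auto intro!: add_mono)
  also have "\<dots> = integral {0..x} (\<lambda>t. cmod (u t * ?a t + ?c t) + cmod (- (l + (u t)^2) * ?a t - u t * ?c t))"
    using absint_int(2)[OF r(1), of 0 x] absint_int(2)[OF r(2), of 0 x] x by (simp add: integral_add)
  also have "\<dots> \<le> integral {0..x} (\<lambda>t. wt r t * (Wt r t ^ n / fact n))"
  proof (rule integral_mono_absint[of pi])
    fix t assume t: "t \<in> {0..x}"
    have "cmod (u t * ?a t + ?c t) + cmod (- (l + (u t)^2) * ?a t - u t * ?c t) \<le> wt r t * (cmod (?a t) + cmod (?c t))"
      by (rule system_bound[OF l])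
    also have "\<dots> \<le> wt r t * (Wt r t ^ n / fact n)"
      using Suc.IH[of t] t x wt_nonneg[OF r0] by (intro mult_left_mono) auto
    finally show "cmod (u t * ?a t + ?c t) + cmod (- (l + (u t)^2) * ?a t - u t * ?c t) \<le> wt r t * (Wt r t ^ n / fact n)" .
  next
    show "(\<lambda>t. cmod (u t * ?a t + ?c t) + cmod (- (l + (u t)^2) * ?a t - u t * ?c t)) absolutely_integrable_on {0..pi}"
      by (rule set_integral_add(1)[OF set_integrable_norm[OF r(1)] set_integrable_norm[OF r(2)]])
    show "(\<lambda>t. wt r t * (Wt r t ^ n / fact n)) absolutely_integrable_on {0..pi}"
      by (rule absint_mult_cont(1)[OF wt_absint cW])
  qed (use x in auto)
  also have "\<dots> = Wt r x ^ Suc n / fact (Suc n)"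
    using integral_power_fact[OF wt_absint x] by (simp add: Wt_def)
  finally show ?case .
qed

lemma picard_bound_pi:
  assumes l: "cmod l \<le> r" and x: "x \<in> {0..pi}"
  shows "cmod (fst (picard u l n) x) \<le> Wt r pi ^ n / fact n" "cmod (snd (picard u l n) x) \<le> Wt r pi ^ n / fact n"
proof -
  have r0: "r \<ge> 0" using l norm_ge_zero order_trans by blast
  have "Wt r x \<le> Wt r pi" unfolding Wt_def
    using x absint_int(1)[OF wt_absint, of 0 x] absint_int(1)[OF wt_absint, of 0 pi] wt_nonneg[OF r0]
    by (intro integral_subset_le) auto
  moreover have "0 \<le> Wt r x" unfolding Wt_def
    using x absint_int(1)[OF wt_absint, of 0 x] wt_nonneg[OF r0] by (intro integral_nonneg) auto
  ultimately have "Wt r x ^ n / fact n \<le> Wt r pi ^ n / fact n"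
    by (intro divide_right_mono power_mono) auto
  then have "cmod (fst (picard u l n) x) + cmod (snd (picard u l n) x) \<le> Wt r pi ^ n / fact n"
    using picard_bound[OF l x, of n] by linarith
  then show "cmod (fst (picard u l n) x) \<le> Wt r pi ^ n / fact n" "cmod (snd (picard u l n) x) \<le> Wt r pi ^ n / fact n"
    by (smt (verit) norm_ge_zero)+
qed

definition sol1 :: "complex \<Rightarrow> real \<Rightarrow> complex" where "sol1 l x = (\<Sum>n. fst (picard u l n) x)"
definition sol2 :: "complex \<Rightarrow> real \<Rightarrow> complex" where "sol2 l x = (\<Sum>n. snd (picard u l n) x)"

lemma summable_exp_series: "summable (\<lambda>n. x ^ n / fact n)" for x :: real
  using summable_exp[of x] by (simp add: divide_inverse mult.commute)

text \<open>The M-test is run jointly in \<open>(l, x)\<close>: fixing \<open>l\<close> then gives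
  continuity in \<open>x\<close>, fixing \<open>x\<close> gives holomorphy in
  \<open>l\<close>.\<close>

lemma picard_uniform:
  "uniform_limit ({l. cmod l \<le> r} \<times> {0..pi}) (\<lambda>N (l, x). \<Sum>n<N. fst (picard u l n) x) (\<lambda>(l, x). sol1 l x) sequentially"
  "uniform_limit ({l. cmod l \<le> r} \<times> {0..pi}) (\<lambda>N (l, x). \<Sum>n<N. snd (picard u l n) x) (\<lambda>(l, x). sol2 l x) sequentially"
proof -
  have "uniform_limit ({l. cmod l \<le> r} \<times> {0..pi}) (\<lambda>N p. \<Sum>n<N. fst (picard u (fst p) n) (snd p)) (\<lambda>p. \<Sum>n. fst (picard u (fst p) n) (snd p)) sequentially"
    by (rule Weierstrass_m_test[OF _ summable_exp_series[of "Wt r pi"]]) (use picard_bound_pi[of _ r] in auto)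
  then show "uniform_limit ({l. cmod l \<le> r} \<times> {0..pi}) (\<lambda>N (l, x). \<Sum>n<N. fst (picard u l n) x) (\<lambda>(l, x). sol1 l x) sequentially"
    by (simp add: sol1_def case_prod_unfold)
  have "uniform_limit ({l. cmod l \<le> r} \<times> {0..pi}) (\<lambda>N p. \<Sum>n<N. snd (picard u (fst p) n) (snd p)) (\<lambda>p. \<Sum>n. snd (picard u (fst p) n) (snd p)) sequentially"
    by (rule Weierstrass_m_test[OF _ summable_exp_series[of "Wt r pi"]]) (use picard_bound_pi[of _ r] in auto)
  then show "uniform_limit ({l. cmod l \<le> r} \<times> {0..pi}) (\<lambda>N (l, x). \<Sum>n<N. snd (picard u l n) x) (\<lambda>(l, x). sol2 l x) sequentially"
    by (simp add: sol2_def case_prod_unfold)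
qed

lemma picard_uniform_x:
  "uniform_limit {0..pi} (\<lambda>N x. \<Sum>n<N. fst (picard u l n) x) (sol1 l) sequentially"
  "uniform_limit {0..pi} (\<lambda>N x. \<Sum>n<N. snd (picard u l n) x) (sol2 l) sequentially"
proof -
  show "uniform_limit {0..pi} (\<lambda>N x. \<Sum>n<N. fst (picard u l n) x) (sol1 l) sequentially"
    "uniform_limit {0..pi} (\<lambda>N x. \<Sum>n<N. snd (picard u l n) x) (sol2 l) sequentially"
    using uniform_limit_compose'[OF picard_uniform(1)[of "cmod l"], of "\<lambda>x. (l, x)" "{0..pi}"]
      uniform_limit_compose'[OF picard_uniform(2)[of "cmod l"], of "\<lambda>x. (l, x)" "{0..pi}"] by auto
qed

lemma sol_cont: "continuous_on {0..pi} (sol1 l)" "continuous_on {0..pi} (sol2 l)"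
proof -
  have "continuous_on {0..pi} (\<lambda>x. \<Sum>n<N. fst (picard u l n) x)" "continuous_on {0..pi} (\<lambda>x. \<Sum>n<N. snd (picard u l n) x)" for N
    by (intro continuous_on_sum picard_cont)+
  then show "continuous_on {0..pi} (sol1 l)" "continuous_on {0..pi} (sol2 l)"
    using uniform_limit_theorem[OF always_eventually picard_uniform_x(1)] uniform_limit_theorem[OF always_eventually picard_uniform_x(2)] by auto
qed

lemma sol2_holo: "x \<in> {0..pi} \<Longrightarrow> (\<lambda>l. sol2 l x) holomorphic_on UNIV"
proof (rule holomorphic_uniform_sequence)
  assume x: "x \<in> {0..pi}"
  show "(\<lambda>l. \<Sum>n<N. snd (picard u l n) x) holomorphic_on UNIV" for N
    using picard_poly_family x by (intro holomorphic_intros poly_family_holo) auto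
  fix l :: complex
  have "uniform_limit (cball l 1) (\<lambda>N l. \<Sum>n<N. snd (picard u l n) x) (\<lambda>l. sol2 l x) sequentially"
    unfolding uniform_limit_iff
  proof (intro allI impI)
    fix e :: real assume e: "e > 0"
    have sub: "cmod l' \<le> cmod l + 1" if "l' \<in> cball l 1" for l'
      using that norm_triangle_ineq3[of l' l] by (auto simp: dist_norm norm_minus_commute)
    show "\<forall>\<^sub>F N in sequentially. \<forall>l\<in>cball l 1. dist (\<Sum>n<N. snd (picard u l n) x) (sol2 l x) < e"
      using picard_uniform(2)[of "cmod l + 1", unfolded uniform_limit_iff, rule_format, OF e]
      by (rule eventually_mono) (use sub x in force)
  qed
  then show "\<exists>d>0. cball l d \<subseteq> UNIV \<and> uniform_limit (cball l d) (\<lambda>N l. \<Sum>n<N. snd (picard u l n) x) (\<lambda>l. sol2 l x) sequentially"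
    by (intro exI[of _ 1]) auto
qed auto

lemma picard_sums:
  assumes "x \<in> {0..pi}"
  shows "(\<lambda>N. \<Sum>n<N. fst (picard u l n) x) \<longlonglongrightarrow> sol1 l x" "(\<lambda>N. \<Sum>n<N. snd (picard u l n) x) \<longlonglongrightarrow> sol2 l x"
  using picard_uniform_x[of l] assms by (auto intro: tendsto_uniform_limitI)

lemma picard_partial_bound:
  assumes "x \<in> {0..pi}"
  shows "cmod (\<Sum>n<N. fst (picard u l n) x) + cmod (\<Sum>n<N. snd (picard u l n) x) \<le> 2 * exp (Wt (cmod l) pi)"
proof -
  have s: "(\<Sum>n<N. Wt (cmod l) pi ^ n / fact n) \<le> exp (Wt (cmod l) pi)"
  proof -
    have "0 \<le> Wt (cmod l) pi" unfolding Wt_def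
      using absint_int(1)[OF wt_absint, of 0 pi] wt_nonneg[of "cmod l"] by (intro integral_nonneg) auto
    moreover have "(\<lambda>n. Wt (cmod l) pi ^ n / fact n) sums exp (Wt (cmod l) pi)"
      using exp_converges[of "Wt (cmod l) pi"] by (simp add: divide_inverse mult.commute)
    ultimately show ?thesis
      using sum_le_suminf[OF summable_exp_series, of "{..<N}" "Wt (cmod l) pi"] by (auto simp: sums_iff)
  qed
  have "cmod (\<Sum>n<N. fst (picard u l n) x) \<le> (\<Sum>n<N. Wt (cmod l) pi ^ n / fact n)"
    by (rule order_trans[OF norm_sum sum_mono]) (use picard_bound_pi[OF order_refl assms] in auto)
  moreover have "cmod (\<Sum>n<N. snd (picard u l n) x) \<le> (\<Sum>n<N. Wt (cmod l) pi ^ n / fact n)"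
    by (rule order_trans[OF norm_sum sum_mono]) (use picard_bound_pi[OF order_refl assms] in auto)
  ultimately show ?thesis using s by linarith
qed

text \<open>\<open>T\<close> stands for either row of the coefficient matrix. Dominated convergence
  carries the series through the integral, the majorant being \<open>wt\<close> times the bound of
  \<open>picard_partial_bound\<close>, which is independent of the number of terms.\<close>

lemma sol_limit_integral:
  assumes x: "x \<in> {0..pi}"
    and T: "\<And>t a c. cmod (T t a c) \<le> wt (cmod l) t * (cmod a + cmod c)"
    and add: "\<And>t a c a' c'. T t (a + a') (c + c') = T t a c + T t a' c'" and zero: "\<And>t. T t 0 0 = 0"
    and int: "\<And>a c. continuous_on {0..pi} a \<Longrightarrow> continuous_on {0..pi} c \<Longrightarrow> (\<lambda>t. T t (a t) (c t)) absolutely_integrable_on {0..pi}"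
  shows "(\<lambda>N. \<Sum>n<N. integral {0..x} (\<lambda>t. T t (fst (picard u l n) t) (snd (picard u l n) t)))
    \<longlonglongrightarrow> integral {0..x} (\<lambda>t. T t (sol1 l t) (sol2 l t))"
proof -
  let ?w = "wt (cmod l)"
  let ?a = "\<lambda>N t. \<Sum>n<N. fst (picard u l n) t" and ?c = "\<lambda>N t. \<Sum>n<N. snd (picard u l n) t"
  have cac: "continuous_on {0..pi} (?a N)" "continuous_on {0..pi} (?c N)" for N
    by (intro continuous_intros picard_cont)+
  have Ti: "(\<lambda>t. T t (a t) (c t)) integrable_on {0..x}" if "continuous_on {0..pi} a" "continuous_on {0..pi} c" for a c
    using absint_int(1)[OF int[OF that], of 0 x] x by auto
  have Tsum: "T t (?a N t) (?c N t) = (\<Sum>n<N. T t (fst (picard u l n) t) (snd (picard u l n) t))" for N t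
    by (induction N) (auto simp: add zero)
  have w0: "?w t \<ge> 0" for t by (intro wt_nonneg) auto
  have dist: "cmod (T t a c - T t a' c') \<le> ?w t * (cmod (a - a') + cmod (c - c'))" for t a c a' c'
    using T[of t "a - a'" "c - c'"] add[of t "a - a'" a' "c - c'" c'] by simp
  have "(\<lambda>N. integral {0..x} (\<lambda>t. T t (?a N t) (?c N t))) \<longlonglongrightarrow> integral {0..x} (\<lambda>t. T t (sol1 l t) (sol2 l t))"
  proof (rule dominated_convergence(2))
    show "(\<lambda>t. T t (?a N t) (?c N t)) integrable_on {0..x}" for N by (rule Ti[OF cac])
    show "(\<lambda>t. ?w t * (2 * exp (Wt (cmod l) pi))) integrable_on {0..x}"
      using absint_int(1)[OF wt_absint, of 0 x] x by (intro integrable_on_mult_left) auto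
    fix t assume t: "t \<in> {0..x}"
    show "cmod (T t (?a N t) (?c N t)) \<le> ?w t * (2 * exp (Wt (cmod l) pi))" for N
    proof -
      have "?w t * (cmod (?a N t) + cmod (?c N t)) \<le> ?w t * (2 * exp (Wt (cmod l) pi))"
        using t x by (intro mult_left_mono w0 picard_partial_bound) auto
      with T[of t "?a N t" "?c N t"] show ?thesis by linarith
    qed
    have "(\<lambda>N. ?w t * (cmod (?a N t - sol1 l t) + cmod (?c N t - sol2 l t))) \<longlonglongrightarrow> ?w t * (cmod (sol1 l t - sol1 l t) + cmod (sol2 l t - sol2 l t))"
      using t x by (intro tendsto_intros picard_sums) auto
    then have "(\<lambda>N. T t (?a N t) (?c N t) - T t (sol1 l t) (sol2 l t)) \<longlonglongrightarrow> 0"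
      using Lim_null_comparison[of "\<lambda>N. T t (?a N t) (?c N t) - T t (sol1 l t) (sol2 l t)"
          "\<lambda>N. ?w t * (cmod (?a N t - sol1 l t) + cmod (?c N t - sol2 l t))" sequentially]
        dist[of t "?a _ t" "?c _ t" "sol1 l t" "sol2 l t"] by simp
    then show "(\<lambda>N. T t (?a N t) (?c N t)) \<longlonglongrightarrow> T t (sol1 l t) (sol2 l t)" by (rule LIM_zero_cancel)
  qed
  moreover have "integral {0..x} (\<lambda>t. T t (?a N t) (?c N t)) = (\<Sum>n<N. integral {0..x} (\<lambda>t. T t (fst (picard u l n) t) (snd (picard u l n) t)))" for N
    unfolding Tsum by (rule integral_sum) (auto intro!: Ti[OF picard_cont])
  ultimately show ?thesis by (simp only:)
qed

lemma sol_reg_sol: "reg_sol u l (sol1 l) (sol2 l)" "sol1 l 0 = 0" "sol2 l 0 = 1"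
proof -
  note sb = system_bound[of l "cmod l", OF order_refl]
  have T1: "cmod (u t * a + c) \<le> wt (cmod l) t * (cmod a + cmod c)" for t a c
    using sb[of t a c] by (smt (verit) norm_ge_zero)
  have T2: "cmod (- (l + (u t)^2) * a - u t * c) \<le> wt (cmod l) t * (cmod a + cmod c)" for t a c
    using sb[of t a c] by (smt (verit) norm_ge_zero)
  have e1: "sol1 l x = integral {0..x} (\<lambda>t. u t * sol1 l t + sol2 l t)" if x: "x \<in> {0..pi}" for x
  proof (rule LIMSEQ_unique)
    have "(\<lambda>N. \<Sum>n<N. integral {0..x} (\<lambda>t. u t * fst (picard u l n) t + snd (picard u l n) t)) \<longlonglongrightarrow> integral {0..x} (\<lambda>t. u t * sol1 l t + sol2 l t)"
      by (rule sol_limit_integral[OF x T1]) (use rhs_absint in \<open>simp_all add: distrib_left\<close>)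
    moreover have "(\<Sum>n<N. integral {0..x} (\<lambda>t. u t * fst (picard u l n) t + snd (picard u l n) t)) = (\<Sum>n<Suc N. fst (picard u l n) x)" for N
      unfolding sum.lessThan_Suc_shift by simp
    ultimately show "(\<lambda>N. \<Sum>n<Suc N. fst (picard u l n) x) \<longlonglongrightarrow> integral {0..x} (\<lambda>t. u t * sol1 l t + sol2 l t)" by simp
    show "(\<lambda>N. \<Sum>n<Suc N. fst (picard u l n) x) \<longlonglongrightarrow> sol1 l x"
      by (rule LIMSEQ_Suc[OF picard_sums(1)[OF x]])
  qed
  have e2: "sol2 l x = 1 + integral {0..x} (\<lambda>t. - (l + (u t)^2) * sol1 l t - u t * sol2 l t)" if x: "x \<in> {0..pi}" for x
  proof (rule LIMSEQ_unique)
    have "(\<lambda>N. \<Sum>n<N. integral {0..x} (\<lambda>t. - (l + (u t)^2) * fst (picard u l n) t - u t * snd (picard u l n) t)) \<longlonglongrightarrow> integral {0..x} (\<lambda>t. - (l + (u t)^2) * sol1 l t - u t * sol2 l t)"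
      by (rule sol_limit_integral[OF x T2]) (use rhs_absint in \<open>auto simp: ring_distribs\<close>)
    from tendsto_add[OF tendsto_const[of 1] this]
    show "(\<lambda>N. 1 + (\<Sum>n<N. integral {0..x} (\<lambda>t. - (l + (u t)^2) * fst (picard u l n) t - u t * snd (picard u l n) t))) \<longlonglongrightarrow> 1 + integral {0..x} (\<lambda>t. - (l + (u t)^2) * sol1 l t - u t * sol2 l t)" .
    have "1 + (\<Sum>n<N. integral {0..x} (\<lambda>t. - (l + (u t)^2) * fst (picard u l n) t - u t * snd (picard u l n) t)) = (\<Sum>n<Suc N. snd (picard u l n) x)" for N
      unfolding sum.lessThan_Suc_shift by simp
    then show "(\<lambda>N. 1 + (\<Sum>n<N. integral {0..x} (\<lambda>t. - (l + (u t)^2) * fst (picard u l n) t - u t * snd (picard u l n) t))) \<longlonglongrightarrow> sol2 l x"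
      using LIMSEQ_Suc[OF picard_sums(2)[OF x]] by simp
  qed
  show z: "sol1 l 0 = 0" "sol2 l 0 = 1" using e1[of 0] e2[of 0] by auto
  show "reg_sol u l (sol1 l) (sol2 l)"
    unfolding reg_sol_def z using e1 e2 rhs_absint[OF sol_cont] by auto
qed

text \<open>Subtracting \<open>y2 0\<close> times the normalized solution leaves zero Cauchy
  data.\<close>

lemma reg_sol_unique:
  assumes y: "reg_sol u l y1 y2" and 0: "y1 0 = 0" and x: "x \<in> {0..pi}"
  shows "y1 x = y2 0 * sol1 l x" "y2 x = y2 0 * sol2 l x"
  using reg_sol_zero[OF reg_sol_lincomb[OF y sol_reg_sol(1), of "- y2 0"] _ _ x] 0 sol_reg_sol(2,3)[of l] by auto

lemma char_fn_eq: "char_fn u l = sol2 l pi"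
  unfolding char_fn_def
proof (rule the_equality)
  show "\<exists>y1 y2. reg_sol u l y1 y2 \<and> y1 0 = 0 \<and> y2 0 = 1 \<and> y2 pi = sol2 l pi"
    using sol_reg_sol[of l] by blast
  fix c assume "\<exists>y1 y2. reg_sol u l y1 y2 \<and> y1 0 = 0 \<and> y2 0 = 1 \<and> y2 pi = c"
  then show "c = sol2 l pi" using reg_sol_unique(2)[of l _ _ pi] by force
qed

lemma char_fn_holo: "char_fn u holomorphic_on S"
proof -
  have "char_fn u = (\<lambda>l. sol2 l pi)" using char_fn_eq by auto
  then show ?thesis using sol2_holo[of pi] holomorphic_on_subset by auto
qed

lemma is_eigenvalue_iff: "is_eigenvalue u l \<longleftrightarrow> char_fn u l = 0"
proof
  assume "is_eigenvalue u l"
  then obtain y1 y2 where y: "reg_sol u l y1 y2" "y1 0 = 0" "y2 pi = 0" "\<exists>x\<in>{0..pi}. y1 x \<noteq> 0"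
    unfolding is_eigenvalue_def by blast
  then have "y2 0 \<noteq> 0" using reg_sol_unique(1)[OF y(1,2)] by auto
  moreover have "y2 0 * sol2 l pi = 0" using reg_sol_unique(2)[OF y(1,2), of pi] y(3) by auto
  ultimately show "char_fn u l = 0" by (simp add: char_fn_eq)
next
  assume c: "char_fn u l = 0"
  \<comment> \<open>An eigenfunction must be nonzero in its first component. If
    \<open>sol1 l\<close> vanished on the interval, the first equation would give
    \<open>sol2 l\<close> zero integral over every \<open>{0..x}\<close>; differentiating at 0
    contradicts \<open>sol2 l 0 = 1\<close>.\<close>
  have "\<exists>x\<in>{0..pi}. sol1 l x \<noteq> 0"
  proof (rule ccontr)
    assume "\<not> ?thesis"
    then have z: "\<And>x. x \<in> {0..pi} \<Longrightarrow> sol1 l x = 0" by auto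
    have i: "integral {0..x} (sol2 l) = 0" if x: "x \<in> {0..pi}" for x
    proof -
      have "integral {0..x} (sol2 l) = integral {0..x} (\<lambda>t. u t * sol1 l t + sol2 l t)"
        using z x by (intro integral_cong) auto
      also have "\<dots> = sol1 l x - sol1 l 0"
        using antideriv_eq[of pi "sol1 l", OF _ x] sol_reg_sol(1)[of l] unfolding reg_sol_antideriv by metis
      also have "\<dots> = 0" using z[OF x] z[of 0] by simp
      finally show ?thesis .
    qed
    have "((\<lambda>x. integral {0..x} (sol2 l)) has_vector_derivative sol2 l 0) (at 0 within {0..pi})"
      by (intro integral_has_vector_derivative sol_cont) auto
    then have "((\<lambda>x. 0) has_vector_derivative sol2 l 0) (at 0 within {0..pi})"
      by (rule has_vector_derivative_transform[rotated 2]) (use i in auto)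
    then have "0 = sol2 l 0" 
      by (rule vector_derivative_unique_within[rotated 1, OF has_vector_derivative_const]) (auto simp: trivial_limit_within)
    then show False using sol_reg_sol(3)[of l] by simp
  qed
  then show "is_eigenvalue u l"
    unfolding is_eigenvalue_def using sol_reg_sol[of l] c unfolding char_fn_eq by blast
qed

end

section \<open>Amplitudes of the solution\<close>

text \<open>\<open>e2 k\<close> and \<open>e2 (- k)\<close> are the factors e and e' of the
  overview.\<close>

definition e2 :: "complex \<Rightarrow> real \<Rightarrow> complex" where
  "e2 k t = exp (2 * \<i> * k * of_real t)"

lemma e2_minus: "e2 k t * e2 (- k) t = 1" "e2 (- k) t * e2 k t = 1"
  by (simp_all add: e2_def exp_add[symmetric])

lemma e2_cont: "continuous_on S (e2 k)"
  unfolding e2_def by (intro continuous_intros)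

lemma e2_0 [simp]: "e2 k 0 = 1"
  by (simp add: e2_def)

context L2_potential
begin

text \<open>\<open>amp k\<close> and \<open>amp (- k)\<close> are \<open>P\<close> and \<open>Q\<close>; \<open>af k\<close> is \<open>a\<close>.\<close>

definition amp :: "complex \<Rightarrow> real \<Rightarrow> complex" where
  "amp k x = exp (- \<i> * k * of_real x) * (sol2 (k\<^sup>2) x + \<i> * k * sol1 (k\<^sup>2) x)"

definition af :: "complex \<Rightarrow> real \<Rightarrow> complex" where
  "af k t = (u t)\<^sup>2 / (2 * \<i> * k)"

definition U1 :: real where "U1 = integral {0..pi} (\<lambda>t. cmod (u t))"
definition U2 :: real where "U2 = integral {0..pi} (\<lambda>t. (cmod (u t))\<^sup>2)"

lemma amp_0 [simp]: "amp k 0 = 1"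
  using sol_reg_sol[of "k\<^sup>2"] by (simp add: amp_def)

lemma char_fn_amp: "char_fn u (k\<^sup>2) = (exp (\<i> * k * pi) * amp k pi + exp (- \<i> * k * pi) * amp (- k) pi) / 2"
proof -
  have "exp (\<i> * k * pi) * exp (- \<i> * k * pi) = 1" "exp (- \<i> * k * pi) * exp (\<i> * k * pi) = 1"
    by (simp_all add: exp_add[symmetric])
  then have "exp (\<i> * k * pi) * amp k pi = sol2 (k\<^sup>2) pi + \<i> * k * sol1 (k\<^sup>2) pi"
    "exp (- \<i> * k * pi) * amp (- k) pi = sol2 (k\<^sup>2) pi - \<i> * k * sol1 (k\<^sup>2) pi"
    unfolding amp_def by (simp_all add: mult.assoc[symmetric])
  then show ?thesis by (simp add: char_fn_eq)
qed

text \<open>One statement serves both amplitudes: the solution depends on \<open>k^2\<close> only,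
  so the equation for the second amplitude is this one at \<open>- k\<close>.\<close>

lemma amp_antideriv:
  assumes k: "k \<noteq> 0"
  shows "antideriv pi (amp k) (\<lambda>t. - (u t * e2 (- k) t * amp (- k) t) - af k t * (amp k t - e2 (- k) t * amp (- k) t))"
proof -
  let ?y1 = "sol1 (k\<^sup>2)" and ?y2 = "sol2 (k\<^sup>2)"
  note y = sol_reg_sol(1)[of "k\<^sup>2", unfolded reg_sol_antideriv]
  have a1: "antideriv pi (\<lambda>x. ?y2 x + \<i> * k * ?y1 x)
     (\<lambda>t. (- (k\<^sup>2 + (u t)\<^sup>2) * ?y1 t - u t * ?y2 t) + \<i> * k * (u t * ?y1 t + ?y2 t))"
    using y by (intro antideriv_add antideriv_cmult) auto
  have a2: "antideriv pi (\<lambda>x. exp (- \<i> * k * of_real x + 0)) (\<lambda>x. (- \<i> * k) * exp (- \<i> * k * of_real x + 0))"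
    by (rule antideriv_exp)
  show ?thesis
  proof (rule antideriv_cong[OF antideriv_mult[OF a2 a1]])
    fix t
    show "exp (- \<i> * k * of_real t + 0) * (?y2 t + \<i> * k * ?y1 t) = amp k t" by (simp add: amp_def)
    have "e2 (- k) t * exp (\<i> * k * of_real t) = exp (- \<i> * k * of_real t)"
      unfolding e2_def exp_add[symmetric] by (simp add: algebra_simps)
    then have m: "e2 (- k) t * amp (- k) t = exp (- \<i> * k * of_real t) * (?y2 t - \<i> * k * ?y1 t)"
      unfolding amp_def by (simp add: mult.assoc[symmetric])
    have m2: "amp k t = exp (- \<i> * k * of_real t) * (?y2 t + \<i> * k * ?y1 t)" by (simp add: amp_def)
    have af: "af k t * (2 * \<i> * k) = (u t)\<^sup>2" using k by (simp add: af_def)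
    have "- (u t * e2 (- k) t * amp (- k) t) - af k t * (amp k t - e2 (- k) t * amp (- k) t)
      = - u t * (e2 (- k) t * amp (- k) t) - af k t * (amp k t - e2 (- k) t * amp (- k) t)" by simp
    also have "\<dots> = exp (- \<i> * k * of_real t) * (- u t * (?y2 t - \<i> * k * ?y1 t) - (af k t * (2 * \<i> * k)) * ?y1 t)"
      unfolding m m2 by (simp add: algebra_simps)
    also have "\<dots> = exp (- \<i> * k * of_real t) * (- u t * (?y2 t - \<i> * k * ?y1 t) - (u t)\<^sup>2 * ?y1 t)"
      unfolding af ..
    also have "\<dots> = (- \<i> * k) * exp (- \<i> * k * of_real t) * (?y2 t + \<i> * k * ?y1 t)
        + exp (- \<i> * k * of_real t) * ((- (k\<^sup>2 + (u t)\<^sup>2) * ?y1 t - u t * ?y2 t) + \<i> * k * (u t * ?y1 t + ?y2 t))"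
    proof -
      have "- u t * (?y2 t - \<i> * k * ?y1 t) - (u t)\<^sup>2 * ?y1 t
        = (- \<i> * k) * (?y2 t + \<i> * k * ?y1 t) + ((- (k\<^sup>2 + (u t)\<^sup>2) * ?y1 t - u t * ?y2 t) + \<i> * k * (u t * ?y1 t + ?y2 t))"
        by (simp add: algebra_simps power2_eq_square)
      from arg_cong[OF this, of "\<lambda>z. exp (- \<i> * k * of_real t) * z"] show ?thesis
        unfolding distrib_left by (simp only: mult_ac)
    qed
    finally show "(- \<i> * k) * exp (- \<i> * k * of_real t + 0) * (?y2 t + \<i> * k * ?y1 t)
        + exp (- \<i> * k * of_real t + 0) * ((- (k\<^sup>2 + (u t)\<^sup>2) * ?y1 t - u t * ?y2 t) + \<i> * k * (u t * ?y1 t + ?y2 t))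
      = - (u t * e2 (- k) t * amp (- k) t) - af k t * (amp k t - e2 (- k) t * amp (- k) t)" by simp
  qed
qed

lemma amp_cont: "k \<noteq> 0 \<Longrightarrow> continuous_on {0..pi} (amp k)"
  using amp_antideriv antideriv_cont by blast

lemma af_absint: "af k absolutely_integrable_on {0..pi}"
  using absint_mult_cont(1)[OF u2_absint, of "\<lambda>t. 1 / (2 * \<i> * k)"] by (simp add: af_def[abs_def])

lemma af_minus: "af (- k) t = - af k t"
  by (simp add: af_def)

lemma af_norm: "cmod (af k t) = (cmod (u t))\<^sup>2 / (2 * cmod k)"
  by (simp add: af_def norm_divide norm_mult norm_power)

lemma uv_absint: "(\<lambda>t. cmod (u t) + (cmod (u t))\<^sup>2) absolutely_integrable_on {0..pi}"
  by (rule set_integral_add(1)[OF set_integrable_norm[OF u_absint] u2n_absint])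

lemma uv_integral: "integral {0..pi} (\<lambda>t. cmod (u t) + (cmod (u t))\<^sup>2) = U1 + U2"
  unfolding U1_def U2_def using absint_int(2)[OF u_absint, of 0 pi] absint_int(1)[OF u2n_absint, of 0 pi]
  by (intro integral_add) auto

lemma integral_mono_set:
  fixes f :: "real \<Rightarrow> real"
  assumes "f absolutely_integrable_on {0..b}" "\<And>t. t \<in> {0..b} \<Longrightarrow> 0 \<le> f t" "0 \<le> x" "x \<le> b"
  shows "integral {0..x} f \<le> integral {0..b} f"
  using assms absint_int(1)[OF assms(1), of 0 x] absint_int(1)[OF assms(1), of 0 b] by (intro integral_subset_le) auto

lemma af_mult_bound:
  assumes k: "k \<noteq> 0" and g: "continuous_on {0..pi} g" "\<And>t. t \<in> {0..pi} \<Longrightarrow> cmod (g t) \<le> B" and x: "x \<in> {0..pi}"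
  shows "cmod (integral {0..x} (\<lambda>t. af k t * g t)) \<le> U2 / (2 * cmod k) * B"
proof -
  have B: "B \<ge> 0" using order_trans[OF norm_ge_zero g(2)[of 0]] by simp
  have i: "(\<lambda>t. (cmod (u t))\<^sup>2 * (B / (2 * cmod k))) absolutely_integrable_on {0..pi}"
    by (intro absint_mult_cont u2n_absint) auto
  have "cmod (integral {0..x} (\<lambda>t. af k t * g t)) \<le> integral {0..x} (\<lambda>t. (cmod (u t))\<^sup>2 * (B / (2 * cmod k)))"
  proof (rule integral_norm_le_absint[OF absint_mult_cont(1)[OF af_absint g(1)] _ _ _ i])
    fix t assume "t \<in> {0..x}"
    then have "cmod (af k t) * cmod (g t) \<le> (cmod (u t))\<^sup>2 / (2 * cmod k) * B"
      using g(2)[of t] x unfolding af_norm by (intro mult_left_mono) auto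
    then show "cmod (af k t * g t) \<le> (cmod (u t))\<^sup>2 * (B / (2 * cmod k))" by (simp add: norm_mult)
  qed (use x in auto)
  also have "\<dots> \<le> integral {0..pi} (\<lambda>t. (cmod (u t))\<^sup>2 * (B / (2 * cmod k)))"
    using x B by (intro integral_mono_set[OF i]) auto
  also have "\<dots> = U2 / (2 * cmod k) * B" by (simp add: U2_def)
  finally show ?thesis .
qed

text \<open>Gronwall constant of the weighted amplitude system when the kernel is bounded by
  \<open>K\<close>: the prefactor collects the inhomogeneous terms, the exponent is the integral of
  the weight \<open>2 * K * (|u| + |u|^2)\<close>.\<close>

definition Cb :: "real \<Rightarrow> real" where
  "Cb K = 2 * (1 + K * (K + 1)) * exp (2 * K * (U1 + U2))"

lemma Cb_pos: "K \<ge> 0 \<Longrightarrow> Cb K > 0"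
  by (simp add: Cb_def add_pos_nonneg)

text \<open>The weight \<open>e2 k x\<close> on the first amplitude and the kernel bound for \<open>t \<le> x\<close> cover both the upper half plane
  (with \<open>K = 1\<close>) and horizontal strips.\<close>

lemma amp_bound:
  assumes k: "cmod k \<ge> 1" and K: "K \<ge> 1"
    and ker: "\<And>t x. 0 \<le> t \<Longrightarrow> t \<le> x \<Longrightarrow> x \<le> pi \<Longrightarrow> cmod (e2 k x * e2 (- k) t) \<le> K"
    and b1: "\<And>x. x \<in> {0..pi} \<Longrightarrow> cmod (integral {0..x} (\<lambda>t. u t * e2 k t)) \<le> b"
    and b2: "\<And>x. x \<in> {0..pi} \<Longrightarrow> cmod (e2 k x * integral {0..x} (\<lambda>t. u t * e2 (- k) t)) \<le> b"
    and b3: "U2 / cmod k \<le> b"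
    and x: "x \<in> {0..pi}"
  shows "cmod (e2 k x * (amp k x - 1)) + cmod (amp (- k) x - 1) \<le> Cb K * b"
proof -
  have k0: "k \<noteq> 0" "- k \<noteq> 0" using k by auto
  define X where "X = (\<lambda>x. e2 k x * (amp k x - 1))"
  define Z where "Z = (\<lambda>x. amp (- k) x - 1)"
  define E where "E = (\<lambda>x. cmod (X x) + cmod (Z x))"
  have cX: "continuous_on {0..pi} X" unfolding X_def by (intro continuous_intros e2_cont amp_cont k0)
  have cZ: "continuous_on {0..pi} Z" unfolding Z_def by (intro continuous_intros e2_cont amp_cont k0)
  have cE: "continuous_on {0..pi} E" unfolding E_def by (intro continuous_intros cX cZ)
  have E0: "E t \<ge> 0" for t by (simp add: E_def)
  have eK: "cmod (e2 k t) \<le> K" if "t \<in> {0..pi}" for t using ker[of 0 t] that by simp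
  define v where "v = (\<lambda>t. cmod (u t) + (cmod (u t))\<^sup>2)"
  have vi: "v absolutely_integrable_on {0..pi}" unfolding v_def by (rule uv_absint)
  define h where "h = (\<lambda>t. v t * E t + (cmod (u t))\<^sup>2 * ((K + 1) / (2 * cmod k)))"
  have hi: "h absolutely_integrable_on {0..pi}"
    unfolding h_def by (intro set_integral_add(1) absint_mult_cont(1) vi cE u2n_absint) auto
  \<comment> \<open>What remains of the right-hand sides once the leading terms are split off: the
    derivative of \<open>amp k\<close> is \<open>- u t * e2 (- k) t - e2 (- k) t * B Z t\<close>,
    that of \<open>amp (- k)\<close> is \<open>- u t * e2 k t - B X t\<close>. Multiplying the first
    integral equation by \<open>e2 k x\<close> produces the bounded kernel.\<close>
  define B where "B = (\<lambda>Y t. u t * Y t + af k t * (X t - Z t) + af k t * (e2 k t - 1))"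
  have Bi: "B Y absolutely_integrable_on {0..pi}" if "continuous_on {0..pi} Y" for Y
    unfolding B_def using that
    by (intro set_integral_add(1) absint_mult_cont(1) u_absint af_absint continuous_intros cX cZ e2_cont)
  have Bh: "cmod (B Y t) \<le> h t" if Y: "cmod (Y t) \<le> E t" and t: "t \<in> {0..pi}" for Y t
  proof -
    have af1: "cmod (af k t) \<le> (cmod (u t))\<^sup>2"
    proof -
      have "(cmod (u t))\<^sup>2 \<le> (cmod (u t))\<^sup>2 * (2 * cmod k)" using k by (intro mult_right_le_one_le[THEN order_trans] mult_left_mono[of 1 "2 * cmod k", simplified]) auto
      then show ?thesis unfolding af_norm using k by (simp add: divide_le_eq)
    qed
    have "cmod (B Y t) \<le> cmod (u t) * cmod (Y t) + cmod (af k t) * cmod (X t - Z t) + cmod (af k t) * cmod (e2 k t - 1)"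
      unfolding B_def by (intro order_trans[OF norm_triangle_ineq] add_mono) (auto simp: norm_mult)
    also have "\<dots> \<le> cmod (u t) * E t + (cmod (u t))\<^sup>2 * E t + cmod (af k t) * (K + 1)"
    proof (intro add_mono mult_mono Y af1 order_refl)
      show "cmod (X t - Z t) \<le> E t" unfolding E_def by (rule norm_triangle_ineq4)
      show "cmod (e2 k t - 1) \<le> K + 1" using norm_triangle_ineq4[of "e2 k t" 1] eK[OF t] by simp
    qed auto
    also have "\<dots> = h t" by (simp add: h_def v_def af_norm algebra_simps)
    finally show ?thesis .
  qed
  have hx: "integral {0..x} h \<le> integral {0..x} (\<lambda>t. v t * E t) + (K + 1) * b" if x: "x \<in> {0..pi}" for x
  proof -
    have i1: "(\<lambda>t. v t * E t) integrable_on {0..x}"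
      using absint_int(1)[OF absint_mult_cont(1)[OF vi cE], of 0 x] x by auto
    have i2: "(\<lambda>t. (cmod (u t))\<^sup>2) integrable_on {0..x}" using absint_int(1)[OF u2n_absint, of 0 x] x by auto
    have "integral {0..x} h = integral {0..x} (\<lambda>t. v t * E t) + integral {0..x} (\<lambda>t. (cmod (u t))\<^sup>2) * ((K + 1) / (2 * cmod k))"
      unfolding h_def using integral_add[OF i1 integrable_on_mult_left[OF i2, of "(K + 1) / (2 * cmod k)"]]
      by (simp only: Henstock_Kurzweil_Integration.integral_mult_left)
    moreover have "integral {0..x} (\<lambda>t. (cmod (u t))\<^sup>2) * ((K + 1) / (2 * cmod k)) \<le> U2 * ((K + 1) / (2 * cmod k))"
      unfolding U2_def using x K by (intro mult_right_mono integral_mono_set u2n_absint) auto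
    moreover have "U2 * ((K + 1) / (2 * cmod k)) = (K + 1) / 2 * (U2 / cmod k)" by simp
    moreover have "(K + 1) / 2 * (U2 / cmod k) \<le> (K + 1) / 2 * b" using b3 K by (intro mult_left_mono) auto
    moreover have "0 \<le> (K + 1) * b"
      using K b1[OF x] by (intro mult_nonneg_nonneg) (auto intro: order_trans[OF norm_ge_zero])
    moreover have "(K + 1) / 2 * b = ((K + 1) * b) / 2" by simp
    ultimately show ?thesis by linarith
  qed
  have ineq: "E x \<le> 2 * (1 + K * (K + 1)) * b + integral {0..x} (\<lambda>t. (2 * K * v t) * E t)" if x: "x \<in> {0..pi}" for x
  proof -
    have hx0: "0 \<le> integral {0..x} h"
      using x K E0 by (intro integral_nonneg absint_int(1)[OF hi]) (auto simp: h_def v_def)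
    have b0: "b \<ge> 0" using b1[OF x] norm_ge_zero order_trans by blast
    have iu: "(\<lambda>t. u t * e2 k' t) integrable_on {0..x}" for k'
      using absint_int(1)[OF absint_mult_cont(1)[OF u_absint e2_cont], of 0 x] x by auto
    have Bi1: "(\<lambda>t. e2 (- k) t * B Z t) absolutely_integrable_on {0..pi}"
      by (rule absint_mult_cont(2)[OF Bi[OF cZ] e2_cont])
    have iB1: "(\<lambda>t. e2 (- k) t * B Z t) integrable_on {0..x}" using absint_int(1)[OF Bi1, of 0 x] x by auto
    have iB2: "B X integrable_on {0..x}" using absint_int(1)[OF Bi[OF cX], of 0 x] x by auto
    have "amp k x - 1 = integral {0..x} (\<lambda>t. - (u t * e2 (- k) t * amp (- k) t) - af k t * (amp k t - e2 (- k) t * amp (- k) t))"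
      using antideriv_eq[OF amp_antideriv[OF k0(1)] x] by simp
    also have "\<dots> = integral {0..x} (\<lambda>t. - (u t * e2 (- k) t) - e2 (- k) t * B Z t)"
    proof (rule integral_cong)
      fix t
      have X: "e2 (- k) t * X t = amp k t - 1"
        unfolding X_def by (simp add: mult.assoc[symmetric] e2_minus)
      have "e2 (- k) t * B Z t = u t * e2 (- k) t * (amp (- k) t - 1) + af k t * (e2 (- k) t * X t - e2 (- k) t * Z t) + af k t * (e2 (- k) t * e2 k t - e2 (- k) t)"
        by (simp add: B_def Z_def algebra_simps)
      also have "\<dots> = u t * e2 (- k) t * (amp (- k) t - 1) + af k t * (amp k t - e2 (- k) t * amp (- k) t)"
        unfolding X e2_minus Z_def by (simp add: algebra_simps)
      finally show "- (u t * e2 (- k) t * amp (- k) t) - af k t * (amp k t - e2 (- k) t * amp (- k) t) = - (u t * e2 (- k) t) - e2 (- k) t * B Z t"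
        by (simp add: algebra_simps)
    qed
    also have "\<dots> = - integral {0..x} (\<lambda>t. u t * e2 (- k) t) - integral {0..x} (\<lambda>t. e2 (- k) t * B Z t)"
      using integral_diff[OF integrable_neg[OF iu[of "- k"]] iB1] by simp
    finally have "amp k x - 1 = - integral {0..x} (\<lambda>t. u t * e2 (- k) t) - integral {0..x} (\<lambda>t. e2 (- k) t * B Z t)" .
    moreover have "integral {0..x} (\<lambda>t. e2 k x * (e2 (- k) t * B Z t)) = e2 k x * integral {0..x} (\<lambda>t. e2 (- k) t * B Z t)"
      by (rule Henstock_Kurzweil_Integration.integral_mult_right)
    ultimately have "X x = - (e2 k x * integral {0..x} (\<lambda>t. u t * e2 (- k) t)) - integral {0..x} (\<lambda>t. e2 k x * (e2 (- k) t * B Z t))"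
      unfolding X_def by (simp add: right_diff_distrib)
    moreover have "cmod (integral {0..x} (\<lambda>t. e2 k x * (e2 (- k) t * B Z t))) \<le> integral {0..x} (\<lambda>t. K * h t)"
    proof (rule integral_norm_le_absint[of pi])
      show "(\<lambda>t. e2 k x * (e2 (- k) t * B Z t)) absolutely_integrable_on {0..pi}"
        by (intro absint_mult_cont(2)[OF Bi1] continuous_intros)
      show "(\<lambda>t. K * h t) absolutely_integrable_on {0..pi}"
        by (intro absint_mult_cont(2)[OF hi] continuous_intros)
      fix t assume t: "t \<in> {0..x}"
      have "cmod (e2 k x * (e2 (- k) t * B Z t)) = cmod (e2 k x * e2 (- k) t) * cmod (B Z t)" by (simp add: norm_mult)
      also have "\<dots> \<le> K * h t" using t x K by (intro mult_mono ker Bh) (auto simp: E_def)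
      finally show "cmod (e2 k x * (e2 (- k) t * B Z t)) \<le> K * h t" .
    qed (use x in auto)
    moreover have "integral {0..x} (\<lambda>t. K * h t) = K * integral {0..x} h" by simp
    ultimately have X: "cmod (X x) \<le> b + K * integral {0..x} h"
      using norm_triangle_ineq4[of "- (e2 k x * integral {0..x} (\<lambda>t. u t * e2 (- k) t))" "integral {0..x} (\<lambda>t. e2 k x * (e2 (- k) t * B Z t))"] b2[OF x]
      by simp
    have "Z x = integral {0..x} (\<lambda>t. - (u t * e2 k t * amp k t) - af (- k) t * (amp (- k) t - e2 k t * amp k t))"
      using antideriv_eq[OF amp_antideriv[OF k0(2)] x] by (simp add: Z_def)
    also have "\<dots> = integral {0..x} (\<lambda>t. - (u t * e2 k t) - B X t)"
      by (rule integral_cong) (simp add: B_def X_def Z_def af_minus algebra_simps)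
    also have "\<dots> = - integral {0..x} (\<lambda>t. u t * e2 k t) - integral {0..x} (B X)"
      using integral_diff[OF integrable_neg[OF iu[of k]] iB2] by simp
    finally have "cmod (Z x) \<le> cmod (integral {0..x} (\<lambda>t. u t * e2 k t)) + cmod (integral {0..x} (B X))"
      by (metis norm_minus_cancel norm_triangle_ineq4)
    moreover have "cmod (integral {0..x} (B X)) \<le> integral {0..x} h"
      by (rule integral_norm_le_absint[OF Bi[OF cX] _ _ _ hi]) (use x in \<open>auto intro!: Bh simp: E_def\<close>)
    ultimately have Z: "cmod (Z x) \<le> b + integral {0..x} h" using b1[OF x] by linarith
    have "integral {0..x} h \<le> K * integral {0..x} h" using K hx0 mult_right_mono[of 1 K "integral {0..x} h"] by simp
    then have "E x \<le> 2 * b + 2 * (K * integral {0..x} h)" using X Z by (simp add: E_def)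
    also have "\<dots> \<le> 2 * b + 2 * (K * (integral {0..x} (\<lambda>t. v t * E t) + (K + 1) * b))"
      using K hx[OF x] by (intro add_mono mult_left_mono) auto
    also have "\<dots> = 2 * (1 + K * (K + 1)) * b + 2 * K * integral {0..x} (\<lambda>t. v t * E t)"
      by (simp add: algebra_simps)
    also have "2 * K * integral {0..x} (\<lambda>t. v t * E t) = integral {0..x} (\<lambda>t. (2 * K * v t) * E t)"
      by (simp add: mult.assoc)
    finally show ?thesis .
  qed
  have b0: "b \<ge> 0" using b1[OF x] norm_ge_zero order_trans by blast
  have vKi: "(\<lambda>t. 2 * K * v t) absolutely_integrable_on {0..pi}"
    by (intro absint_mult_cont(2)[OF vi] continuous_intros)
  have "E x \<le> 2 * (1 + K * (K + 1)) * b * exp (integral {0..x} (\<lambda>t. 2 * K * v t))"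
    using K b0 by (intro gronwall[OF vKi _ cE _ ineq x]) (auto simp: v_def)
  also have "integral {0..x} (\<lambda>t. 2 * K * v t) = 2 * K * integral {0..x} v" by simp
  also have "2 * (1 + K * (K + 1)) * b * exp (2 * K * integral {0..x} v) \<le> 2 * (1 + K * (K + 1)) * b * exp (2 * K * (U1 + U2))"
  proof -
    have "integral {0..x} v \<le> U1 + U2"
      using integral_mono_set[OF vi, of x] x uv_integral by (auto simp: v_def)
    then show ?thesis using K b0 by (intro mult_left_mono) auto
  qed
  finally show ?thesis by (simp add: E_def X_def Z_def Cb_def mult_ac)
qed

section \<open>Oscillatory integrals and the second order expansion in a strip\<close>

definition osc :: "complex \<Rightarrow> real \<Rightarrow> complex" where
  "osc k x = integral {0..x} (\<lambda>t. u t * e2 k t)"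

text \<open>Everything that the expansion uses about one \<open>k\<close>, in a form symmetric under
  \<open>k\<close> to \<open>- k\<close>. In the end \<open>b\<close> is \<open>gammafun\<close> at
  the eigenvalue and \<open>K\<close> bounds the exponentials in a horizontal strip.\<close>

definition osc_bound :: "real \<Rightarrow> complex \<Rightarrow> real \<Rightarrow> bool" where
  "osc_bound K k b \<longleftrightarrow> cmod k \<ge> 1 \<and> (\<forall>t\<in>{0..pi}. cmod (e2 k t) \<le> K \<and> cmod (e2 (- k) t) \<le> K)
     \<and> (\<forall>x\<in>{0..pi}. cmod (osc k x) \<le> b \<and> cmod (osc (- k) x) \<le> b) \<and> U2 / cmod k \<le> b"

lemma osc_bound_minus: "osc_bound K k b \<Longrightarrow> osc_bound K (- k) b"
  by (auto simp: osc_bound_def)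

lemma osc_antideriv: "antideriv pi (osc k) (\<lambda>t. u t * e2 k t)"
  using antideriv_indefinite[OF absint_mult_cont(1)[OF u_absint e2_cont[of _ k]], of 0]
  by (simp add: osc_def[abs_def])

lemma osc_cont: "continuous_on {0..pi} (osc k)"
  by (rule antideriv_cont[OF osc_antideriv])

lemma osc_0 [simp]: "osc k 0 = 0"
  by (simp add: osc_def)

lemma U_nonneg: "U1 \<ge> 0" "U2 \<ge> 0"
  unfolding U1_def U2_def
  by (intro integral_nonneg absint_int(2)[OF u_absint] absint_int(1)[OF u2n_absint]; simp)+

lemma u_mult_bound:
  assumes g: "continuous_on {0..pi} g" "\<And>t. t \<in> {0..pi} \<Longrightarrow> cmod (g t) \<le> B" and x: "x \<in> {0..pi}"
  shows "cmod (integral {0..x} (\<lambda>t. u t * g t)) \<le> U1 * B"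
proof -
  have B: "B \<ge> 0" using order_trans[OF norm_ge_zero g(2)[of 0]] by simp
  have i: "(\<lambda>t. cmod (u t) * B) absolutely_integrable_on {0..pi}"
    by (intro absint_mult_cont set_integrable_norm u_absint) auto
  have "cmod (integral {0..x} (\<lambda>t. u t * g t)) \<le> integral {0..x} (\<lambda>t. cmod (u t) * B)"
    by (rule integral_norm_le_absint[OF absint_mult_cont(1)[OF u_absint g(1)] _ _ _ i])
      (use x g(2) in \<open>auto simp: norm_mult intro!: mult_left_mono\<close>)
  also have "\<dots> \<le> integral {0..pi} (\<lambda>t. cmod (u t) * B)"
    using x B by (intro integral_mono_set[OF i]) auto
  also have "\<dots> = U1 * B" by (simp add: U1_def)
  finally show ?thesis .
qed

text \<open>With both exponentials bounded by \<open>K\<close>, the kernel is bounded by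
  \<open>K * K\<close> and the weighted oscillatory integral by \<open>K * b\<close>, so
  \<open>amp_bound\<close> applies; multiplying by \<open>e2 (- k)\<close> then removes the weight
  at the cost of one more factor \<open>K\<close>.\<close>

lemma amp_bound_osc:
  assumes o: "osc_bound K k b" and K: "K \<ge> 1" and x: "x \<in> {0..pi}"
  shows "cmod (amp k x - 1) \<le> K * (Cb (K * K) * (K * b))" "cmod (amp (- k) x - 1) \<le> K * (Cb (K * K) * (K * b))"
proof -
  have k: "cmod k \<ge> 1" and eK: "\<And>t. t \<in> {0..pi} \<Longrightarrow> cmod (e2 k t) \<le> K" "\<And>t. t \<in> {0..pi} \<Longrightarrow> cmod (e2 (- k) t) \<le> K"
    and ob: "\<And>x. x \<in> {0..pi} \<Longrightarrow> cmod (osc k x) \<le> b" "\<And>x. x \<in> {0..pi} \<Longrightarrow> cmod (osc (- k) x) \<le> b"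
    and U: "U2 / cmod k \<le> b" using o by (auto simp: osc_bound_def)
  have b0: "b \<ge> 0" using order_trans[OF norm_ge_zero ob(1)[OF x]] .
  have bK: "b \<le> K * b" using mult_right_mono[OF K b0] by simp
  have main: "cmod (e2 k x * (amp k x - 1)) + cmod (amp (- k) x - 1) \<le> Cb (K * K) * (K * b)"
  proof (rule amp_bound[OF k _ _ _ _ _ x])
    show "K * K \<ge> 1" using K mult_mono[of 1 K 1 K] by simp
    fix t x assume "0 \<le> t" "t \<le> x" "x \<le> pi"
    then show "cmod (e2 k x * e2 (- k) t) \<le> K * K"
      using eK(1)[of x] eK(2)[of t] K unfolding norm_mult by (intro mult_mono) auto
  next
    fix x assume x: "x \<in> {0..pi}"
    show "cmod (integral {0..x} (\<lambda>t. u t * e2 k t)) \<le> K * b" using ob(1)[OF x] bK by (simp add: osc_def)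
    show "cmod (e2 k x * integral {0..x} (\<lambda>t. u t * e2 (- k) t)) \<le> K * b"
      using eK(1)[OF x] ob(2)[OF x] K unfolding norm_mult osc_def by (intro mult_mono) auto
  qed (use U bK in linarith)
  let ?D = "Cb (K * K) * (K * b)"
  have D0: "?D \<ge> 0" using K b0 Cb_pos[of "K * K"] by (intro mult_nonneg_nonneg) auto
  have Z: "cmod (amp (- k) x - 1) \<le> ?D" and X: "cmod (e2 k x * (amp k x - 1)) \<le> ?D" using main norm_ge_zero by (smt (verit))+
  have "?D \<le> K * ?D" using mult_right_mono[OF K D0] by simp
  with Z show "cmod (amp (- k) x - 1) \<le> K * ?D" by linarith
  have "amp k x - 1 = e2 (- k) x * (e2 k x * (amp k x - 1))"
    unfolding mult.assoc[symmetric] e2_minus by simp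
  then have "cmod (amp k x - 1) = cmod (e2 (- k) x) * cmod (e2 k x * (amp k x - 1))" by (metis norm_mult)
  also have "\<dots> \<le> K * ?D" using eK(2)[OF x] X K by (intro mult_mono) auto
  finally show "cmod (amp k x - 1) \<le> K * ?D" .
qed

text \<open>Second order expansion: the first order part of \<open>amp (- k)\<close> is \<open>- osc k\<close>, and the remainder
  \<open>amp (- k) - 1 + osc k\<close> is integrated by parts against \<open>u e2 (- k)\<close>, which gains a factor \<open>b\<close>.\<close>
lemma amp_expansion:
  assumes K: "K \<ge> 1"
  shows "\<exists>C\<ge>0. \<forall>k b. osc_bound K k b \<longrightarrow>
    cmod (amp k pi - 1 + osc (- k) pi - integral {0..pi} (\<lambda>t. u t * (e2 (- k) t * osc k t)) + integral {0..pi} (\<lambda>t. af k t * (1 - e2 (- k) t))) \<le> C * b\<^sup>2"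
proof -
  define D where "D = K * (Cb (K * K) * K)"
  define D0 where "D0 = D * (U1 * K + U2)"
  \<comment> \<open>The four summands are the coefficients of \<open>b^2\<close> in the bounds
    \<open>n1\<close>, \<open>n2\<close>, \<open>n3\<close> and \<open>n4\<close> below.\<close>
  define C where "C = (D + 1) + U1 * (K * D) + (1 + D0) * (1 + K) / 2 + D * (1 + K) / 2"
  have Dp: "D \<ge> 0" using K Cb_pos[of "K*K"] by (auto simp: D_def)
  have D0p: "D0 \<ge> 0" using Dp K U_nonneg by (auto simp: D0_def)
  have Cp: "C \<ge> 0" using Dp D0p K U_nonneg by (auto simp: C_def)
  have main: "cmod (amp k pi - 1 + osc (- k) pi - integral {0..pi} (\<lambda>t. u t * (e2 (- k) t * osc k t)) + integral {0..pi} (\<lambda>t. af k t * (1 - e2 (- k) t))) \<le> C * b\<^sup>2"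
    if o: "osc_bound K k b" for k b
  proof -
    have k: "cmod k \<ge> 1" and eK: "\<And>t. t \<in> {0..pi} \<Longrightarrow> cmod (e2 k t) \<le> K" "\<And>t. t \<in> {0..pi} \<Longrightarrow> cmod (e2 (- k) t) \<le> K"
      and ob: "\<And>x. x \<in> {0..pi} \<Longrightarrow> cmod (osc k x) \<le> b" "\<And>x. x \<in> {0..pi} \<Longrightarrow> cmod (osc (- k) x) \<le> b"
      and U: "U2 / cmod k \<le> b" using o by (auto simp: osc_bound_def)
    have k0: "k \<noteq> 0" "- k \<noteq> 0" using k by auto
    have b0: "b \<ge> 0" using order_trans[OF norm_ge_zero ob(1)[of 0]] by simp
    define Y where "Y = (\<lambda>x. amp k x - 1)"
    define Z where "Z = (\<lambda>x. amp (- k) x - 1)"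
    define q where "q = (\<lambda>x. Z x + osc k x)"
    have cY: "continuous_on {0..pi} Y" and cZ: "continuous_on {0..pi} Z"
      unfolding Y_def Z_def by (intro continuous_intros amp_cont k0)+
    have cq: "continuous_on {0..pi} q" unfolding q_def by (intro continuous_intros cZ osc_cont)
    have YZ: "cmod (Y t) \<le> D * b" "cmod (Z t) \<le> D * b" if "t \<in> {0..pi}" for t
      using amp_bound_osc[OF o K that] by (auto simp: Y_def Z_def D_def mult_ac)
    \<comment> \<open>The same estimate with the trivial bound of the oscillatory integrals in place
      of \<open>b\<close> gives a bound \<open>D0\<close> independent of \<open>b\<close>. It is
      used where \<open>1 + Y\<close> and \<open>1 + Z\<close> multiply a product that is already of
      order \<open>b^2\<close>; the bound \<open>D * b\<close> would leave cubic terms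
      there.\<close>
    have "osc_bound K k (U1 * K + U2)"
      unfolding osc_bound_def
    proof (intro conjI ballI k eK)
      fix x assume "x \<in> {0..pi}"
      then show "cmod (osc k x) \<le> U1 * K + U2" "cmod (osc (- k) x) \<le> U1 * K + U2"
        using u_mult_bound[of "e2 k" K x] u_mult_bound[of "e2 (- k)" K x] eK U_nonneg e2_cont[of "{0..pi}"]
        by (auto simp: osc_def intro: order_trans)
    next
      have "U2 / cmod k \<le> U2 / 1" using k U_nonneg by (intro divide_left_mono) auto
      moreover have "0 \<le> U1 * K" using U_nonneg K by simp
      ultimately show "U2 / cmod k \<le> U1 * K + U2" by simp
    qed
    then have YZ0: "cmod (Y t) \<le> D0" "cmod (Z t) \<le> D0" if "t \<in> {0..pi}" for t
      using amp_bound_osc[OF _ K that, of k "U1 * K + U2"] by (auto simp: Y_def Z_def D_def D0_def mult_ac)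
    \<comment> \<open>Adding \<open>osc k\<close> cancels the leading term of the derivative of
      \<open>Z\<close>; every term left carries \<open>Y\<close> or the factor \<open>af k\<close>,
      hence has an integral of order \<open>b\<close>.\<close>
    have aq: "antideriv pi q (\<lambda>t. - (u t * e2 k t * Y t) + af k t * (1 + Z t - e2 k t * (1 + Y t)))"
    proof -
      have "antideriv pi (\<lambda>x. amp (- k) x + (- 1 + osc k x))
        (\<lambda>t. (- (u t * e2 (- (- k)) t * amp (- (- k)) t) - af (- k) t * (amp (- k) t - e2 (- (- k)) t * amp (- (- k)) t)) + (0 + u t * e2 k t))"
        by (intro antideriv_add antideriv_const osc_antideriv amp_antideriv k0)
      then show ?thesis
        by (rule antideriv_cong) (simp_all add: q_def Z_def Y_def af_minus algebra_simps)
    qed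
    have i_u: "(\<lambda>t. u t * g t) integrable_on {0..pi}" and i_a: "(\<lambda>t. af k t * g t) integrable_on {0..pi}"
      if "continuous_on {0..pi} g" for g
      using absint_int(1)[OF absint_mult_cont(1)[OF u_absint that], of 0 pi] absint_int(1)[OF absint_mult_cont(1)[OF af_absint that], of 0 pi] by auto
    have c1: "continuous_on {0..pi} (\<lambda>t. e2 (- k) t * q t)" and c2: "continuous_on {0..pi} (\<lambda>t. e2 (- k) t * osc k t)"
      and c3: "continuous_on {0..pi} (\<lambda>t. 1 - e2 (- k) t)" and c4: "continuous_on {0..pi} (\<lambda>t. Y t - e2 (- k) t * Z t)"
      and c5: "continuous_on {0..pi} (\<lambda>t. e2 k t * (Y t * osc (- k) t))"
      and c6: "continuous_on {0..pi} (\<lambda>t. (1 + Z t - e2 k t * (1 + Y t)) * osc (- k) t)"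
      by (intro continuous_intros cY cZ cq osc_cont e2_cont)+
    have "amp k pi - 1 = integral {0..pi} (\<lambda>t. - (u t * e2 (- k) t * amp (- k) t) - af k t * (amp k t - e2 (- k) t * amp (- k) t))"
      using antideriv_eq[OF amp_antideriv[OF k0(1)], of pi] by simp
    also have "\<dots> = integral {0..pi} (\<lambda>t. - (u t * e2 (- k) t) + u t * (e2 (- k) t * osc k t) - u t * (e2 (- k) t * q t)
        - af k t * (1 - e2 (- k) t) - af k t * (Y t - e2 (- k) t * Z t))"
      by (rule integral_cong) (simp add: Y_def Z_def q_def algebra_simps)
    also have "\<dots> = - osc (- k) pi + integral {0..pi} (\<lambda>t. u t * (e2 (- k) t * osc k t)) - integral {0..pi} (\<lambda>t. u t * (e2 (- k) t * q t))
        - integral {0..pi} (\<lambda>t. af k t * (1 - e2 (- k) t)) - integral {0..pi} (\<lambda>t. af k t * (Y t - e2 (- k) t * Z t))"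
    proof -
      note j = integrable_neg[OF i_u[OF e2_cont, of "- k"]] i_u[OF c2] i_u[OF c1] i_a[OF c3] i_a[OF c4]
      note j12 = integrable_add[OF j(1,2)]
      note j13 = integrable_diff[OF j12 j(3)]
      note j14 = integrable_diff[OF j13 j(4)]
      show ?thesis
        unfolding osc_def[of _ pi] by (simp only: integral_diff[OF j14 j(5)] integral_diff[OF j13 j(4)] integral_diff[OF j12 j(3)] integral_add[OF j(1,2)] integral_neg)
    qed
    finally have e: "amp k pi - 1 + osc (- k) pi - integral {0..pi} (\<lambda>t. u t * (e2 (- k) t * osc k t)) + integral {0..pi} (\<lambda>t. af k t * (1 - e2 (- k) t))
       = - integral {0..pi} (\<lambda>t. u t * (e2 (- k) t * q t)) - integral {0..pi} (\<lambda>t. af k t * (Y t - e2 (- k) t * Z t))" by simp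
    have q0: "q 0 = 0" by (simp add: q_def Z_def)
    have "osc (- k) pi * q pi = integral {0..pi} (\<lambda>t. u t * e2 (- k) t * q t + osc (- k) t * (- (u t * e2 k t * Y t) + af k t * (1 + Z t - e2 k t * (1 + Y t))))"
      using antideriv_eq[OF antideriv_mult[OF osc_antideriv[of "- k"] aq], of pi] q0 by simp
    also have "\<dots> = integral {0..pi} (\<lambda>t. u t * (e2 (- k) t * q t) - u t * (e2 k t * (Y t * osc (- k) t)) + af k t * ((1 + Z t - e2 k t * (1 + Y t)) * osc (- k) t))"
      by (rule integral_cong) (simp add: algebra_simps)
    also have "\<dots> = integral {0..pi} (\<lambda>t. u t * (e2 (- k) t * q t)) - integral {0..pi} (\<lambda>t. u t * (e2 k t * (Y t * osc (- k) t)))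
       + integral {0..pi} (\<lambda>t. af k t * ((1 + Z t - e2 k t * (1 + Y t)) * osc (- k) t))"
      by (simp only: integral_add[OF integrable_diff[OF i_u[OF c1] i_u[OF c5]] i_a[OF c6]] integral_diff[OF i_u[OF c1] i_u[OF c5]])
    finally have e': "- integral {0..pi} (\<lambda>t. u t * (e2 (- k) t * q t)) = - (osc (- k) pi * q pi) - integral {0..pi} (\<lambda>t. u t * (e2 k t * (Y t * osc (- k) t)))
       + integral {0..pi} (\<lambda>t. af k t * ((1 + Z t - e2 k t * (1 + Y t)) * osc (- k) t))" by simp
    have n1: "cmod (osc (- k) pi * q pi) \<le> b * (D * b + b)"
      unfolding norm_mult q_def using YZ(2)[of pi] ob(1)[of pi] ob(2)[of pi] b0
      by (intro mult_mono order_trans[OF norm_triangle_ineq] add_mono) auto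
    have n2: "cmod (integral {0..pi} (\<lambda>t. u t * (e2 k t * (Y t * osc (- k) t)))) \<le> U1 * (K * ((D * b) * b))"
      using eK YZ ob K Dp b0 by (intro u_mult_bound c5) (auto simp: norm_mult intro!: mult_mono)
    have n3: "cmod (integral {0..pi} (\<lambda>t. af k t * ((1 + Z t - e2 k t * (1 + Y t)) * osc (- k) t))) \<le> U2 / (2 * cmod k) * (((1 + D0) + K * (1 + D0)) * b)"
    proof (rule af_mult_bound[OF k0(1) c6])
      fix t assume t: "t \<in> {0..pi}"
      have "cmod (1 + Z t) \<le> 1 + D0" "cmod (1 + Y t) \<le> 1 + D0"
        using norm_triangle_ineq[of 1 "Z t"] norm_triangle_ineq[of 1 "Y t"] YZ0[OF t] by auto
      then have "cmod (1 + Z t - e2 k t * (1 + Y t)) \<le> (1 + D0) + K * (1 + D0)"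
        using eK(1)[OF t] K by (intro order_trans[OF norm_triangle_ineq4] add_mono) (auto simp: norm_mult intro!: mult_mono)
      then show "cmod ((1 + Z t - e2 k t * (1 + Y t)) * osc (- k) t) \<le> ((1 + D0) + K * (1 + D0)) * b"
        unfolding norm_mult using ob(2)[OF t] D0p K by (intro mult_mono) auto
    qed simp
    have n4: "cmod (integral {0..pi} (\<lambda>t. af k t * (Y t - e2 (- k) t * Z t))) \<le> U2 / (2 * cmod k) * (D * b + K * (D * b))"
    proof (rule af_mult_bound[OF k0(1) c4])
      fix t assume t: "t \<in> {0..pi}"
      show "cmod (Y t - e2 (- k) t * Z t) \<le> D * b + K * (D * b)"
        using eK(2)[OF t] K YZ[OF t] by (intro order_trans[OF norm_triangle_ineq4] add_mono) (auto simp: norm_mult intro!: mult_mono)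
    qed simp
    have U': "U2 / (2 * cmod k) \<le> b / 2" using U by (simp add: field_simps)
    have n3': "U2 / (2 * cmod k) * (((1 + D0) + K * (1 + D0)) * b) \<le> b / 2 * (((1 + D0) + K * (1 + D0)) * b)"
      using D0p K b0 by (intro mult_right_mono[OF U']) auto
    have n4': "U2 / (2 * cmod k) * (D * b + K * (D * b)) \<le> b / 2 * (D * b + K * (D * b))"
      using Dp K b0 by (intro mult_right_mono[OF U']) auto
    have tri: "cmod (- A - B + C - E) \<le> cmod A + cmod B + cmod C + cmod E" for A B C E :: complex
      using norm_triangle_ineq4[of "- A - B + C" E] norm_triangle_ineq[of "- A - B" C] norm_triangle_ineq4[of "- A" B] by simp
    have "cmod (- integral {0..pi} (\<lambda>t. u t * (e2 (- k) t * q t)) - integral {0..pi} (\<lambda>t. af k t * (Y t - e2 (- k) t * Z t)))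
       \<le> b * (D * b + b) + U1 * (K * ((D * b) * b)) + b / 2 * (((1 + D0) + K * (1 + D0)) * b) + b / 2 * (D * b + K * (D * b))"
      unfolding e' using n1 n2 n3 n4 n3' n4' by (intro order_trans[OF tri]) linarith
    also have "\<dots> = C * b\<^sup>2" by (simp add: C_def power2_eq_square field_simps)
    finally show ?thesis unfolding e .
  qed
  show ?thesis using Cp main by blast
qed

section \<open>Passage to the sine and cosine integrals that make up v and gamma\<close>

definition So :: "complex \<Rightarrow> real \<Rightarrow> complex" where
  "So k x = integral {0..x} (\<lambda>t. u t * sin (2 * k * of_real t))"

definition Co :: "complex \<Rightarrow> real \<Rightarrow> complex" where
  "Co k x = integral {0..x} (\<lambda>t. u t * cos (2 * k * of_real t))"

text \<open>\<open>v(\<pi>, k^2)\<close> as a function of \<open>k\<close>, with the double integral reduced to a single one.\<close>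

definition vk :: "complex \<Rightarrow> complex" where
  "vk k = So k pi + 1 / 2 * (1 / k) * integral {0..pi} (\<lambda>t. (u t)\<^sup>2)
    + 2 * integral {0..pi} (\<lambda>t. u t * (cos (2 * k * of_real t) * So k t))
    - 1 / 2 * (1 / k) * integral {0..pi} (\<lambda>t. (u t)\<^sup>2 * cos (2 * k * of_real t))"

lemma inner_integral:
  "integral {0..t} (\<lambda>s. u t * u s * cos (2 * k * of_real t) * sin (2 * k * of_real s)) = u t * (cos (2 * k * of_real t) * So k t)"
proof -
  have "integral {0..t} (\<lambda>s. u t * u s * cos (2 * k * of_real t) * sin (2 * k * of_real s))
    = integral {0..t} (\<lambda>s. (u t * cos (2 * k * of_real t)) * (u s * sin (2 * k * of_real s)))"
    by (simp add: mult_ac)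
  also have "\<dots> = (u t * cos (2 * k * of_real t)) * So k t"
    unfolding So_def by (rule Henstock_Kurzweil_Integration.integral_mult_right)
  finally show ?thesis by (simp add: mult_ac)
qed

lemma vfun_eq: "vfun u pi l = vk (csqrt l)"
  unfolding vfun_def vk_def inner_integral So_def[of _ pi] by simp

lemma trig_cont: "continuous_on S (\<lambda>t. sin (2 * k * of_real t :: complex))" "continuous_on S (\<lambda>t. cos (2 * k * of_real t :: complex))"
  by (intro continuous_intros)+

lemma So_antideriv: "antideriv pi (So k) (\<lambda>t. u t * sin (2 * k * of_real t))"
  using antideriv_indefinite[OF absint_mult_cont(1)[OF u_absint trig_cont(1)[of _ k]], of 0]
  by (simp add: So_def[abs_def])

lemma Co_antideriv: "antideriv pi (Co k) (\<lambda>t. u t * cos (2 * k * of_real t))"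
  using antideriv_indefinite[OF absint_mult_cont(1)[OF u_absint trig_cont(2)[of _ k]], of 0]
  by (simp add: Co_def[abs_def])

lemma So_cont: "continuous_on {0..pi} (So k)" and Co_cont: "continuous_on {0..pi} (Co k)"
  using antideriv_cont[OF So_antideriv] antideriv_cont[OF Co_antideriv] by auto

lemma e2_trig: "e2 k t = cos (2 * k * of_real t) + \<i> * sin (2 * k * of_real t)"
  "e2 (- k) t = cos (2 * k * of_real t) - \<i> * sin (2 * k * of_real t)"
  using exp_Euler[of "2 * k * of_real t"] exp_Euler[of "- (2 * k * of_real t)"] by (simp_all add: e2_def mult_ac)

lemma u_trig_integrable:
  assumes "x \<in> {0..pi}"
  shows "(\<lambda>t. u t * sin (2 * k * of_real t)) integrable_on {0..x}" "(\<lambda>t. u t * cos (2 * k * of_real t)) integrable_on {0..x}"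
  using assms absint_int(1)[OF antideriv_absint[OF So_antideriv], of 0 x] absint_int(1)[OF antideriv_absint[OF Co_antideriv], of 0 x] by auto

lemma osc_trig:
  assumes x: "x \<in> {0..pi}"
  shows "osc k x = Co k x + \<i> * So k x" "osc (- k) x = Co k x - \<i> * So k x"
proof -
  note i = u_trig_integrable[OF x, of k]
  have "osc k x = integral {0..x} (\<lambda>t. u t * cos (2 * k * of_real t) + \<i> * (u t * sin (2 * k * of_real t)))"
    unfolding osc_def e2_trig(1) by (simp add: algebra_simps)
  also have "\<dots> = Co k x + \<i> * So k x"
    unfolding Co_def So_def using integral_add[OF i(2) integrable_on_mult_right[OF i(1), of \<i>]] by simp
  finally show "osc k x = Co k x + \<i> * So k x" .
  have "osc (- k) x = integral {0..x} (\<lambda>t. u t * cos (2 * k * of_real t) - \<i> * (u t * sin (2 * k * of_real t)))"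
    unfolding osc_def e2_trig(2) by (simp add: algebra_simps)
  also have "\<dots> = Co k x - \<i> * So k x"
    unfolding Co_def So_def using integral_diff[OF i(2) integrable_on_mult_right[OF i(1), of \<i>]] by simp
  finally show "osc (- k) x = Co k x - \<i> * So k x" .
qed

text \<open>The expansion at \<open>k\<close> minus the one at \<open>- k\<close>. The second order
  terms leave 2i times the integral of u cos So minus that of u sin Co. The product rule turns the
  latter into \<open>So k pi * Co k pi\<close> minus the former: the product is
  \<open>O(b^2)\<close>, and the doubled integral is the one in \<open>vk\<close>. The
  \<open>af\<close> terms combine to the two \<open>u^2\<close> terms of \<open>vk\<close>.\<close>

lemma amp_difference:
  assumes K: "K \<ge> 1"
  shows "\<exists>C\<ge>0. \<forall>k b. osc_bound K k b \<longrightarrow> cmod (amp k pi - amp (- k) pi - 2 * \<i> * vk k) \<le> C * b\<^sup>2"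
proof -
  obtain C where C: "C \<ge> 0" and exp: "\<And>k b. osc_bound K k b \<Longrightarrow>
    cmod (amp k pi - 1 + osc (- k) pi - integral {0..pi} (\<lambda>t. u t * (e2 (- k) t * osc k t)) + integral {0..pi} (\<lambda>t. af k t * (1 - e2 (- k) t))) \<le> C * b\<^sup>2"
    using amp_expansion[OF K] by blast
  have main: "cmod (amp k pi - amp (- k) pi - 2 * \<i> * vk k) \<le> (2 * C + 2) * b\<^sup>2" if o: "osc_bound K k b" for k b
  proof -
    have k0: "k \<noteq> 0" using o by (auto simp: osc_bound_def)
    let ?s = "\<lambda>t. sin (2 * k * complex_of_real t)" and ?c = "\<lambda>t. cos (2 * k * complex_of_real t)"
    define J1 where "J1 = integral {0..pi} (\<lambda>t. u t * (e2 (- k) t * osc k t))"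
    define J2 where "J2 = integral {0..pi} (\<lambda>t. u t * (e2 k t * osc (- k) t))"
    define A1 where "A1 = integral {0..pi} (\<lambda>t. af k t * (1 - e2 (- k) t))"
    define A2 where "A2 = integral {0..pi} (\<lambda>t. af (- k) t * (1 - e2 k t))"
    have x1: "cmod (amp k pi - 1 + osc (- k) pi - J1 + A1) \<le> C * b\<^sup>2"
      using exp[OF o] by (simp add: J1_def A1_def)
    have x2: "cmod (amp (- k) pi - 1 + osc k pi - J2 + A2) \<le> C * b\<^sup>2"
      using exp[OF osc_bound_minus[OF o]] by (simp add: J2_def A2_def)
    have i_u: "(\<lambda>t. u t * g t) integrable_on {0..pi}" and i_a: "(\<lambda>t. af k' t * g t) integrable_on {0..pi}" and i_2: "(\<lambda>t. (u t)\<^sup>2 * g t) integrable_on {0..pi}"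
      if "continuous_on {0..pi} g" for g k'
      using absint_int(1)[OF absint_mult_cont(1)[OF u_absint that], of 0 pi] absint_int(1)[OF absint_mult_cont(1)[OF af_absint that], of 0 pi]
        absint_int(1)[OF absint_mult_cont(1)[OF u2_absint that], of 0 pi] by auto
    have "J1 - J2 = integral {0..pi} (\<lambda>t. u t * (e2 (- k) t * osc k t) - u t * (e2 k t * osc (- k) t))"
      unfolding J1_def J2_def by (intro integral_diff[symmetric] i_u continuous_intros e2_cont osc_cont)
    also have "\<dots> = integral {0..pi} (\<lambda>t. 2 * \<i> * (u t * (?c t * So k t) - u t * (?s t * Co k t)))"
    proof (rule integral_cong)
      fix t assume t: "t \<in> {0..pi}"
      show "u t * (e2 (- k) t * osc k t) - u t * (e2 k t * osc (- k) t) = 2 * \<i> * (u t * (?c t * So k t) - u t * (?s t * Co k t))"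
        unfolding osc_trig(1)[OF t, of k] osc_trig(2)[OF t, of k] e2_trig(1)[of k] e2_trig(2)[of k] by (simp add: algebra_simps)
    qed
    also have "\<dots> = 2 * \<i> * (integral {0..pi} (\<lambda>t. u t * (?c t * So k t)) - integral {0..pi} (\<lambda>t. u t * (?s t * Co k t)))"
      by (subst Henstock_Kurzweil_Integration.integral_mult_right, subst integral_diff[OF i_u i_u])
        (intro continuous_intros So_cont Co_cont | simp)+
    finally have J: "J1 - J2 = 2 * \<i> * (integral {0..pi} (\<lambda>t. u t * (?c t * So k t)) - integral {0..pi} (\<lambda>t. u t * (?s t * Co k t)))" .
    have "So k pi * Co k pi = integral {0..pi} (\<lambda>t. u t * ?s t * Co k t + So k t * (u t * ?c t))"
      using antideriv_eq[OF antideriv_mult[OF So_antideriv[of k] Co_antideriv[of k]], of pi] by (simp add: So_def[of k 0])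
    also have "\<dots> = integral {0..pi} (\<lambda>t. u t * (?s t * Co k t) + u t * (?c t * So k t))"
      by (simp add: mult_ac)
    also have "\<dots> = integral {0..pi} (\<lambda>t. u t * (?s t * Co k t)) + integral {0..pi} (\<lambda>t. u t * (?c t * So k t))"
      by (intro integral_add i_u continuous_intros So_cont Co_cont)
    finally have SC: "integral {0..pi} (\<lambda>t. u t * (?s t * Co k t)) = So k pi * Co k pi - integral {0..pi} (\<lambda>t. u t * (?c t * So k t))" by simp
    have "A1 - A2 = integral {0..pi} (\<lambda>t. af k t * (1 - e2 (- k) t) - af (- k) t * (1 - e2 k t))"
      unfolding A1_def A2_def by (intro integral_diff[symmetric] i_a continuous_intros e2_cont)
    also have "\<dots> = integral {0..pi} (\<lambda>t. (1 / (\<i> * k)) * ((u t)\<^sup>2 * 1 - (u t)\<^sup>2 * ?c t))"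
    proof (rule integral_cong)
      fix t
      have af2: "2 * af k t = (1 / (\<i> * k)) * (u t)\<^sup>2" by (simp add: af_def)
      have "af k t * (1 - e2 (- k) t) - af (- k) t * (1 - e2 k t) = (2 * af k t) * (1 - ?c t)"
        unfolding af_minus e2_trig by (simp add: algebra_simps)
      also have "\<dots> = (1 / (\<i> * k)) * ((u t)\<^sup>2 * 1 - (u t)\<^sup>2 * ?c t)" unfolding af2 by (simp only: right_diff_distrib mult.assoc)
      finally show "af k t * (1 - e2 (- k) t) - af (- k) t * (1 - e2 k t) = (1 / (\<i> * k)) * ((u t)\<^sup>2 * 1 - (u t)\<^sup>2 * ?c t)" .
    qed
    also have "\<dots> = (1 / (\<i> * k)) * (integral {0..pi} (\<lambda>t. (u t)\<^sup>2 * 1) - integral {0..pi} (\<lambda>t. (u t)\<^sup>2 * ?c t))"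
      by (subst Henstock_Kurzweil_Integration.integral_mult_right, subst integral_diff[OF i_2 i_2]) (intro continuous_intros | simp)+
    finally have A: "A1 - A2 = (1 / (\<i> * k)) * (integral {0..pi} (\<lambda>t. (u t)\<^sup>2) - integral {0..pi} (\<lambda>t. (u t)\<^sup>2 * ?c t))" by simp
    have ik: "1 / (\<i> * k) = - (\<i> / k)" by (simp add: divide_simps)
    have o1: "osc k pi = Co k pi + \<i> * So k pi" "osc (- k) pi = Co k pi - \<i> * So k pi" using osc_trig[of pi k] by auto
    have "(amp k pi - 1 + osc (- k) pi - J1 + A1) - (amp (- k) pi - 1 + osc k pi - J2 + A2)
       = amp k pi - amp (- k) pi + (osc (- k) pi - osc k pi) - (J1 - J2) + (A1 - A2)" by simp
    also have "\<dots> = amp k pi - amp (- k) pi - 2 * \<i> * vk k + 2 * \<i> * (So k pi * Co k pi)"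
      unfolding o1 J SC A ik vk_def by (simp add: algebra_simps)
    finally have e: "amp k pi - amp (- k) pi - 2 * \<i> * vk k =
       ((amp k pi - 1 + osc (- k) pi - J1 + A1) - (amp (- k) pi - 1 + osc k pi - J2 + A2)) - 2 * \<i> * (So k pi * Co k pi)"
      by (simp only: add_diff_cancel_right')
    have ob: "cmod (osc k pi) \<le> b" "cmod (osc (- k) pi) \<le> b" using o by (auto simp: osc_bound_def)
    have "Co k pi = (osc k pi + osc (- k) pi) / 2" "\<i> * So k pi = (osc k pi - osc (- k) pi) / 2"
      unfolding o1 by (auto simp: field_simps)
    then have "cmod (Co k pi) = cmod (osc k pi + osc (- k) pi) / 2" "cmod (So k pi) = cmod (osc k pi - osc (- k) pi) / 2"
      by (metis norm_divide norm_numeral, metis norm_divide norm_numeral norm_mult norm_ii mult_1)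
    then have "cmod (Co k pi) \<le> b" "cmod (So k pi) \<le> b"
      using ob norm_triangle_ineq[of "osc k pi" "osc (- k) pi"] norm_triangle_ineq4[of "osc k pi" "osc (- k) pi"] by auto
    then have "cmod (So k pi * Co k pi) \<le> b * b"
      unfolding norm_mult using order_trans[OF norm_ge_zero ob(1)] by (intro mult_mono) auto
    then have "cmod (2 * \<i> * (So k pi * Co k pi)) \<le> 2 * b\<^sup>2" by (simp add: norm_mult power2_eq_square)
    then show ?thesis unfolding e
      using norm_triangle_ineq4[of "(amp k pi - 1 + osc (- k) pi - J1 + A1) - (amp (- k) pi - 1 + osc k pi - J2 + A2)" "2 * \<i> * (So k pi * Co k pi)"]
        norm_triangle_ineq4[of "amp k pi - 1 + osc (- k) pi - J1 + A1" "amp (- k) pi - 1 + osc k pi - J2 + A2"] x1 x2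
      by (simp add: distrib_right)
  qed
  show ?thesis using C main by (intro exI[of _ "2 * C + 2"]) auto
qed

lemma gammafun_bounds:
  assumes l: "l \<noteq> 0"
  shows "\<And>x. x \<in> {0..pi} \<Longrightarrow> cmod (So (csqrt l) x) + cmod (Co (csqrt l) x) \<le> gammafun u l"
    "U2 / cmod (csqrt l) \<le> gammafun u l"
proof -
  let ?k = "csqrt l"
  let ?F = "\<lambda>x. cmod (So ?k x) + cmod (Co ?k x)
      + 2 * cmod (integral {0..x} (\<lambda>t. u t * (cos (2 * ?k * of_real t) * So ?k t)))
      + 1 / 2 * cmod ((1 / ?k) * integral {0..x} (\<lambda>t. (u t)\<^sup>2 * cos (2 * ?k * of_real t)))"
  have g: "gammafun u l = (SUP x\<in>{0..pi}. ?F x) + U2 / cmod ?k"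
    unfolding gammafun_def inner_integral So_def[of _ x for x, symmetric] U2_def
    by (simp add: So_def[symmetric] Co_def[symmetric] norm_csqrt)
  have c1: "continuous_on {0..pi} (\<lambda>x. integral {0..x} (\<lambda>t. u t * (cos (2 * ?k * of_real t) * So ?k t)))"
    by (intro indefinite_integral_continuous_1 absint_int(1)[OF absint_mult_cont(1)[OF u_absint]] continuous_intros So_cont) auto
  have c2: "continuous_on {0..pi} (\<lambda>x. integral {0..x} (\<lambda>t. (u t)\<^sup>2 * cos (2 * ?k * of_real t)))"
    by (intro indefinite_integral_continuous_1 absint_int(1)[OF absint_mult_cont(1)[OF u2_absint]] continuous_intros) auto
  \<comment> \<open>A real \<open>SUP\<close> is known to dominate its values only if these are
    bounded above; continuity on a compact interval provides that.\<close>
  have "continuous_on {0..pi} ?F" by (intro continuous_intros c1 c2 So_cont Co_cont)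
  then have "bounded (?F ` {0..pi})" using compact_continuous_image compact_imp_bounded by blast
  then have bdd: "bdd_above (?F ` {0..pi})" by (rule bounded_imp_bdd_above)
  have up: "?F x \<le> (SUP x\<in>{0..pi}. ?F x)" if "x \<in> {0..pi}" for x
    by (rule cSUP_upper[OF that bdd])
  have U: "U2 / cmod ?k \<ge> 0" using U_nonneg by simp
  show "cmod (So ?k x) + cmod (Co ?k x) \<le> gammafun u l" if "x \<in> {0..pi}" for x
    unfolding g using up[OF that] U norm_ge_zero[of "integral {0..x} (\<lambda>t. u t * (cos (2 * ?k * of_real t) * So ?k t))"]
      norm_ge_zero[of "(1 / ?k) * integral {0..x} (\<lambda>t. (u t)\<^sup>2 * cos (2 * ?k * of_real t))"] by linarith
  have "0 \<le> ?F 0" by simp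
  also have "\<dots> \<le> (SUP x\<in>{0..pi}. ?F x)" by (rule up) simp
  finally show "U2 / cmod ?k \<le> gammafun u l" unfolding g by simp
qed

end

section \<open>Dependence of \<open>v\<close> on the spectral parameter\<close>

text \<open>The bound sees \<open>h\<close> only through the supremum \<open>B\<close> of its
  primitive, not through its L1 norm. With \<open>h\<close> an oscillating multiple of
  \<open>u\<close>, this is how gamma enters as a factor; \<open>D\<close> will be of the size of
  the change in the spectral parameter.\<close>

lemma integral_by_parts_bound:
  fixes H G :: "real \<Rightarrow> complex"
  assumes H: "antideriv b H h" "H 0 = 0" "\<And>t. t \<in> {0..b} \<Longrightarrow> cmod (H t) \<le> B"
    and G: "antideriv b G g" "continuous_on {0..b} g" "G 0 = 0" "\<And>t. t \<in> {0..b} \<Longrightarrow> cmod (g t) \<le> D"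
    and x: "x \<in> {0..b}"
  shows "cmod (integral {0..x} (\<lambda>t. h t * G t)) \<le> 2 * b * D * B" "cmod (G x) \<le> b * D"
proof -
  have B: "B \<ge> 0" using order_trans[OF norm_ge_zero H(3)[OF x]] .
  have D: "D \<ge> 0" using order_trans[OF norm_ge_zero G(4)[OF x]] .
  have Gx: "cmod (G y) \<le> y * D" if y: "y \<in> {0..b}" for y
  proof -
    have "G y = integral {0..y} g" using antideriv_eq[OF G(1) y] G(3) by simp
    also have "cmod \<dots> \<le> D * (y - 0)" using y G(4) by (intro integral_bound continuous_on_subset[OF G(2)]) auto
    finally show ?thesis by (simp add: mult.commute)
  qed
  show "cmod (G x) \<le> b * D" using Gx[OF x] x D mult_right_mono[of x b D] by auto
  have hi: "h absolutely_integrable_on {0..b}" by (rule antideriv_absint[OF H(1)])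
  have cH: "continuous_on {0..b} H" by (rule antideriv_cont[OF H(1)])
  have cG: "continuous_on {0..b} G" by (rule antideriv_cont[OF G(1)])
  have i1: "(\<lambda>t. h t * G t) integrable_on {0..x}" using absint_int(1)[OF absint_mult_cont(1)[OF hi cG], of 0 x] x by auto
  have c2: "continuous_on {0..x} (\<lambda>t. H t * g t)" using x by (intro continuous_intros continuous_on_subset[OF cH] continuous_on_subset[OF G(2)]) auto
  have "H x * G x = integral {0..x} (\<lambda>t. h t * G t + H t * g t)"
    using antideriv_eq[OF antideriv_mult[OF H(1) G(1)] x] H(2) by simp
  also have "\<dots> = integral {0..x} (\<lambda>t. h t * G t) + integral {0..x} (\<lambda>t. H t * g t)"
    by (intro integral_add i1 integrable_continuous_real c2)
  finally have "integral {0..x} (\<lambda>t. h t * G t) = H x * G x - integral {0..x} (\<lambda>t. H t * g t)" by simp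
  moreover have "cmod (H x * G x) \<le> B * (x * D)"
    unfolding norm_mult using B by (intro mult_mono H(3) Gx x) auto
  moreover have "cmod (integral {0..x} (\<lambda>t. H t * g t)) \<le> (B * D) * (x - 0)"
    using x B by (intro integral_bound c2) (auto simp: norm_mult intro!: mult_mono H(3) G(4))
  ultimately have "cmod (integral {0..x} (\<lambda>t. h t * G t)) \<le> 2 * x * D * B"
    using norm_triangle_ineq4[of "H x * G x" "integral {0..x} (\<lambda>t. H t * g t)"] by (simp add: mult_ac)
  also have "\<dots> \<le> 2 * b * D * B" using x B D by (intro mult_right_mono) auto
  finally show "cmod (integral {0..x} (\<lambda>t. h t * G t)) \<le> 2 * b * D * B" .
qed

lemma cmod_sin_cos_le: "cmod (sin z) \<le> exp (cmod z)" "cmod (cos z) \<le> exp (cmod z)"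
proof -
  have e: "cmod (exp (\<i> * z)) \<le> exp (cmod z)" "cmod (exp (- (\<i> * z))) \<le> exp (cmod z)"
    using norm_exp[of "\<i> * z"] norm_exp[of "- (\<i> * z)"] by (auto simp: norm_mult)
  have "cmod (sin z) = cmod (exp (\<i> * z) - exp (- (\<i> * z))) / 2"
    unfolding sin_exp_eq by (simp add: norm_divide norm_mult)
  then show "cmod (sin z) \<le> exp (cmod z)" using e norm_triangle_ineq4[of "exp (\<i> * z)" "exp (- (\<i> * z))"] by linarith
  have "cmod (cos z) = cmod (exp (\<i> * z) + exp (- (\<i> * z))) / 2"
    unfolding cos_exp_eq by (simp add: norm_divide norm_mult)
  then show "cmod (cos z) \<le> exp (cmod z)" using e norm_triangle_ineq[of "exp (\<i> * z)" "exp (- (\<i> * z))"] by linarith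
qed

text \<open>The shift by 1 makes the second function vanish at 0, as
  \<open>integral_by_parts_bound\<close> asks of \<open>G\<close>.\<close>

lemma trig_deriv:
  "((\<lambda>t. sin (2 * d * of_real t)) has_vector_derivative 2 * d * cos (2 * d * of_real t)) (at t)"
  "((\<lambda>t. cos (2 * d * of_real t) - 1) has_vector_derivative - (2 * d * sin (2 * d * of_real t))) (at t)" for d :: complex
proof -
  have "((\<lambda>z. sin (2 * d * z)) has_field_derivative 2 * d * cos (2 * d * of_real t)) (at (of_real t))"
    by (auto intro!: derivative_eq_intros)
  from has_vector_derivative_real_field[OF this]
  show "((\<lambda>t. sin (2 * d * of_real t)) has_vector_derivative 2 * d * cos (2 * d * of_real t)) (at t)" .
  have "((\<lambda>z. cos (2 * d * z) - 1) has_field_derivative - (2 * d * sin (2 * d * of_real t))) (at (of_real t))"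
    by (auto intro!: derivative_eq_intros)
  from has_vector_derivative_real_field[OF this]
  show "((\<lambda>t. cos (2 * d * of_real t) - 1) has_vector_derivative - (2 * d * sin (2 * d * of_real t))) (at t)" .
qed

lemma antideriv_trig:
  "antideriv b (\<lambda>t. sin (2 * d * of_real t)) (\<lambda>t. 2 * d * cos (2 * d * of_real t))"
  "antideriv b (\<lambda>t. cos (2 * d * of_real t) - 1) (\<lambda>t. - (2 * d * sin (2 * d * of_real t)))" for d :: complex
  by (rule antideriv_FTC[OF trig_deriv(1)], intro continuous_intros)
    (rule antideriv_FTC[OF trig_deriv(2)], intro continuous_intros)

lemma trig_deriv_bound:
  assumes d: "cmod d \<le> 1" and t: "t \<in> {0..pi}"
  shows "cmod (2 * d * cos (2 * d * of_real t)) \<le> 2 * cmod d * exp (2 * pi)"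
    "cmod (- (2 * d * sin (2 * d * of_real t))) \<le> 2 * cmod d * exp (2 * pi)"
proof -
  have "cmod (2 * d * of_real t) \<le> 2 * pi"
    using d t mult_mono[of "cmod d" 1 t pi] by (simp add: norm_mult)
  then have "cmod (cos (2 * d * of_real t)) \<le> exp (2 * pi)" "cmod (sin (2 * d * of_real t)) \<le> exp (2 * pi)"
    by (meson cmod_sin_cos_le exp_le_cancel_iff order_trans)+
  then show "cmod (2 * d * cos (2 * d * of_real t)) \<le> 2 * cmod d * exp (2 * pi)"
    "cmod (- (2 * d * sin (2 * d * of_real t))) \<le> 2 * cmod d * exp (2 * pi)"
    by (auto simp: norm_mult intro!: mult_left_mono)
qed

context L2_potential
begin

text \<open>With \<open>d\<close> the difference \<open>\<kappa> - k\<close>, the addition theorems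
  split the trigonometric factors at \<open>\<kappa>\<close> into those at \<open>k\<close> and
  factors whose derivatives are \<open>O(|d|)\<close>. Integration by parts then yields
  \<open>|d|\<close> times the bound \<open>b\<close>, which is assumed only at the complex point
  \<open>k\<close>, where gamma is evaluated. The terms containing \<open>1 / k\<close> get their
  factor \<open>b\<close> from \<open>U2 / cmod k <= b\<close>.\<close>

lemma vk_variation:
  assumes K: "K \<ge> 1"
  shows "\<exists>C\<ge>0. \<forall>k (\<kappa>::real) b. cmod k \<ge> 1 \<longrightarrow> \<kappa> \<ge> 1 \<longrightarrow> cmod (of_real \<kappa> - k) \<le> 1 \<longrightarrow>
     (\<forall>t\<in>{0..pi}. cmod (sin (2 * k * of_real t)) \<le> K \<and> cmod (cos (2 * k * of_real t)) \<le> K) \<longrightarrow>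
     (\<forall>x\<in>{0..pi}. cmod (So k x) \<le> b \<and> cmod (Co k x) \<le> b) \<longrightarrow> U2 / cmod k \<le> b \<longrightarrow>
     cmod (vk (of_real \<kappa>) - vk k) \<le> C * cmod (of_real \<kappa> - k) * b"
proof -
  define M where "M = 2 * exp (2 * pi)"
  define C1 where "C1 = 4 * pi * M"
  define C2 where "C2 = 2 * K * (pi * M)"
  \<comment> \<open>In order: the change of \<open>So\<close>, the term with the plain integral of
    \<open>u^2\<close>, the double integral (change of \<open>So\<close>, then of the cosine), and
    the last term (change of \<open>1 / k\<close>, then of the cosine).\<close>
  define C where "C = C1 + 1 / 2 + 2 * (U1 * C1) + 2 * (U1 * C2) + 1 / 2 + C2 / 2"
  have M0: "M \<ge> 0" by (simp add: M_def)
  have C12: "C1 \<ge> 0" "C2 \<ge> 0" using M0 K by (auto simp: C1_def C2_def)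
  have C0: "C \<ge> 0" using C12 U_nonneg by (auto simp: C_def)
  have main: "cmod (vk (of_real \<kappa>) - vk k) \<le> C * cmod (of_real \<kappa> - k) * b"
    if k: "cmod k \<ge> 1" and \<kappa>: "\<kappa> \<ge> 1" and d1: "cmod (of_real \<kappa> - k) \<le> 1"
     and tK: "\<And>t. t \<in> {0..pi} \<Longrightarrow> cmod (sin (2 * k * of_real t)) \<le> K" "\<And>t. t \<in> {0..pi} \<Longrightarrow> cmod (cos (2 * k * of_real t)) \<le> K"
     and ob: "\<And>x. x \<in> {0..pi} \<Longrightarrow> cmod (So k x) \<le> b" "\<And>x. x \<in> {0..pi} \<Longrightarrow> cmod (Co k x) \<le> b"
     and U: "U2 / cmod k \<le> b" for k and \<kappa> :: real and b
  proof -
    define q :: complex where "q = of_real \<kappa>"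
    define d where "d = q - k"
    have d1: "cmod d \<le> 1" using d1 by (simp add: d_def q_def)
    have b0: "b \<ge> 0" using order_trans[OF norm_ge_zero ob(1)[of 0]] by simp
    have k0: "k \<noteq> 0" and q0: "q \<noteq> 0" using k \<kappa> by (auto simp: q_def)
    let ?m = "cmod d * M"
    have g: "cmod (2 * d * cos (2 * d * of_real t)) \<le> ?m" "cmod (- (2 * d * sin (2 * d * of_real t))) \<le> ?m" if "t \<in> {0..pi}" for t
      using trig_deriv_bound[OF d1 that] by (auto simp: M_def mult_ac)
    \<comment> \<open>The second conclusion of \<open>integral_by_parts_bound\<close> concerns
      \<open>G\<close> alone, so the zero function may stand for \<open>H\<close>.\<close>
    have gs: "cmod (sin (2 * d * of_real t)) \<le> pi * ?m" "cmod (cos (2 * d * of_real t) - 1) \<le> pi * ?m" if "t \<in> {0..pi}" for t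
    proof -
      have "continuous_on {0..pi} (\<lambda>t. 2 * d * cos (2 * d * complex_of_real t))" "continuous_on {0..pi} (\<lambda>t. - (2 * d * sin (2 * d * complex_of_real t)))"
        by (intro continuous_intros)+
      then show "cmod (sin (2 * d * of_real t)) \<le> pi * ?m" "cmod (cos (2 * d * of_real t) - 1) \<le> pi * ?m"
      using integral_by_parts_bound(2)[OF antideriv_const[of pi 0] _ _ antideriv_trig(1)[of pi d] _ _ g(1) that, of 0]
        integral_by_parts_bound(2)[OF antideriv_const[of pi 0] _ _ antideriv_trig(2)[of pi d] _ _ g(2) that, of 0]
        by auto
    qed
    have qt: "2 * q * of_real t = 2 * k * of_real t + 2 * d * of_real t" for t
      by (simp add: d_def algebra_simps)
    have i_u: "(\<lambda>t. u t * g t) integrable_on {0..x}" and i_2: "(\<lambda>t. (u t)\<^sup>2 * g t) integrable_on {0..x}"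
      if "continuous_on {0..pi} g" "x \<in> {0..pi}" for g x
      using absint_int(1)[OF absint_mult_cont(1)[OF u_absint that(1)], of 0 x] 
        absint_int(1)[OF absint_mult_cont(1)[OF u2_absint that(1)], of 0 x] that(2) by auto
    have S: "cmod (So q x - So k x) \<le> C1 * cmod d * b" if x: "x \<in> {0..pi}" for x
    proof -
      let ?h1 = "\<lambda>t. u t * sin (2 * k * of_real t)" and ?h2 = "\<lambda>t. u t * cos (2 * k * of_real t)"
      have "So q x - So k x = integral {0..x} (\<lambda>t. u t * sin (2 * q * of_real t) - u t * sin (2 * k * of_real t))"
        unfolding So_def by (intro integral_diff[symmetric] u_trig_integrable x)
      also have "\<dots> = integral {0..x} (\<lambda>t. ?h1 t * (cos (2 * d * of_real t) - 1) + ?h2 t * sin (2 * d * of_real t))"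
        unfolding qt sin_add by (simp add: algebra_simps)
      also have "\<dots> = integral {0..x} (\<lambda>t. ?h1 t * (cos (2 * d * of_real t) - 1)) + integral {0..x} (\<lambda>t. ?h2 t * sin (2 * d * of_real t))"
        unfolding mult.assoc by (intro integral_add i_u[OF _ x] continuous_intros)
      finally have "cmod (So q x - So k x) \<le> cmod (integral {0..x} (\<lambda>t. ?h1 t * (cos (2 * d * of_real t) - 1))) + cmod (integral {0..x} (\<lambda>t. ?h2 t * sin (2 * d * of_real t)))"
        by (simp add: norm_triangle_ineq)
      also have "cmod (integral {0..x} (\<lambda>t. ?h1 t * (cos (2 * d * of_real t) - 1))) \<le> 2 * pi * ?m * b"
        by (rule integral_by_parts_bound(1)[OF So_antideriv _ ob(1) antideriv_trig(2) _ _ g(2) x])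
          (auto simp: So_def intro!: continuous_intros)
      also have "cmod (integral {0..x} (\<lambda>t. ?h2 t * sin (2 * d * of_real t))) \<le> 2 * pi * ?m * b"
        by (rule integral_by_parts_bound(1)[OF Co_antideriv _ ob(2) antideriv_trig(1) _ _ g(1) x])
          (auto simp: Co_def intro!: continuous_intros)
      finally show ?thesis by (simp add: C1_def mult_ac)
    qed
    have c: "cmod (cos (2 * q * of_real t) - cos (2 * k * of_real t)) \<le> C2 * cmod d" if t: "t \<in> {0..pi}" for t
    proof -
      have "cos (2 * q * of_real t) - cos (2 * k * of_real t) = cos (2 * k * of_real t) * (cos (2 * d * of_real t) - 1) - sin (2 * k * of_real t) * sin (2 * d * of_real t)"
        unfolding qt cos_add by (simp add: algebra_simps)
      also have "cmod \<dots> \<le> cmod (cos (2 * k * of_real t)) * cmod (cos (2 * d * of_real t) - 1) + cmod (sin (2 * k * of_real t)) * cmod (sin (2 * d * of_real t))"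
        by (metis norm_mult norm_triangle_ineq4)
      also have "\<dots> \<le> K * (pi * ?m) + K * (pi * ?m)"
        using K tK[OF t] gs[OF t] by (intro add_mono mult_mono) auto
      finally show ?thesis by (simp add: C2_def mult_ac)
    qed
    have c1: "cmod (cos (2 * q * of_real t)) \<le> 1" for t
    proof -
      have "2 * q * of_real t = of_real (2 * \<kappa> * t)" by (simp add: q_def)
      then show ?thesis by (simp add: cos_of_real del: of_real_mult)
    qed
    have r: "cmod (1 / q - 1 / k) \<le> cmod d / cmod k"
    proof -
      have "1 / q - 1 / k = - d / (q * k)" using k0 q0 by (simp add: d_def field_simps)
      then have "cmod (1 / q - 1 / k) = cmod d / cmod k / \<kappa>" using \<kappa> by (simp add: norm_divide norm_mult q_def)
      also have "\<dots> \<le> cmod d / cmod k / 1" using \<kappa> by (intro divide_left_mono) auto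
      finally show ?thesis by simp
    qed
    have pi0: "pi \<in> {0..pi}" by simp
    \<comment> \<open>At \<open>k = - \<i> / 2\<close> the denominator \<open>2 * \<i> * k\<close>
      of \<open>af k\<close> is 1, so \<open>af_mult_bound\<close> becomes a bound for integrals
      against \<open>u^2\<close>.\<close>
    have u2b: "cmod (integral {0..pi} (\<lambda>t. (u t)\<^sup>2 * g t)) \<le> U2 * B"
      if "continuous_on {0..pi} g" "\<And>t. t \<in> {0..pi} \<Longrightarrow> cmod (g t) \<le> B" for g B
      using af_mult_bound[of "- \<i> / 2", OF _ that pi0] by (simp add: af_def norm_divide)
    have dU: "cmod d / cmod k * U2 \<le> cmod d * b" using mult_left_mono[OF U, of "cmod d"] by simp
    let ?cq = "\<lambda>t. cos (2 * q * complex_of_real t)" and ?ck = "\<lambda>t. cos (2 * k * complex_of_real t)"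
    define I where "I = integral {0..pi} (\<lambda>t. (u t)\<^sup>2)"
    define T2 where "T2 = 1 / 2 * (1 / q - 1 / k) * I"
    have n2: "cmod T2 \<le> 1 / 2 * (cmod d * b)"
    proof -
      have "cmod I \<le> U2" using u2b[of "\<lambda>t. 1" 1] by (simp add: I_def)
      then have "cmod (1 / q - 1 / k) * cmod I \<le> cmod d / cmod k * U2" using r by (intro mult_mono) auto
      then show ?thesis using dU by (simp add: T2_def norm_mult)
    qed
    define T3 where "T3 = integral {0..pi} (\<lambda>t. u t * (?cq t * So q t)) - integral {0..pi} (\<lambda>t. u t * (?ck t * So k t))"
    have n3: "cmod T3 \<le> U1 * (C1 * cmod d * b) + U1 * (C2 * cmod d * b)"
    proof -
      have "T3 = integral {0..pi} (\<lambda>t. u t * (?cq t * So q t) - u t * (?ck t * So k t))"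
        unfolding T3_def by (intro integral_diff[symmetric] i_u[OF _ pi0] continuous_intros So_cont)
      also have "\<dots> = integral {0..pi} (\<lambda>t. u t * (?cq t * (So q t - So k t)) + u t * ((?cq t - ?ck t) * So k t))"
        by (simp add: algebra_simps)
      also have "\<dots> = integral {0..pi} (\<lambda>t. u t * (?cq t * (So q t - So k t))) + integral {0..pi} (\<lambda>t. u t * ((?cq t - ?ck t) * So k t))"
        by (intro integral_add i_u[OF _ pi0] continuous_intros So_cont)
      finally have "cmod T3 \<le> cmod (integral {0..pi} (\<lambda>t. u t * (?cq t * (So q t - So k t)))) + cmod (integral {0..pi} (\<lambda>t. u t * ((?cq t - ?ck t) * So k t)))"
        by (simp add: norm_triangle_ineq)
      also have "\<dots> \<le> U1 * (C1 * cmod d * b) + U1 * (C2 * cmod d * b)"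
      proof (intro add_mono u_mult_bound pi0 continuous_intros So_cont)
        fix t assume t: "t \<in> {0..pi}"
        show "cmod (?cq t * (So q t - So k t)) \<le> C1 * cmod d * b"
          using mult_mono[OF c1[of t] S[OF t]] by (simp add: norm_mult)
        show "cmod ((?cq t - ?ck t) * So k t) \<le> C2 * cmod d * b"
          unfolding norm_mult using c[OF t] ob(1)[OF t] C12 by (intro mult_mono) auto
      qed
      finally show ?thesis .
    qed
    define T4 where "T4 = 1 / 2 * (1 / q) * integral {0..pi} (\<lambda>t. (u t)\<^sup>2 * ?cq t) - 1 / 2 * (1 / k) * integral {0..pi} (\<lambda>t. (u t)\<^sup>2 * ?ck t)"
    have n4: "cmod T4 \<le> 1 / 2 * (cmod d * b) + 1 / 2 * (C2 * (cmod d * b))"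
    proof -
      have df: "integral {0..pi} (\<lambda>t. (u t)\<^sup>2 * ?cq t) - integral {0..pi} (\<lambda>t. (u t)\<^sup>2 * ?ck t) = integral {0..pi} (\<lambda>t. (u t)\<^sup>2 * (?cq t - ?ck t))"
        unfolding right_diff_distrib by (intro integral_diff[symmetric] i_2[OF _ pi0] continuous_intros)
      define V1 where "V1 = integral {0..pi} (\<lambda>t. (u t)\<^sup>2 * ?cq t)"
      define V2 where "V2 = integral {0..pi} (\<lambda>t. (u t)\<^sup>2 * (?cq t - ?ck t))"
      have "T4 = 1 / 2 * ((1 / q - 1 / k) * V1) + 1 / 2 * ((1 / k) * V2)"
        unfolding T4_def V1_def V2_def df[symmetric] by (simp add: algebra_simps)
      then have "cmod T4 \<le> cmod (1 / 2 * ((1 / q - 1 / k) * V1)) + cmod (1 / 2 * ((1 / k) * V2))"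
        using norm_triangle_ineq by metis
      also have "\<dots> = 1 / 2 * (cmod (1 / q - 1 / k) * cmod V1) + 1 / 2 * (1 / cmod k * cmod V2)"
        by (simp add: norm_mult norm_divide)
      also have "\<dots> \<le> 1 / 2 * (cmod d / cmod k * (U2 * 1)) + 1 / 2 * (1 / cmod k * (U2 * (C2 * cmod d)))"
        unfolding V1_def V2_def by (intro add_mono mult_left_mono mult_mono r u2b c1 c continuous_intros) auto
      also have "1 / cmod k * (U2 * (C2 * cmod d)) = C2 * (cmod d / cmod k * U2)" by simp
      also have "1 / 2 * (cmod d / cmod k * (U2 * 1)) + 1 / 2 * (C2 * (cmod d / cmod k * U2)) \<le> 1 / 2 * (cmod d * b) + 1 / 2 * (C2 * (cmod d * b))"
        using dU C12 by (intro add_mono mult_left_mono) auto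
      finally show ?thesis .
    qed
    have "vk q - vk k = (So q pi - So k pi) + T2 + 2 * T3 - T4"
      unfolding vk_def T2_def T3_def T4_def I_def by (simp add: algebra_simps)
    then have "cmod (vk q - vk k) \<le> cmod (So q pi - So k pi) + cmod T2 + cmod (2 * T3) + cmod T4"
      using norm_triangle_ineq4[of "(So q pi - So k pi) + T2 + 2 * T3" T4] norm_triangle_ineq[of "(So q pi - So k pi) + T2" "2 * T3"]
        norm_triangle_ineq[of "So q pi - So k pi" T2] by simp
    also have "\<dots> \<le> C1 * cmod d * b + 1 / 2 * (cmod d * b) + 2 * (U1 * (C1 * cmod d * b) + U1 * (C2 * cmod d * b)) + (1 / 2 * (cmod d * b) + 1 / 2 * (C2 * (cmod d * b)))"
      using n3 by (intro add_mono S[OF pi0] n2 n4) (simp add: norm_mult)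
    also have "\<dots> = C * cmod d * b" by (simp add: C_def algebra_simps)
    finally show ?thesis by (simp add: q_def d_def)
  qed
  show ?thesis using C0 main by blast
qed

end

section \<open>Counting and enumerating the eigenvalues\<close>

text \<open>Rouche's theorem is applied in the larger disc of radius \<open>r + 1\<close>, where its
  sums carry winding numbers. The strict inequality excludes zeros on the circle; zeros outside have
  winding number 0, those inside 1. It also gives both functions a nonzero value, whence the
  finiteness of their zero sets in compact discs.\<close>

lemma rouche_circle:
  fixes f g :: "complex \<Rightarrow> complex"
  assumes f: "f holomorphic_on UNIV" and g: "g holomorphic_on UNIV" and r: "r > 0"
    and less: "\<And>z. cmod z = r \<Longrightarrow> cmod (g z - f z) < cmod (f z)"
  shows "finite {z\<in>ball 0 r. f z = 0}" "finite {z\<in>ball 0 r. g z = 0}"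
    "(\<Sum>z | z \<in> ball 0 r \<and> g z = 0. zorder g z) = (\<Sum>z | z \<in> ball 0 r \<and> f z = 0. zorder f z)"
proof -
  let ?R = "r + 1"
  have fin: "finite {z\<in>cball 0 ?R. h z = 0}" if h: "h holomorphic_on UNIV" "h (of_real r) \<noteq> 0" for h :: "complex \<Rightarrow> complex"
  proof (cases "h constant_on UNIV")
    case True
    then have "{z\<in>cball 0 ?R. h z = 0} = {}" using h(2) unfolding constant_on_def by auto
    then show ?thesis by (metis finite.emptyI)
  next
    case False
    then show ?thesis using h(1) by (intro holomorphic_compact_finite_zeros[of h UNIV]) auto
  qed
  have fr: "f (of_real r) \<noteq> 0" and gr: "g (of_real r) \<noteq> 0" using less[of "of_real r"] r by auto
  have ff: "finite {z\<in>ball 0 ?R. f z = 0}" by (rule finite_subset[OF _ fin[OF f fr]]) auto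
  have fg: "finite {z\<in>ball 0 ?R. g z = 0}" by (rule finite_subset[OF _ fin[OF g gr]]) auto
  show f1: "finite {z\<in>ball 0 r. f z = 0}" by (rule finite_subset[OF _ ff]) auto
  show g1: "finite {z\<in>ball 0 r. g z = 0}" by (rule finite_subset[OF _ fg]) auto
  have R: "(\<Sum>p | p \<in> ball 0 ?R \<and> f p + (g p - f p) = 0. winding_number (circlepath 0 r) p * zorder (\<lambda>p. f p + (g p - f p)) p)
     = (\<Sum>p | p \<in> ball 0 ?R \<and> f p = 0. winding_number (circlepath 0 r) p * zorder f p)"
  proof (rule Rouche_theorem)
    show "f holomorphic_on ball 0 ?R" "(\<lambda>p. g p - f p) holomorphic_on ball 0 ?R"
      using f g by (auto intro!: holomorphic_intros intro: holomorphic_on_subset)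
    show "\<forall>z\<in>path_image (circlepath 0 r). cmod (g z - f z) < cmod (f z)" using less r by auto
    show "path_image (circlepath 0 r) \<subseteq> ball 0 ?R" using r by auto
    show "\<forall>z. z \<notin> ball 0 ?R \<longrightarrow> winding_number (circlepath 0 r) z = 0"
      using r by (intro allI impI winding_number_zero_outside[of _ "cball 0 r"]) auto
  qed (use ff fg in auto)
  have restrict: "(\<Sum>p | p \<in> ball 0 ?R \<and> h p = 0. winding_number (circlepath 0 r) p * zorder h p) = of_int (\<Sum>p | p \<in> ball 0 r \<and> h p = 0. zorder h p)"
    if fin: "finite {z\<in>ball 0 ?R. h z = 0}" and nz: "\<And>z. cmod z = r \<Longrightarrow> h z \<noteq> 0" for h :: "complex \<Rightarrow> complex"
  proof -
    have "(\<Sum>p | p \<in> ball 0 ?R \<and> h p = 0. winding_number (circlepath 0 r) p * zorder h p) = (\<Sum>p | p \<in> ball 0 r \<and> h p = 0. winding_number (circlepath 0 r) p * zorder h p)"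
    proof (rule sum.mono_neutral_right[OF fin])
      show "\<forall>p\<in>{p \<in> ball 0 ?R. h p = 0} - {p \<in> ball 0 r. h p = 0}. winding_number (circlepath 0 r) p * of_int (zorder h p) = 0"
      proof
        fix p assume "p \<in> {p \<in> ball 0 ?R. h p = 0} - {p \<in> ball 0 r. h p = 0}"
        then have "h p = 0" "\<not> cmod p < r" by auto
        then have "cmod p > r" using nz[of p] by fastforce
        then have "winding_number (circlepath 0 r) p = 0"
          using r by (intro winding_number_zero_outside[of _ "cball 0 r"]) auto
        then show "winding_number (circlepath 0 r) p * of_int (zorder h p) = 0" by simp
      qed
    qed auto
    also have "\<dots> = (\<Sum>p | p \<in> ball 0 r \<and> h p = 0. of_int (zorder h p))"
      by (intro sum.cong) (auto simp: winding_number_circlepath)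
    finally show ?thesis by simp
  qed
  have "of_int (\<Sum>p | p \<in> ball 0 r \<and> g p = 0. zorder g p) = (of_int (\<Sum>p | p \<in> ball 0 r \<and> f p = 0. zorder f p) :: complex)"
    using R restrict[OF ff] restrict[OF fg] less by force
  then show "(\<Sum>z | z \<in> ball 0 r \<and> g z = 0. zorder g z) = (\<Sum>z | z \<in> ball 0 r \<and> f z = 0. zorder f z)"
    by (simp only: of_int_eq_iff)
qed

text \<open>\<open>- e2 k pi\<close> equals exp(2 pi i (k - 1/2)) and lies within 1/2 of 1, so its
  principal logarithm is 2 pi i (k - 1/2) up to a multiple of 2 pi i, which defines
  \<open>m\<close>. The distance follows from |Ln(1 + w)| <= 2|w|, and the argument is written as 1
  + w with this in view.\<close>

lemma near_half_integer:
  assumes "cmod (1 + e2 k pi) < 1/2"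
  obtains m :: int where "2 * pi * \<i> * (k - (of_int m + 1/2)) = Ln (1 + (- e2 k pi - 1))"
    "cmod (k - (of_int m + 1/2)) \<le> cmod (1 + e2 k pi) / pi"
proof -
  have e: "exp (2 * pi * \<i> * (k - 1/2)) = - e2 k pi"
  proof -
    have "exp (2 * pi * \<i> * (k - 1/2)) = exp (2 * \<i> * k * pi + - (\<i> * pi))" by (simp add: algebra_simps)
    also have "\<dots> = e2 k pi * exp (- (\<i> * pi))" unfolding exp_add e2_def ..
    also have "exp (- (\<i> * pi)) = (-1 :: complex)" by (simp add: exp_minus exp_pi_i')
    finally show ?thesis by simp
  qed
  have "exp (Ln (- e2 k pi)) = - e2 k pi" by (simp add: e2_def)
  with e have "exp (2 * pi * \<i> * (k - 1/2)) = exp (Ln (- e2 k pi))" by simp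
  then obtain m :: int where m: "2 * pi * \<i> * (k - 1/2) = Ln (- e2 k pi) + (of_int (2 * m) * pi) * \<i>"
    by (auto simp: exp_eq)
  then have L: "2 * pi * \<i> * (k - (of_int m + 1/2)) = Ln (1 + (- e2 k pi - 1))" by (simp add: algebra_simps)
  have "cmod (- e2 k pi - 1) = cmod (1 + e2 k pi)" by (metis minus_diff_commute norm_minus_cancel add.commute diff_minus_eq_add minus_add_distrib uminus_add_conv_diff)
  then have "cmod (Ln (1 + (- e2 k pi - 1))) \<le> 2 * cmod (1 + e2 k pi)"
    using norm_Ln_le[of "- e2 k pi - 1"] assms by simp
  then have "2 * pi * cmod (k - (of_int m + 1/2)) \<le> 2 * cmod (1 + e2 k pi)"
    unfolding L[symmetric] by (simp add: norm_mult)
  then have "cmod (k - (of_int m + 1/2)) \<le> cmod (1 + e2 k pi) / pi" by (simp add: field_simps)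
  with L show ?thesis using that by blast
qed

lemma half_integer_norm: "cmod (of_int m + 1/2) = \<bar>real_of_int m + 1/2\<bar>"
proof -
  have "of_int m + 1/2 = complex_of_real (real_of_int m + 1/2)" by simp
  then show ?thesis by (metis norm_of_real)
qed

text \<open>Otherwise \<open>k\<close> would be within 1/4 of a half-integer, so its modulus
  \<open>N\<close> would be within 1/4 of some |m + 1/2|. After doubling, an even and an odd integer
  would differ by less than 1.\<close>

lemma circle_lower_bound:
  assumes "cmod k = real N"
  shows "1/2 \<le> cmod (1 + e2 k pi)"
proof (rule ccontr)
  assume a: "\<not> ?thesis"
  then obtain m :: int where m: "cmod (k - (of_int m + 1/2)) \<le> cmod (1 + e2 k pi) / pi"
    using near_half_integer[of k] by auto
  have "cmod (1 + e2 k pi) / pi \<le> (1/2) / 2" using a pi_ge_two by (intro frac_le) auto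
  with m have "cmod (k - (of_int m + 1/2)) \<le> 1/4" by linarith
  moreover have "\<bar>cmod k - cmod (of_int m + 1/2)\<bar> \<le> cmod (k - (of_int m + 1/2))" by (rule norm_triangle_ineq3)
  ultimately have "\<bar>real_of_int (int N) - \<bar>real_of_int m + 1/2\<bar>\<bar> \<le> 1/4"
    unfolding half_integer_norm assms by simp
  then have "\<bar>2 * real_of_int (int N) - \<bar>real_of_int (2 * m + 1)\<bar>\<bar> \<le> 1/2" by (simp add: abs_if split: if_splits)
  then have "\<bar>real_of_int (2 * int N - \<bar>2 * m + 1\<bar>)\<bar> < 1" by simp
  then have "\<bar>2 * int N - \<bar>2 * m + 1\<bar>\<bar> < 1" by linarith
  then show False by presburger
qed

section \<open>The comparison problem: zero potential\<close>

interpretation zero: L2_potential "\<lambda>_. 0"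
  by unfold_locales (simp add: L2_on_0pi_def integrable_0)

lemma amp_zero_potential: "k \<noteq> 0 \<Longrightarrow> zero.amp k pi = 1"
  using antideriv_eq[OF zero.amp_antideriv, of k pi] by (simp add: zero.af_def)

lemma char_fn_zero_potential:
  "char_fn (\<lambda>_. 0) (k\<^sup>2) = cos (k * pi)"
proof (cases "k = 0")
  case False
  then have "char_fn (\<lambda>_. 0) (k\<^sup>2) = (exp (\<i> * k * pi) + exp (- \<i> * k * pi)) / 2"
    using zero.char_fn_amp[of k] amp_zero_potential[of k] amp_zero_potential[of "- k"] by simp
  also have "\<dots> = cos (k * pi)" unfolding cos_exp_eq by (simp add: mult_ac)
  finally show ?thesis .
next
  case True
  \<comment> \<open>The amplitude equations divide by \<open>k\<close>; at \<open>k = 0\<close> the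
    solution \<open>(x, 1)\<close> is given explicitly instead.\<close>
  have "antideriv pi (\<lambda>x. complex_of_real x) (\<lambda>t. 1)"
  proof (rule antideriv_FTC)
    show "(complex_of_real has_vector_derivative 1) (at x)" for x
      using bounded_linear.has_vector_derivative[OF bounded_linear_of_real has_vector_derivative_id, of "at x"]
      by simp
  qed (intro continuous_intros)
  moreover have "antideriv pi (\<lambda>x. 1::complex) (\<lambda>t. 0)" by (rule antideriv_const)
  ultimately have "reg_sol (\<lambda>_. 0) 0 (\<lambda>x. of_real x) (\<lambda>x. 1)" unfolding reg_sol_antideriv by simp
  from zero.reg_sol_unique(2)[OF this, of pi] show ?thesis using True by (simp add: zero.char_fn_eq)
qed

lemma zero_potential_zeros:
  "{z \<in> ball 0 ((real N)\<^sup>2). char_fn (\<lambda>_. 0) z = 0} = (\<lambda>j. of_real ((real j - 1/2)\<^sup>2)) ` {1..N}"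
proof (intro set_eqI iffI)
  fix z assume "z \<in> {z \<in> ball 0 ((real N)\<^sup>2). char_fn (\<lambda>_. 0) z = 0}"
  then have z: "cmod z < (real N)\<^sup>2" "char_fn (\<lambda>_. 0) ((csqrt z)\<^sup>2) = 0" by auto
  then obtain m :: int where "csqrt z * pi = of_real (m * pi) + of_real pi / 2"
    unfolding char_fn_zero_potential cos_eq_0 by blast
  then have "csqrt z * pi = (of_int m + 1/2) * pi" by (simp add: algebra_simps)
  then have k: "csqrt z = of_int m + 1/2" by simp
  have zk: "z = (of_int m + 1/2)\<^sup>2" using k power2_csqrt[of z] by simp
  have re: "Re (csqrt z) = real_of_int m + 1/2" unfolding k by simp
  have "0 \<le> Re (csqrt z)" using csqrt_principal[of z] by auto
  then have m0: "m \<ge> 0" unfolding re by linarith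
  have "(real_of_int m + 1/2)\<^sup>2 < (real N)\<^sup>2"
    using z(1) unfolding zk norm_power half_integer_norm by simp
  then have "real_of_int m + 1/2 < real N" by (rule power2_less_imp_less) simp
  then have "m < int N" by linarith
  with m0 have "nat (m + 1) \<in> {1..N}" by auto
  moreover have "real (nat (m + 1)) - 1/2 = real_of_int m + 1/2" using m0 by simp
  then have "z = of_real ((real (nat (m + 1)) - 1/2)\<^sup>2)" unfolding zk by (simp add: add.commute)
  ultimately show "z \<in> (\<lambda>j. of_real ((real j - 1/2)\<^sup>2)) ` {1..N}" by blast
next
  fix z :: complex assume "z \<in> (\<lambda>j. of_real ((real j - 1/2)\<^sup>2)) ` {1..N}"
  then obtain j where j: "j \<in> {1..N}" "z = of_real ((real j - 1/2)\<^sup>2)" by blast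
  have "cos (of_real (real j - 1/2) * complex_of_real pi) = 0"
    unfolding cos_eq_0 by (intro exI[of _ "int j - 1"]) (simp add: algebra_simps)
  then have "char_fn (\<lambda>_. 0) z = 0" using char_fn_zero_potential[of "of_real (real j - 1/2)"] j(2) by simp
  moreover have "cmod z < (real N)\<^sup>2"
  proof -
    have "cmod z = (real j - 1/2)\<^sup>2" unfolding j(2) norm_of_real by simp
    also have "\<dots> < (real N)\<^sup>2" using j(1) by (intro power_strict_mono) auto
    finally show ?thesis .
  qed
  ultimately show "z \<in> {z \<in> ball 0 ((real N)\<^sup>2). char_fn (\<lambda>_. 0) z = 0}" by simp
qed

text \<open>Differentiating \<open>char_fn\<close> at \<open>k^2\<close> as a function of
  \<open>k\<close> by the chain rule gives the derivative of cos(k pi), which is nonzero where the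
  cosine vanishes; hence so is the derivative in the spectral parameter.\<close>

lemma zero_potential_zorder:
  assumes j: "j \<ge> (1::nat)"
  shows "zorder (char_fn (\<lambda>_. 0)) (of_real ((real j - 1/2)\<^sup>2)) = 1"
proof -
  let ?f = "char_fn (\<lambda>_. 0)"
  let ?k = "complex_of_real (real j - 1/2)"
  have k0: "?k \<noteq> 0" using j by (simp add: complex_eq_iff)
  have z: "complex_of_real ((real j - 1/2)\<^sup>2) = ?k\<^sup>2" by simp
  have c0: "cos (?k * pi) = 0"
    unfolding cos_eq_0 by (intro exI[of _ "int j - 1"]) (simp add: algebra_simps)
  then have s0: "sin (?k * pi) \<noteq> 0" by (metis add.right_neutral power_zero_numeral sin_cos_squared_add zero_neq_one)
  have hol: "?f holomorphic_on UNIV" by (rule zero.char_fn_holo)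
  have d1: "((\<lambda>k. ?f (k\<^sup>2)) has_field_derivative deriv ?f (?k\<^sup>2) * (2 * ?k)) (at ?k)"
  proof -
    have "(?f has_field_derivative deriv ?f (?k\<^sup>2)) (at (?k\<^sup>2))"
      using holomorphic_derivI[OF hol, of "?k\<^sup>2"] by simp
    moreover have "((\<lambda>k. k\<^sup>2) has_field_derivative 2 * ?k) (at ?k)"
      by (auto intro!: derivative_eq_intros)
    ultimately show ?thesis by (rule DERIV_chain2)
  qed
  have d2: "((\<lambda>k. cos (k * pi)) has_field_derivative - (pi * sin (?k * pi))) (at ?k)"
    by (auto intro!: derivative_eq_intros)
  have "deriv ?f (?k\<^sup>2) * (2 * ?k) = - (pi * sin (?k * pi))"
    using DERIV_unique[OF d1[unfolded char_fn_zero_potential] d2] .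
  then have dn: "deriv ?f (?k\<^sup>2) \<noteq> 0" using s0 by auto
  show ?thesis unfolding z
  proof (rule zorder_zero_eqI[OF hol])
    fix i assume "i < nat 1"
    then show "(deriv ^^ i) ?f (?k\<^sup>2) = 0" using c0 char_fn_zero_potential[of ?k] by simp
  qed (use dn in auto)
qed

lemma zero_potential_count:
  "(\<Sum>z | z \<in> ball 0 ((real N)\<^sup>2) \<and> char_fn (\<lambda>_. 0) z = 0. zorder (char_fn (\<lambda>_. 0)) z) = int N"
proof -
  have inj: "inj_on (\<lambda>j. complex_of_real ((real j - 1/2)\<^sup>2)) {1..N}"
  proof (rule inj_onI)
    fix i j assume ij: "i \<in> {1..N}" "j \<in> {1..N}" "complex_of_real ((real i - 1/2)\<^sup>2) = complex_of_real ((real j - 1/2)\<^sup>2)"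
    then have "(real i - 1/2)\<^sup>2 = (real j - 1/2)\<^sup>2" by (simp only: of_real_eq_iff)
    then show "i = j" using ij(1,2) by (subst (asm) power2_eq_iff_nonneg) auto
  qed
  show ?thesis unfolding zero_potential_zeros sum.reindex[OF inj] o_def
    using zero_potential_zorder by (simp del: of_real_power of_real_diff)
qed

section \<open>Counting the eigenvalues by comparison with the zero potential\<close>

context L2_potential
begin

text \<open>In the closed upper half plane the kernel \<open>e2 k x * e2 (- k) t\<close>,
  \<open>t <= x\<close>, has modulus at most 1, so \<open>amp_bound\<close> applies with
  \<open>K = 1\<close>. The weight is moved inside the oscillatory integral, where it becomes the
  shift \<open>d\<close> of \<open>riemann_lebesgue\<close>.\<close>

lemma amp_asymptotic:
  assumes e: "e > 0"
  shows "\<exists>R. \<forall>k. R \<le> cmod k \<longrightarrow> Im k \<ge> 0 \<longrightarrow> cmod (e2 k pi * (amp k pi - 1) + (amp (- k) pi - 1)) \<le> e"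
proof -
  have C: "Cb 1 > 0" by (rule Cb_pos) simp
  define d where "d = e / Cb 1"
  have d: "d > 0" using e C by (simp add: d_def)
  obtain R where R: "R > 0" and RL: "\<And>k c x. R \<le> cmod k \<Longrightarrow> x \<in> {0..pi} \<Longrightarrow> (\<forall>t\<in>{0..x}. cmod (exp (k * of_real t + c)) \<le> 1) \<Longrightarrow>
           cmod (integral {0..x} (\<lambda>t. u t * exp (k * of_real t + c))) \<le> d"
    using riemann_lebesgue[OF u_absint d, of 1] by auto
  \<comment> \<open>In the threshold, \<open>R\<close> serves the Riemann-Lebesgue lemma,
    \<open>U2 / d\<close> yields \<open>U2 / cmod k <= d\<close>, and 1 yields
    \<open>cmod k >= 1\<close>.\<close>
  have "cmod (e2 k pi * (amp k pi - 1) + (amp (- k) pi - 1)) \<le> e"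
    if k: "R + U2 / d + 1 \<le> cmod k" and im: "Im k \<ge> 0" for k
  proof -
    have U: "U2 / d \<ge> 0" using U_nonneg d by simp
    have ker: "cmod (e2 k x * e2 (- k) t) \<le> 1" if "0 \<le> t" "t \<le> x" for t x
    proof -
      have "e2 k x * e2 (- k) t = exp (2 * \<i> * k * of_real (x - t))"
        unfolding e2_def exp_add[symmetric] by (simp add: algebra_simps)
      moreover have "Im k * (x - t) \<ge> 0" using im that by simp
      ultimately show ?thesis by (simp add: norm_exp_eq_Re)
    qed
    have "cmod (e2 k pi * (amp k pi - 1)) + cmod (amp (- k) pi - 1) \<le> Cb 1 * d"
    proof (rule amp_bound)
      show "1 \<le> cmod k" using k R U by simp
      show "U2 / cmod k \<le> d"
      proof -
        have "cmod k > 0" using k R U by linarith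
        moreover have "U2 / d \<le> cmod k" using k R by linarith
        ultimately show ?thesis using d by (simp add: field_simps)
      qed
      fix x assume x: "x \<in> {0..pi}"
      have "cmod (integral {0..x} (\<lambda>t. u t * exp ((2 * \<i> * k) * of_real t + 0))) \<le> d"
      proof (rule RL[OF _ x])
        show "R \<le> cmod (2 * \<i> * k)" using k R U by (simp add: norm_mult)
        show "\<forall>t\<in>{0..x}. cmod (exp (2 * \<i> * k * complex_of_real t + 0)) \<le> 1"
          using ker[of 0] by (auto simp: e2_def)
      qed
      then show "cmod (integral {0..x} (\<lambda>t. u t * e2 k t)) \<le> d" by (simp add: e2_def)
      have sh: "e2 k x * e2 (- k) t = exp ((- 2 * \<i> * k) * of_real t + 2 * \<i> * k * of_real x)" for t
        unfolding e2_def exp_add[symmetric] by (simp add: algebra_simps)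
      have "cmod (integral {0..x} (\<lambda>t. u t * exp ((- 2 * \<i> * k) * of_real t + 2 * \<i> * k * of_real x))) \<le> d"
      proof (rule RL[OF _ x])
        show "R \<le> cmod (- 2 * \<i> * k)" using k R U by (simp add: norm_mult)
        show "\<forall>t\<in>{0..x}. cmod (exp (- 2 * \<i> * k * complex_of_real t + 2 * \<i> * k * of_real x)) \<le> 1"
          using ker[of _ x] unfolding sh by auto
      qed
      moreover have "e2 k x * integral {0..x} (\<lambda>t. u t * e2 (- k) t) = integral {0..x} (\<lambda>t. u t * (e2 k x * e2 (- k) t))"
        unfolding Henstock_Kurzweil_Integration.integral_mult_right[symmetric] by (simp add: mult_ac)
      ultimately show "cmod (e2 k x * integral {0..x} (\<lambda>t. u t * e2 (- k) t)) \<le> d" unfolding sh by simp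
    qed (use ker in auto)
    also have "\<dots> = e" using C by (simp add: d_def)
    finally show ?thesis by (intro order_trans[OF norm_triangle_ineq])
  qed
  then show ?thesis by blast
qed

text \<open>With the exponential that grows in the upper half plane factored out, the comparison
  with the zero potential reduces to that of the bracket with \<open>e2 k pi + 1\<close>.\<close>

lemma char_fn_e2: "char_fn u (k\<^sup>2) = exp (- \<i> * k * pi) / 2 * (e2 k pi * amp k pi + amp (- k) pi)"
proof -
  have "exp (\<i> * k * pi) = exp (- \<i> * k * pi) * e2 k pi"
    unfolding e2_def exp_add[symmetric] by (simp add: algebra_simps)
  then show ?thesis unfolding char_fn_amp by (simp add: algebra_simps add_divide_distrib)
qed

lemma eigenvalue_count:
  "\<exists>N0. \<forall>N\<ge>N0. finite {z\<in>ball 0 ((real N)\<^sup>2). char_fn u z = 0} \<and> (\<forall>z. cmod z = (real N)\<^sup>2 \<longrightarrow> char_fn u z \<noteq> 0) \<and>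
     (\<Sum>z | z \<in> ball 0 ((real N)\<^sup>2) \<and> char_fn u z = 0. zorder (char_fn u) z) = int N"
proof -
  \<comment> \<open>The tolerance 1/4 stays below the lower bound 1/2 of
    \<open>circle_lower_bound\<close>.\<close>
  obtain R where R: "\<And>k. R \<le> cmod k \<Longrightarrow> Im k \<ge> 0 \<Longrightarrow> cmod (e2 k pi * (amp k pi - 1) + (amp (- k) pi - 1)) \<le> 1/4"
    using amp_asymptotic[of "1/4"] by auto
  obtain N0 :: nat where N0: "R \<le> real N0" using real_arch_simple by blast
  have less: "cmod (char_fn u z - char_fn (\<lambda>_. 0) z) < cmod (char_fn (\<lambda>_. 0) z)" if N: "N \<ge> N0" and z: "cmod z = (real N)\<^sup>2" for N z
  proof -
    \<comment> \<open>The characteristic function depends on \<open>k^2\<close> only, so the root in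
      the closed upper half plane may be taken; the principal root can lie below the real
      axis.\<close>
    define k where "k = (if Im (csqrt z) \<ge> 0 then csqrt z else - csqrt z)"
    have kz: "k\<^sup>2 = z" and im: "Im k \<ge> 0" by (auto simp: k_def)
    have kN: "cmod k = real N"
    proof -
      have "(cmod k)\<^sup>2 = (real N)\<^sup>2" using z kz norm_power[of k 2] by simp
      then show ?thesis by simp
    qed
    let ?E = "exp (- \<i> * k * pi) / 2"
    have u: "char_fn u z = ?E * (e2 k pi * amp k pi + amp (- k) pi)" using char_fn_e2[of k] kz by simp
    have 0: "char_fn (\<lambda>_. 0) z = ?E * (e2 k pi + 1)"
    proof -
      have "exp (- \<i> * k * pi) * e2 k pi = exp (\<i> * k * pi)" unfolding e2_def exp_add[symmetric] by (simp add: algebra_simps)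
      then have "?E * (e2 k pi + 1) = (exp (\<i> * k * pi) + exp (- \<i> * k * pi)) / 2" by (simp add: distrib_left)
      also have "\<dots> = cos (k * pi)" unfolding cos_exp_eq by (simp add: mult_ac)
      finally show ?thesis using char_fn_zero_potential[of k] kz by simp
    qed
    have "char_fn u z - char_fn (\<lambda>_. 0) z = ?E * (e2 k pi * (amp k pi - 1) + (amp (- k) pi - 1))"
      unfolding u 0 by (simp add: algebra_simps)
    then have "cmod (char_fn u z - char_fn (\<lambda>_. 0) z) \<le> cmod ?E * (1/4)"
      using R[of k] im kN N N0 by (simp only: norm_mult) (intro mult_left_mono, auto)
    also have "\<dots> < cmod ?E * (1/2)" by (intro mult_strict_left_mono) auto
    also have "\<dots> \<le> cmod ?E * cmod (e2 k pi + 1)"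
      using circle_lower_bound[OF kN] by (intro mult_left_mono) (auto simp: add.commute)
    also have "\<dots> = cmod (char_fn (\<lambda>_. 0) z)" unfolding 0 by (simp add: norm_mult)
    finally show ?thesis .
  qed
  show ?thesis
  proof (intro exI[of _ "max 1 N0"] allI impI)
    fix N assume N: "max 1 N0 \<le> N"
    then have r: "(real N)\<^sup>2 > 0" by simp
    have l: "\<And>z. cmod z = (real N)\<^sup>2 \<Longrightarrow> cmod (char_fn u z - char_fn (\<lambda>_. 0) z) < cmod (char_fn (\<lambda>_. 0) z)"
      using less[of N] N by auto
    note rc = rouche_circle[OF zero.char_fn_holo char_fn_holo r l]
    have "\<forall>z. cmod z = (real N)\<^sup>2 \<longrightarrow> char_fn u z \<noteq> 0" using l by force
    with rc(2,3) zero_potential_count[of N]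
    show "finite {z\<in>ball 0 ((real N)\<^sup>2). char_fn u z = 0} \<and> (\<forall>z. cmod z = (real N)\<^sup>2 \<longrightarrow> char_fn u z \<noteq> 0) \<and>
     (\<Sum>z | z \<in> ball 0 ((real N)\<^sup>2) \<and> char_fn u z = 0. zorder (char_fn u) z) = int N" by simp
  qed
qed

end

text \<open>Total multiplicity \<open>N\<close> in \<open>Z N\<close> forces each increment beyond
  \<open>N0\<close> to be one point of multiplicity 1, which becomes the value at that index. The
  points of \<open>Z N0\<close> are listed with repetition through a bijection of
  \<open>{1..N0}\<close> with the pairs \<open>(z, i)\<close>, \<open>i < m z\<close>.\<close>

lemma enumerate_exhaustion:
  fixes Z :: "nat \<Rightarrow> 'a set" and m :: "'a \<Rightarrow> nat"
  assumes fin: "\<And>N. N \<ge> N0 \<Longrightarrow> finite (Z N)" and sum: "\<And>N. N \<ge> N0 \<Longrightarrow> sum m (Z N) = N"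
    and mono: "\<And>M N. M \<le> N \<Longrightarrow> Z M \<subseteq> Z N" and pos: "\<And>z N. z \<in> Z N \<Longrightarrow> m z \<ge> 1"
  obtains lams where "\<And>n. n \<ge> 1 \<Longrightarrow> \<exists>N. lams n \<in> Z N"
    "\<And>z N. z \<in> Z N \<Longrightarrow> finite {n. n \<ge> 1 \<and> lams n = z} \<and> card {n. n \<ge> 1 \<and> lams n = z} = m z"
    "\<And>n. n > N0 \<Longrightarrow> lams n \<in> Z n - Z (n - 1)"
proof -
  have "\<exists>z. Z n - Z (n - 1) = {z} \<and> m z = 1" if n: "n > N0" for n
  proof -
    have f: "finite (Z n - Z (n - 1))" using fin[of n] n by simp
    have "sum m (Z n - Z (n - 1)) = sum m (Z n) - sum m (Z (n - 1))"
      using fin[of n] n mono[of "n - 1" n] by (intro sum_diff_nat) (auto intro: finite_subset)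
    then have s: "sum m (Z n - Z (n - 1)) = 1" using sum[of n] sum[of "n - 1"] n by simp
    have "card (Z n - Z (n - 1)) \<le> sum m (Z n - Z (n - 1))"
      using sum_mono[of "Z n - Z (n - 1)" "\<lambda>_. 1" m] pos by auto
    moreover have "Z n - Z (n - 1) \<noteq> {}"
    proof
      assume "Z n - Z (n - 1) = {}"
      then have "sum m (Z n - Z (n - 1)) = 0" by (metis sum.empty)
      with s show False by simp
    qed
    then have "card (Z n - Z (n - 1)) > 0" using f by (simp only: card_gt_0_iff) simp
    ultimately have "card (Z n - Z (n - 1)) = 1" using s by linarith
    then obtain z where "Z n - Z (n - 1) = {z}" by (rule card_1_singletonE)
    then show ?thesis using s by auto
  qed
  then obtain \<mu> where \<mu>: "\<And>n. n > N0 \<Longrightarrow> Z n - Z (n - 1) = {\<mu> n}" "\<And>n. n > N0 \<Longrightarrow> m (\<mu> n) = 1" by metis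
  have "card (SIGMA z : Z N0. {..<m z}) = card {1..N0}"
    using fin[of N0] sum[of N0] by (subst card_SigmaI) auto
  then obtain h where h: "bij_betw h {1..N0} (SIGMA z : Z N0. {..<m z})"
    using finite_same_card_bij[of "{1..N0}" "SIGMA z : Z N0. {..<m z}"] fin[of N0] by auto
  define lams where "lams = (\<lambda>n. if n \<le> N0 then fst (h n) else \<mu> n)"
  have l1: "lams n \<in> Z N0" if "n \<in> {1..N0}" for n
    using bij_betwE[OF h] that by (force simp: lams_def)
  have l2: "lams n \<in> Z n - Z (n - 1)" if "n > N0" for n
    using \<mu>(1)[OF that] that by (simp add: lams_def)
  have l3: "finite {n. n \<ge> 1 \<and> lams n = z} \<and> card {n. n \<ge> 1 \<and> lams n = z} = m z" if z: "z \<in> Z N" for z N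
  proof (cases "z \<in> Z N0")
    case True
    have ge: "\<not> n > N0" if "lams n = z" for n
    proof
      assume n: "n > N0"
      then have "Z N0 \<subseteq> Z (n - 1)" by (intro mono) simp
      then show False using l2[OF n] True that by auto
    qed
    have eq: "{n. n \<ge> 1 \<and> lams n = z} = {n\<in>{1..N0}. fst (h n) = z}"
    proof -
      have "n \<le> N0 \<Longrightarrow> lams n = fst (h n)" for n by (simp add: lams_def)
      moreover have "lams n = z \<Longrightarrow> n \<le> N0" for n using ge[of n] by simp
      ultimately have "(1 \<le> n \<and> lams n = z) = (1 \<le> n \<and> n \<le> N0 \<and> fst (h n) = z)" for n by metis
      then show ?thesis by (simp add: conj_assoc)
    qed
    have inj: "inj_on h {n\<in>{1..N0}. fst (h n) = z}"
      using h by (auto simp: bij_betw_def intro: inj_on_subset)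
    have "h ` {n\<in>{1..N0}. fst (h n) = z} = {z} \<times> {..<m z}"
    proof (intro set_eqI iffI)
      fix p assume "p \<in> h ` {n\<in>{1..N0}. fst (h n) = z}"
      then show "p \<in> {z} \<times> {..<m z}" using bij_betwE[OF h] by fastforce
    next
      fix p assume p: "p \<in> {z} \<times> {..<m z}"
      then have "p \<in> h ` {1..N0}" using True h by (auto simp: bij_betw_def)
      then obtain n where "n \<in> {1..N0}" "p = h n" by blast
      with p show "p \<in> h ` {n\<in>{1..N0}. fst (h n) = z}" by (intro image_eqI[of _ _ n]) auto
    qed
    then have "card {n\<in>{1..N0}. fst (h n) = z} = card ({z} \<times> {..<m z})"
      using card_image[OF inj] by simp
    then show ?thesis unfolding eq by (simp add: card_cartesian_product)
  next
    case False
    \<comment> \<open>The first occurrence of \<open>z\<close> lies beyond \<open>N0\<close> by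
      monotonicity, so \<open>n - 1\<close> is a genuine predecessor and \<open>z\<close> is the
      single point of the increment at \<open>n\<close>.\<close>
    define n where "n = (LEAST n. z \<in> Z n)"
    have zn: "z \<in> Z n" unfolding n_def using z by (rule LeastI)
    have nN: "n > N0" using False zn mono[of n N0] by (meson not_le subsetD)
    have zn1: "z \<notin> Z (n - 1)" unfolding n_def using not_less_Least[of "n - 1" "\<lambda>n. z \<in> Z n"] nN by (simp add: n_def)
    with zn have "z \<in> Z n - Z (n - 1)" by simp
    then have z\<mu>: "\<mu> n = z" unfolding \<mu>(1)[OF nN] by simp
    have "n' = n" if n': "n' \<ge> 1" "lams n' = z" for n'
    proof -
      have g: "n' > N0" using l1[of n'] False n' by force
      have "z \<in> Z n' - Z (n' - 1)" using l2[OF g] n'(2) by simp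
      moreover have "Z n' \<subseteq> Z (n - 1)" if "n' < n" using that by (intro mono) simp
      moreover have "Z n \<subseteq> Z (n' - 1)" if "n < n'" using that by (intro mono) simp
      ultimately show ?thesis using zn1 zn by (cases n' n rule: linorder_cases) auto
    qed
    then have "{n. n \<ge> 1 \<and> lams n = z} = {n}" using nN z\<mu> by (auto simp: lams_def)
    then show ?thesis using \<mu>(2)[OF nN] z\<mu> by simp
  qed
  have "\<exists>N. lams n \<in> Z N" if "n \<ge> 1" for n
    using l1[of n] l2[of n] that by (cases "n \<le> N0") auto
  then show ?thesis using that l2 l3 by blast
qed

context L2_potential
begin

text \<open>The open discs of radius \<open>N^2\<close> exhaust the spectrum, with total
  multiplicity \<open>N\<close> once \<open>N\<close> is large; the increments of this exhaustion
  give the annuli, closed on the inner side.\<close>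

lemma eig_enum_exists:
  "\<exists>lams N0. eig_enum u lams \<and>
    (\<forall>n>N0. char_fn u (lams n) = 0 \<and> (real n - 1)\<^sup>2 \<le> cmod (lams n) \<and> cmod (lams n) < (real n)\<^sup>2)"
proof -
  obtain N0 where N0: "\<And>N. N \<ge> N0 \<Longrightarrow> finite {z\<in>ball 0 ((real N)\<^sup>2). char_fn u z = 0}"
    "\<And>N z. N \<ge> N0 \<Longrightarrow> cmod z = (real N)\<^sup>2 \<Longrightarrow> char_fn u z \<noteq> 0"
    "\<And>N. N \<ge> N0 \<Longrightarrow> (\<Sum>z | z \<in> ball 0 ((real N)\<^sup>2) \<and> char_fn u z = 0. zorder (char_fn u) z) = int N"
    using eigenvalue_count by blast
  define Z where "Z = (\<lambda>N::nat. {z\<in>ball 0 ((real N)\<^sup>2). char_fn u z = 0})"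
  define m where "m = eig_mult u"
  \<comment> \<open>The order at a zero is positive because \<open>char_fn u\<close> does not vanish
    identically, as any point of a counting circle shows.\<close>
  have nonzero: "\<exists>w\<in>UNIV. char_fn u w \<noteq> 0" using N0(2)[of N0 "of_real ((real N0)\<^sup>2)"] unfolding norm_of_real by auto
  have zo: "zorder (char_fn u) z > 0" if "char_fn u z = 0" for z
    using zorder_exist_zero[OF char_fn_holo open_UNIV connected_UNIV UNIV_I nonzero, of z] that by simp
  obtain lams where l: "\<And>n. n \<ge> 1 \<Longrightarrow> \<exists>N. lams n \<in> Z N"
    "\<And>z N. z \<in> Z N \<Longrightarrow> finite {n. n \<ge> 1 \<and> lams n = z} \<and> card {n. n \<ge> 1 \<and> lams n = z} = m z"
    "\<And>n. n > N0 \<Longrightarrow> lams n \<in> Z n - Z (n - 1)"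
  proof (rule enumerate_exhaustion[of N0 Z m])
    fix N :: nat assume N: "N \<ge> N0"
    show "finite (Z N)" using N0(1)[OF N] by (simp add: Z_def)
    have "int (sum m (Z N)) = (\<Sum>z\<in>Z N. zorder (char_fn u) z)"
      unfolding of_nat_sum m_def eig_mult_def using zo by (intro sum.cong) (auto simp: Z_def dest: order_less_imp_le)
    also have "\<dots> = int N" using N0(3)[OF N] by (simp add: Z_def)
    finally show "sum m (Z N) = N" by (simp only: of_nat_eq_iff)
  next
    fix M N :: nat assume "M \<le> N"
    then have "(real M)\<^sup>2 \<le> (real N)\<^sup>2" by (intro power_mono) auto
    note sq = this
    show "Z M \<subseteq> Z N"
    proof
      fix z assume "z \<in> Z M"
      then have "cmod z < (real M)\<^sup>2" "char_fn u z = 0" by (auto simp: Z_def)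
      then show "z \<in> Z N" using order.strict_trans2[OF _ sq] by (simp add: Z_def)
    qed
  next
    fix z N assume "z \<in> Z N"
    then show "m z \<ge> 1" using zo[of z] by (simp add: Z_def m_def eig_mult_def)
  qed (rule that; blast)
  have ex: "\<exists>N. z \<in> Z N" if z: "char_fn u z = 0" for z
  proof -
    obtain N :: nat where "cmod z < real N" using reals_Archimedean2 by blast
    moreover have "real N \<le> (real N)\<^sup>2" unfolding power2_eq_square by (cases N) auto
    ultimately have "cmod z < (real N)\<^sup>2" by (rule order.strict_trans2)
    then show ?thesis using z by (intro exI[of _ N]) (simp add: Z_def)
  qed
  have "eig_enum u lams"
    unfolding eig_enum_def is_eigenvalue_iff
  proof
    fix mu
    show "if char_fn u mu = 0 then finite {n. 1 \<le> n \<and> lams n = mu} \<and> card {n. 1 \<le> n \<and> lams n = mu} = eig_mult u mu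
         else {n. 1 \<le> n \<and> lams n = mu} = {}"
    proof (cases "char_fn u mu = 0")
      case True
      then show ?thesis using ex[OF True] l(2) by (auto simp: m_def)
    next
      case False
      then have "\<not> (n \<ge> 1 \<and> lams n = mu)" for n using l(1)[of n] by (auto simp: Z_def)
      then show ?thesis using False by auto
    qed
  qed
  moreover have "char_fn u (lams n) = 0 \<and> (real n - 1)\<^sup>2 \<le> cmod (lams n) \<and> cmod (lams n) < (real n)\<^sup>2" if n: "n > N0" for n
    using l(3)[OF n] n by (auto simp: Z_def not_less of_nat_diff)
  ultimately show ?thesis by blast
qed

section \<open>Asymptotics of the eigenvalues\<close>

lemma e2_norm: "cmod (e2 k t) = exp (- (2 * (Im k * t)))"
  by (simp add: e2_def norm_exp_eq_Re)

text \<open>The half-plane estimate concerns the root \<open>k'\<close>, which may be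
  \<open>- k\<close> for the principal root \<open>k\<close>. Then 1 + e2(k) is 1 + e2(k') times
  e2(k), whose modulus is at most 8/7, so 1/8 becomes 1/7, and dividing by pi gives at most 1/14.
  Since \<open>Re k >= 0\<close> and \<open>n - 1 <= cmod k < n\<close>, the half-integer that is
  this close to \<open>k\<close> must be n - 1/2.\<close>

lemma root_location:
  "\<exists>N1. \<forall>n\<ge>N1. \<forall>l. char_fn u l = 0 \<longrightarrow> (real n - 1)\<^sup>2 \<le> cmod l \<longrightarrow> cmod l < (real n)\<^sup>2 \<longrightarrow>
     cmod (1 + e2 (csqrt l) pi) \<le> 1/7 \<and>
     2 * pi * \<i> * (csqrt l - of_real (real n - 1/2)) = Ln (1 + (- e2 (csqrt l) pi - 1)) \<and>
     cmod (csqrt l - of_real (real n - 1/2)) \<le> 1/14"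
proof -
  obtain R where R: "\<And>k. R \<le> cmod k \<Longrightarrow> Im k \<ge> 0 \<Longrightarrow> cmod (e2 k pi * (amp k pi - 1) + (amp (- k) pi - 1)) \<le> 1/8"
    using amp_asymptotic[of "1/8"] by auto
  obtain N0 :: nat where N0: "R \<le> real N0" using real_arch_simple by blast
  have "cmod (1 + e2 (csqrt l) pi) \<le> 1/7 \<and>
     2 * pi * \<i> * (csqrt l - of_real (real n - 1/2)) = Ln (1 + (- e2 (csqrt l) pi - 1)) \<and>
     cmod (csqrt l - of_real (real n - 1/2)) \<le> 1/14"
    if n: "n \<ge> N0 + 2" and l: "char_fn u l = 0" "(real n - 1)\<^sup>2 \<le> cmod l" "cmod l < (real n)\<^sup>2" for n l
  proof -
    define k where "k = csqrt l"
    define k' where "k' = (if Im k \<ge> 0 then k else - k)"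
    have kz: "k'\<^sup>2 = l" and im: "Im k' \<ge> 0" by (auto simp: k_def k'_def)
    have kk: "(cmod k)\<^sup>2 = cmod l" using norm_power[of k 2] by (simp add: k_def)
    have k1: "real n - 1 \<le> cmod k" by (rule power2_le_imp_le) (use kk l in auto)
    have k2: "cmod k < real n" by (rule power2_less_imp_less) (use kk l in auto)
    have nk': "cmod k' = cmod k" by (simp add: k'_def)
    have z: "e2 k' pi * amp k' pi + amp (- k') pi = 0" using char_fn_e2[of k'] l(1) kz by simp
    have "1 + e2 k' pi = - (e2 k' pi * (amp k' pi - 1) + (amp (- k') pi - 1)) + (e2 k' pi * amp k' pi + amp (- k') pi)"
      by (simp add: algebra_simps)
    then have "1 + e2 k' pi = - (e2 k' pi * (amp k' pi - 1) + (amp (- k') pi - 1))" unfolding z by simp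
    then have "cmod (1 + e2 k' pi) = cmod (e2 k' pi * (amp k' pi - 1) + (amp (- k') pi - 1))" by (metis norm_minus_cancel)
    also have "\<dots> \<le> 1/8" using R[of k'] im nk' k1 n N0 by simp
    finally have w': "cmod (1 + e2 k' pi) \<le> 1/8" .
    have w: "cmod (1 + e2 k pi) \<le> 1/7"
    proof (cases "k' = k")
      case False
      then have km: "k = - k'" by (auto simp: k'_def split: if_splits)
      have "1 + e2 k pi = (1 + e2 k' pi) * e2 k pi"
        unfolding km using e2_minus(1)[of k' pi] by (simp add: distrib_right)
      moreover have "cmod (e2 k' pi) * cmod (e2 k pi) = 1"
        unfolding km norm_mult[symmetric] e2_minus by simp
      moreover have "cmod (e2 k' pi) \<ge> 7/8"
        using w' norm_triangle_ineq4[of "1 + e2 k' pi" "e2 k' pi"] by simp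
      ultimately have "cmod (1 + e2 k pi) \<le> 1/8 * cmod (e2 k pi)" "7/8 * cmod (e2 k pi) \<le> 1"
        using mult_right_mono[OF w' norm_ge_zero[of "e2 k pi"]] mult_right_mono[of "7/8" "cmod (e2 k' pi)" "cmod (e2 k pi)"] norm_mult[of "1 + e2 k' pi" "e2 k pi"]
        by auto
      then show ?thesis by simp
    qed (use w' in simp)
    then obtain m :: int where m: "2 * pi * \<i> * (k - (of_int m + 1/2)) = Ln (1 + (- e2 k pi - 1))"
      "cmod (k - (of_int m + 1/2)) \<le> cmod (1 + e2 k pi) / pi"
      using near_half_integer[of k] by auto
    have "cmod (1 + e2 k pi) / pi \<le> (1/7) / 2" using w pi_ge_two by (intro frac_le) auto
    with m(2) have d: "cmod (k - (of_int m + 1/2)) \<le> 1/14" by linarith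
    moreover have "\<bar>cmod k - cmod (of_int m + 1/2)\<bar> \<le> cmod (k - (of_int m + 1/2))" by (rule norm_triangle_ineq3)
    ultimately have a: "\<bar>cmod k - \<bar>real_of_int m + 1/2\<bar>\<bar> \<le> 1/14" unfolding half_integer_norm by linarith
    have "\<bar>Re (k - (of_int m + 1/2))\<bar> \<le> 1/14" using d abs_Re_le_cmod order_trans by blast
    then have re: "\<bar>Re k - (real_of_int m + 1/2)\<bar> \<le> 1/14" by simp
    have "0 \<le> Re k" using csqrt_principal[of l] by (auto simp: k_def)
    with re have "real_of_int m \<ge> - 4/7" by linarith
    then have m0: "m \<ge> 0" by linarith
    with a have "\<bar>cmod k - (real_of_int m + 1/2)\<bar> \<le> 1/14" by simp
    then have "real_of_int m < real n" "real_of_int m > real n - 2" using k1 k2 by linarith+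
    then have "m = int n - 1" by linarith
    then have hm: "of_int m + 1/2 = complex_of_real (real n - 1/2)" by simp
    show ?thesis using w m(1) d unfolding hm k_def by blast
  qed
  then show ?thesis by blast
qed

text \<open>Stated for every zero in the annulus, so that the constant and the threshold depend on
  \<open>u\<close> alone and not on an enumeration.\<close>

lemma eigenvalue_asymptotics:
  "\<exists>M>0. \<exists>N. \<forall>n\<ge>N. \<forall>l. char_fn u l = 0 \<longrightarrow> (real n - 1)\<^sup>2 \<le> cmod l \<longrightarrow> cmod l < (real n)\<^sup>2 \<longrightarrow>
    cmod (csqrt l - (of_real (real n - 1/2) - 1 / of_real pi * vfun u pi (of_real ((real n - 1/2)\<^sup>2)))) \<le> M * (gammafun u l)\<^sup>2"
proof -
  obtain N1 where N1: "\<And>n l. n \<ge> N1 \<Longrightarrow> char_fn u l = 0 \<Longrightarrow> (real n - 1)\<^sup>2 \<le> cmod l \<Longrightarrow> cmod l < (real n)\<^sup>2 \<Longrightarrow>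
     cmod (1 + e2 (csqrt l) pi) \<le> 1/7 \<and>
     2 * pi * \<i> * (csqrt l - of_real (real n - 1/2)) = Ln (1 + (- e2 (csqrt l) pi - 1)) \<and>
     cmod (csqrt l - of_real (real n - 1/2)) \<le> 1/14"
    using root_location by blast
  \<comment> \<open>Bounds exp(2ikt) and exp(-2ikt) for |Im k| <= 1 and t in [0, pi], which covers
    the roots found by \<open>root_location\<close>.\<close>
  define K where "K = exp (2 * pi)"
  have K: "K \<ge> 1" by (simp add: K_def)
  obtain C1 where C1: "C1 \<ge> 0" "\<And>k b. osc_bound K k b \<Longrightarrow> cmod (amp k pi - amp (- k) pi - 2 * \<i> * vk k) \<le> C1 * b\<^sup>2"
    using amp_difference[OF K] by blast
  obtain C2 where C2: "C2 \<ge> 0" "\<And>k (\<kappa>::real) b. cmod k \<ge> 1 \<Longrightarrow> \<kappa> \<ge> 1 \<Longrightarrow> cmod (of_real \<kappa> - k) \<le> 1 \<Longrightarrow>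
     (\<forall>t\<in>{0..pi}. cmod (sin (2 * k * of_real t)) \<le> K \<and> cmod (cos (2 * k * of_real t)) \<le> K) \<Longrightarrow>
     (\<forall>x\<in>{0..pi}. cmod (So k x) \<le> b \<and> cmod (Co k x) \<le> b) \<Longrightarrow> U2 / cmod k \<le> b \<Longrightarrow>
     cmod (vk (of_real \<kappa>) - vk k) \<le> C2 * cmod (of_real \<kappa> - k) * b"
    using vk_variation[OF K] by blast
  define D where "D = K * (Cb (K * K) * K)"
  have D: "D \<ge> 0" using K Cb_pos[of "K * K"] by (auto simp: D_def)
  \<comment> \<open>21 = 18 + 3: 18 from linearizing the logarithm and 3 from replacing
    \<open>w\<close> by \<open>Q - P\<close>. \<open>C1\<close> comes from the expansion of
    \<open>P - Q\<close>, \<open>C2 * D\<close> from moving v to \<open>\<kappa>^2\<close>, and the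
    final 1 makes \<open>M\<close> positive.\<close>
  define M where "M = 21 * D\<^sup>2 + C1 + C2 * D + 1"
  have M: "M > 0" using C1(1) C2(1) D by (simp add: M_def add_nonneg_pos)
  have "cmod (csqrt l - (of_real (real n - 1/2) - 1 / of_real pi * vfun u pi (of_real ((real n - 1/2)\<^sup>2)))) \<le> M * (gammafun u l)\<^sup>2"
    if n: "n \<ge> N1 + 2" and l: "char_fn u l = 0" "(real n - 1)\<^sup>2 \<le> cmod l" "cmod l < (real n)\<^sup>2" for n l
  proof -
    define k where "k = csqrt l"
    define \<kappa> where "\<kappa> = real n - 1/2"
    define g where "g = gammafun u l"
    define w where "w = - e2 k pi - 1"
    note loc = N1[OF _ l, unfolded k_def[symmetric]]
    have w7: "cmod w \<le> 1/7"
    proof -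
      have "cmod w = cmod (1 + e2 k pi)" unfolding w_def by (metis add.commute norm_minus_cancel minus_add_distrib uminus_add_conv_diff)
      then show ?thesis using loc n by auto
    qed
    have Lw: "2 * pi * \<i> * (k - of_real \<kappa>) = Ln (1 + w)" and d14: "cmod (k - of_real \<kappa>) \<le> 1/14"
      using loc n by (auto simp: w_def \<kappa>_def)
    have \<kappa>1: "\<kappa> \<ge> 3/2" using n by (simp add: \<kappa>_def)
    have k1: "cmod k \<ge> 1"
    proof -
      have "\<kappa> = cmod (of_real \<kappa>)" using \<kappa>1 by simp
      also have "\<dots> \<le> cmod k + cmod (k - of_real \<kappa>)" by (metis norm_triangle_sub norm_minus_commute)
      finally show ?thesis using d14 \<kappa>1 by linarith
    qed
    have l0: "l \<noteq> 0" using k1 by (auto simp: k_def)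
    have "\<bar>Im (k - of_real \<kappa>)\<bar> \<le> 1/14" using d14 abs_Im_le_cmod order_trans by blast
    then have im: "\<bar>Im k\<bar> \<le> 1" by simp
    have eK: "cmod (e2 k t) \<le> K" "cmod (e2 (- k) t) \<le> K" if t: "t \<in> {0..pi}" for t
    proof -
      have "\<bar>Im k * t\<bar> \<le> 1 * pi" unfolding abs_mult using im t by (intro mult_mono) auto
      then have "- (2 * (Im k * t)) \<le> 2 * pi" "- (2 * (Im (- k) * t)) \<le> 2 * pi" by (auto simp: abs_le_iff mult.commute)
      then show "cmod (e2 k t) \<le> K" "cmod (e2 (- k) t) \<le> K" unfolding e2_norm K_def by (simp_all only: exp_le_cancel_iff)
    qed
    have SC: "cmod (So k x) + cmod (Co k x) \<le> g" if "x \<in> {0..pi}" for x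
      using gammafun_bounds(1)[OF l0 that] by (simp add: k_def g_def)
    have U: "U2 / cmod k \<le> g" using gammafun_bounds(2)[OF l0] by (simp add: k_def g_def)
    have SC': "cmod (So k x) \<le> g \<and> cmod (Co k x) \<le> g" if "x \<in> {0..pi}" for x
      using SC[OF that] norm_ge_zero[of "So k x"] norm_ge_zero[of "Co k x"] by linarith
    have g0: "g \<ge> 0" using SC'[of 0] norm_ge_zero order_trans by (metis atLeastAtMost_iff order_refl pi_ge_zero)
    have ob: "osc_bound K k g"
      unfolding osc_bound_def
    proof (intro conjI ballI k1 U eK)
      fix x assume x: "x \<in> {0..pi}"
      show "cmod (osc k x) \<le> g" unfolding osc_trig(1)[OF x]
        using SC[OF x] norm_triangle_ineq[of "Co k x" "\<i> * So k x"] by (simp add: norm_mult)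
      show "cmod (osc (- k) x) \<le> g" unfolding osc_trig(2)[OF x]
        using SC[OF x] norm_triangle_ineq4[of "Co k x" "\<i> * So k x"] by (simp add: norm_mult)
    qed
    define P where "P = amp k pi"
    define Q where "Q = amp (- k) pi"
    have P: "cmod (P - 1) \<le> D * g" and Q: "cmod (Q - 1) \<le> D * g"
      using amp_bound_osc[OF ob K, of pi] by (auto simp: P_def Q_def D_def mult_ac)
    have PQ: "cmod (P - Q - 2 * \<i> * vk k) \<le> C1 * g\<^sup>2" using C1(2)[OF ob] by (simp add: P_def Q_def)
    have Dg: "D * g \<ge> 0" using D g0 by simp
    have "e2 k pi * P + Q = 0" using char_fn_e2[of k] l(1) by (simp add: k_def P_def Q_def)
    \<comment> \<open>The characteristic equation reads \<open>P * (1 + w) = Q\<close>. Rewritten in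
      this way it compares \<open>w\<close> with \<open>Q - P\<close> without a division by
      \<open>P\<close>.\<close>
    then have wPQ: "w - (Q - P) = - ((P - 1) * w)" unfolding w_def by (simp add: algebra_simps add_eq_0_iff)
    \<comment> \<open>A bootstrap: the crude bound \<open>cmod w <= 1\<close> makes \<open>w\<close>
      of first order in \<open>g\<close>, and reinserting this in \<open>(P - 1) * w\<close> makes
      the error in \<open>n1\<close> quadratic.\<close>
    have w1: "cmod w \<le> 3 * (D * g)"
    proof -
      have "w = (Q - 1) - (P - 1) - (P - 1) * w" using wPQ by (simp add: algebra_simps)
      then have "cmod w \<le> cmod (Q - 1) + cmod (P - 1) + cmod ((P - 1) * w)"
        using norm_triangle_ineq4[of "(Q - 1) - (P - 1)" "(P - 1) * w"] norm_triangle_ineq4[of "Q - 1" "P - 1"] by simp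
      also have "cmod ((P - 1) * w) \<le> (D * g) * 1" unfolding norm_mult using P w7 Dg by (intro mult_mono) auto
      finally show ?thesis using P Q by simp
    qed
    have n1: "cmod (w - (Q - P)) \<le> 3 * (D * g)\<^sup>2"
    proof -
      have "cmod (w - (Q - P)) = cmod (P - 1) * cmod w" unfolding wPQ by (simp add: norm_mult)
      also have "\<dots> \<le> (D * g) * (3 * (D * g))" using P w1 Dg by (intro mult_mono) auto
      finally show ?thesis by (simp add: power2_eq_square)
    qed
    have n2: "cmod (Ln (1 + w) - w) \<le> 18 * (D * g)\<^sup>2"
    proof -
      have "cmod (Ln (1 + w) - w) \<le> (cmod w)\<^sup>2 / (1 - cmod w)" using Ln_approx_linear[of w] w7 by simp
      also have "\<dots> \<le> (cmod w)\<^sup>2 / (1/2)" using w7 by (intro divide_left_mono) auto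
      also have "\<dots> \<le> (3 * (D * g))\<^sup>2 / (1/2)" using w1 by (intro divide_right_mono power_mono) auto
      finally show ?thesis by (simp add: power_mult_distrib)
    qed
    define \<epsilon> where "\<epsilon> = k - of_real \<kappa>"
    have e1: "cmod \<epsilon> \<le> D * g"
    proof -
      have "2 * pi * cmod \<epsilon> = cmod (Ln (1 + w))" unfolding Lw[symmetric] \<epsilon>_def by (simp add: norm_mult)
      also have "\<dots> \<le> 6 * (D * g)" using norm_Ln_le[of w] w7 w1 by simp
      finally have "2 * pi * cmod \<epsilon> \<le> 6 * (D * g)" .
      moreover have "6 * cmod \<epsilon> \<le> 2 * pi * cmod \<epsilon>" using pi_gt3 by (intro mult_right_mono) auto
      ultimately show ?thesis by simp
    qed
    have "2 * pi * \<i> * \<epsilon> + 2 * \<i> * vk k = (Ln (1 + w) - w) + (w - (Q - P)) - (P - Q - 2 * \<i> * vk k)"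
      using Lw by (simp add: \<epsilon>_def)
    then have "cmod (2 * pi * \<i> * \<epsilon> + 2 * \<i> * vk k) \<le> 18 * (D * g)\<^sup>2 + 3 * (D * g)\<^sup>2 + C1 * g\<^sup>2"
      using norm_triangle_ineq4[of "(Ln (1 + w) - w) + (w - (Q - P))" "P - Q - 2 * \<i> * vk k"]
        norm_triangle_ineq[of "Ln (1 + w) - w" "w - (Q - P)"] n1 n2 PQ by simp
    moreover have "2 * pi * \<i> * \<epsilon> + 2 * \<i> * vk k = (2 * pi * \<i>) * (\<epsilon> + vk k / pi)" by (simp add: algebra_simps)
    then have "cmod (2 * pi * \<i> * \<epsilon> + 2 * \<i> * vk k) = 2 * pi * cmod (\<epsilon> + vk k / pi)" by (simp add: norm_mult)
    moreover have "1 * cmod (\<epsilon> + vk k / pi) \<le> 2 * pi * cmod (\<epsilon> + vk k / pi)" using pi_gt3 by (intro mult_right_mono) auto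
    ultimately have main: "cmod (\<epsilon> + vk k / pi) \<le> 21 * (D * g)\<^sup>2 + C1 * g\<^sup>2" by linarith
    have trigK: "cmod (sin (2 * k * of_real t)) \<le> K \<and> cmod (cos (2 * k * of_real t)) \<le> K" if t: "t \<in> {0..pi}" for t
    proof -
      have s: "2 * \<i> * sin (2 * k * of_real t) = e2 k t - e2 (- k) t" "2 * cos (2 * k * of_real t) = e2 k t + e2 (- k) t"
        unfolding e2_trig by simp_all
      have "2 * cmod (sin (2 * k * of_real t)) = cmod (e2 k t - e2 (- k) t)" unfolding s[symmetric] by (simp add: norm_mult)
      moreover have "2 * cmod (cos (2 * k * of_real t)) = cmod (e2 k t + e2 (- k) t)" unfolding s[symmetric] by (simp add: norm_mult)
      ultimately show ?thesis
        using eK[OF t] norm_triangle_ineq4[of "e2 k t" "e2 (- k) t"] norm_triangle_ineq[of "e2 k t" "e2 (- k) t"] by linarith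
    qed
    have "cmod (vk (of_real \<kappa>) - vk k) \<le> C2 * cmod (of_real \<kappa> - k) * g"
      using \<kappa>1 d14 trigK SC' U k1 by (intro C2(2)) (auto simp: norm_minus_commute)
    also have "\<dots> \<le> C2 * (D * g) * g"
      using C2(1) e1 g0 by (intro mult_right_mono mult_left_mono) (auto simp: \<epsilon>_def norm_minus_commute)
    finally have var: "cmod (vk (of_real \<kappa>) - vk k) \<le> C2 * D * g\<^sup>2" by (simp add: power2_eq_square mult_ac)
    have "cmod ((vk (of_real \<kappa>) - vk k) / pi) = cmod (vk (of_real \<kappa>) - vk k) / pi" by (simp add: norm_divide)
    also have "\<dots> \<le> cmod (vk (of_real \<kappa>) - vk k) / 1" using pi_gt3 by (intro divide_left_mono) auto
    finally have var': "cmod ((vk (of_real \<kappa>) - vk k) / pi) \<le> C2 * D * g\<^sup>2" using var by simp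
    have "csqrt (of_real (\<kappa>\<^sup>2)) = of_real \<kappa>" using \<kappa>1 by (subst csqrt_of_real_nonneg) (auto simp: real_sqrt_abs)
    then have vf: "vfun u pi (of_real (\<kappa>\<^sup>2)) = vk (of_real \<kappa>)" by (simp only: vfun_eq)
    have "k - (of_real \<kappa> - 1 / of_real pi * vk (of_real \<kappa>)) = (\<epsilon> + vk k / pi) + (vk (of_real \<kappa>) - vk k) / pi"
      by (simp add: \<epsilon>_def diff_divide_distrib)
    then have "cmod (k - (of_real \<kappa> - 1 / of_real pi * vk (of_real \<kappa>))) \<le> 21 * (D * g)\<^sup>2 + C1 * g\<^sup>2 + C2 * D * g\<^sup>2"
      using norm_triangle_ineq[of "\<epsilon> + vk k / pi" "(vk (of_real \<kappa>) - vk k) / pi"] main var' by simp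
    also have "\<dots> \<le> M * g\<^sup>2" by (simp add: M_def algebra_simps power_mult_distrib)
    finally show ?thesis using vf unfolding k_def \<kappa>_def g_def by simp
  qed
  then show ?thesis using M by blast
qed

end

theorem theorem1:
  fixes u :: "real \<Rightarrow> complex"
  assumes "L2_on_0pi u"
  shows "\<exists>lams. eig_enum u lams \<and>
           (\<exists>M>0. \<exists>N. \<forall>n\<ge>N.
              cmod (csqrt (lams n)
                    - (of_real (real n - 1/2)
                       - 1 / of_real pi * vfun u pi (of_real ((real n - 1/2)^2))))
              \<le> M * (gammafun u (lams n))^2)"
proof -
  interpret L2_potential u by unfold_locales (rule assms)
  obtain lams N0 where l: "eig_enum u lams"
    "\<And>n. n > N0 \<Longrightarrow> char_fn u (lams n) = 0 \<and> (real n - 1)\<^sup>2 \<le> cmod (lams n) \<and> cmod (lams n) < (real n)\<^sup>2"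
    using eig_enum_exists by blast
  obtain M N where M: "M > 0" and N: "\<And>n l. n \<ge> N \<Longrightarrow> char_fn u l = 0 \<Longrightarrow> (real n - 1)\<^sup>2 \<le> cmod l \<Longrightarrow> cmod l < (real n)\<^sup>2 \<Longrightarrow>
    cmod (csqrt l - (of_real (real n - 1/2) - 1 / of_real pi * vfun u pi (of_real ((real n - 1/2)\<^sup>2)))) \<le> M * (gammafun u l)\<^sup>2"
    using eigenvalue_asymptotics by blast
  have "\<forall>n \<ge> max N (Suc N0). cmod (csqrt (lams n)
      - (of_real (real n - 1/2) - 1 / of_real pi * vfun u pi (of_real ((real n - 1/2)^2)))) \<le> M * (gammafun u (lams n))^2"
    using l(2) N by simp
  with l(1) M show ?thesis by blast
qed

end
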